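(* For all $\delta>0$, $\mathcal F^\delta$ is real-analytic and convex (on the interval $(-1,1)$ where it is finite), and the sequence $\{\log W_n^\delta(X|Y)-\log W_n^\delta(X|X'):n\in\mathbb N\}$ satisfies the following large deviation principle. Define the open interval $(c_-,c_+)$, with $$c_\pm:=\lim_{p\to\pm1}\frac{d\mathcal F^\delta}{dp}<0.$$ Then, for every interval $J$ such that $J\cap(c_-,c_+)\neq\emptyset$, $$\lim_{n\to\infty}\frac1n\log\,(\mathbb P^\delta\otimes\tilde{\mathbb P}^\delta\otimes\mathbb P^\delta)\left\{\frac1n\log\left(\frac{W_n^\delta(X|Y)}{W_n^\delta(X|X')}\right)\in J\right\}=-\inf_{q\in J\cap(c_-,c_+)}\mathcal I^\delta(q),$$ where $\mathcal I^\delta$ is the Legendre transform of $\mathcal F^\delta$.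
   Context: Let $A$ be a finite set, $p(x,y)$ the transition matrix of an irreducible discrete-time Markov chain on $A$ with $p(x,x)=0$ for all $x$, and $c,\tilde c:A\to(0,\infty)$. (The real parameter $p$ below and in the claim is unrelated to the matrix $p(x,y)$, and $c_\pm$ is unrelated to the rates $c(x)$.) Consider the continuous-time Markov chains on $A$ with generators $$Lf(x)=\sum_{y\in A}c(x)p(x,y)(f(y)-f(x)),\qquad \tilde Lf(x)=\sum_{y\in A}\tilde c(x)p(x,y)(f(y)-f(x)),$$ with unique stationary distributions $\mu$ and $\tilde\mu$. $\mathbb P$ (resp. $\tilde{\mathbb P}$) is the path-space law of the chain with generator $L$ (resp. $\tilde L$) started from $\mu$ (resp. $\tilde\mu$). For $\delta>0$, $\mathbb P^\delta$ (resp. $\tilde{\mathbb P}^\delta$) is the law on $A^{\mathbb N}$ of the discretized chain $(X_{i\delta})_{i\ge0}$ under $\mathbb P$ (resp. $(Y_{i\delta})_{i\ge0}$ under $\tilde{\mathbb P}$). The discretizations of $(X,Y,X')$ have joint law $\mathbb P^\delta\otimes\tilde{\mathbb P}^\delta\otimes\mathbb P^\delta$. Waiting times: for $\delta>0$ and $n\ge 1$, $$W_n^\delta(X|Y)=\inf\{k\ge 1:(X_{\delta},X_{2\delta},\dots,X_{n\delta})=(Y_{(k+1)\delta},\dots,Y_{(k+n)\delta})\}$$ (with $\inf\emptyset=\infty$), and $W_n^\delta(X|X')$ is defined in the same way with $Y$ replaced by $X'$. The function $\mathcal F^\delta$ is defined for $p\in\mathbb R$ by $$\mathcal F^\delta(p):=\lim_{n\to\infty}\frac1{n\delta}\log\mathbb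 E_{\mathbb P^\delta\otimes\tilde{\mathbb P}^\delta\otimes\mathbb P^\delta}\left(\frac{W_n^\delta(X|Y)}{W_n^\delta(X|X')}\right)^p ;$$ it is shown in the paper to exist, to be finite for $p\in(-1,1)$ and to equal $+\infty$ for $|p|\ge1$.
   Formalization: The sign c_± < 0 is corrected to c_- < 0 < c_+ (claimed when c and c̃ differ); both factors 1/n in the large deviation limit are read as 1/(nδ), matching F^δ; J must have nonempty interior, as single points fail; F^δ is not taken to be +∞ for |p| ≥ 1. *)

theory Defs
  imports "HOL-Probability.Probability"
begin

section \<open>Continuous-time Markov chains on a finite state space\<close>

definition n_step :: "('a \<Rightarrow> 'a pmf) \<Rightarrow> nat \<Rightarrow> 'a \<Rightarrow> 'a pmf" where
  "n_step p n x = ((\<lambda>\<nu>. bind_pmf \<nu> p) ^^ n) (return_pmf x)"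

definition irreducible_chain :: "('a \<Rightarrow> 'a pmf) \<Rightarrow> bool" where
  "irreducible_chain p \<longleftrightarrow> (\<forall>x y. \<exists>n. 0 < pmf (n_step p n x) y)"

definition generator ::
    "('a::finite \<Rightarrow> real) \<Rightarrow> ('a \<Rightarrow> 'a pmf) \<Rightarrow> ('a \<Rightarrow> real) \<Rightarrow> 'a \<Rightarrow> real" where
  "generator c p f x = (\<Sum>y\<in>UNIV. c x * pmf (p x) y * (f y - f x))"

text \<open>The operator exponential of \<open>t L\<close>, applied to \<open>f\<close> and evaluated at \<open>x\<close>.\<close>

definition semigroup_of ::
    "(('a \<Rightarrow> real) \<Rightarrow> 'a \<Rightarrow> real) \<Rightarrow> real \<Rightarrow> ('a \<Rightarrow> real) \<Rightarrow> 'a \<Rightarrow> real" where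
  "semigroup_of L t f x = (\<Sum>k. t ^ k / fact k * (L ^^ k) f x)"

definition transition_prob ::
    "(('a \<Rightarrow> real) \<Rightarrow> 'a \<Rightarrow> real) \<Rightarrow> real \<Rightarrow> 'a \<Rightarrow> 'a \<Rightarrow> real" where
  "transition_prob L t x y = semigroup_of L t (indicator {y}) x"

definition stationary_dist :: "(('a \<Rightarrow> real) \<Rightarrow> 'a \<Rightarrow> real) \<Rightarrow> 'a pmf \<Rightarrow> bool" where
  "stationary_dist L \<mu> \<longleftrightarrow>
     (\<forall>t\<ge>0. \<forall>f. measure_pmf.expectation \<mu> (semigroup_of L t f) = measure_pmf.expectation \<mu> f)"

text \<open>
  The process \<open>X\<close>, indexed by times \<open>t \<ge> 0\<close>, is a realization on \<open>M\<close> of the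
  chain with generator \<open>L\<close> and initial law \<open>\<mu>\<close>: it has cadlag paths (for the discrete
  topology on the state space) and the Markovian finite-dimensional distributions.
\<close>

definition markov_realization ::
    "(('a::finite \<Rightarrow> real) \<Rightarrow> 'a \<Rightarrow> real) \<Rightarrow> 'a pmf \<Rightarrow> 'w measure \<Rightarrow> (real \<Rightarrow> 'w \<Rightarrow> 'a) \<Rightarrow> bool" where
  "markov_realization L \<mu> M X \<longleftrightarrow>
     prob_space M \<and>
     (\<forall>t\<ge>0. X t \<in> measurable M (count_space UNIV)) \<and>
     (\<forall>w\<in>space M. \<forall>t\<ge>0. \<forall>\<^sub>F s in at_right t. X s w = X t w) \<and>
     (\<forall>w\<in>space M. \<forall>t>0. \<exists>a. \<forall>\<^sub>F s in at_left t. X s w = a) \<and>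
     (\<forall>n (t::nat \<Rightarrow> real) x. t 0 = 0 \<longrightarrow> (\<forall>i<n. t i \<le> t (Suc i)) \<longrightarrow>
        measure M {w \<in> space M. \<forall>i\<le>n. X (t i) w = x i} =
          pmf \<mu> (x 0) * (\<Prod>i<n. transition_prob L (t (Suc i) - t i) (x i) (x (Suc i))))"

definition discretized_law ::
    "real \<Rightarrow> 'w measure \<Rightarrow> (real \<Rightarrow> 'w \<Rightarrow> 'a) \<Rightarrow> (nat \<Rightarrow> 'a) measure" where
  "discretized_law \<delta> M X =
     distr M (\<Pi>\<^sub>M i\<in>UNIV. count_space UNIV) (\<lambda>w i. X (real i * \<delta>) w)"

section \<open>Extended logarithm and power\<close>

definition ln_ennreal :: "ennreal \<Rightarrow> ereal" where
  "ln_ennreal r = (if r = 0 then -\<infinity> else if r = \<infinity> then \<infinity> else ereal (ln (enn2real r)))"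

definition powr_ennreal :: "ennreal \<Rightarrow> real \<Rightarrow> ennreal" where
  "powr_ennreal r p =
     (if p = 0 then 1
      else if r = 0 then (if p > 0 then 0 else \<infinity>)
      else if r = \<infinity> then (if p > 0 then \<infinity> else 0)
      else ennreal (enn2real r powr p))"

section \<open>Waiting times\<close>

text \<open>Sequences are the discretized chains: \<open>x i\<close> is the state at time \<open>i \<delta>\<close>.
  The infimum of the empty set is \<open>\<infinity>\<close>.\<close>

definition waiting_time :: "nat \<Rightarrow> (nat \<Rightarrow> 'a) \<Rightarrow> (nat \<Rightarrow> 'a) \<Rightarrow> ennreal" where
  "waiting_time n x y = (INF k \<in> {k. 1 \<le> k \<and> (\<forall>i\<in>{1..n}. x i = y (k + i))}. of_nat k)"

text \<open>Triples are \<open>(X, Y, X')\<close>. The indeterminate quotient of two infinite waiting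
  times is harmless: all waiting times are almost surely finite.\<close>

definition waiting_ratio ::
    "nat \<Rightarrow> (nat \<Rightarrow> 'a) \<times> (nat \<Rightarrow> 'a) \<times> (nat \<Rightarrow> 'a) \<Rightarrow> ennreal" where
  "waiting_ratio n = (\<lambda>(x, y, x'). waiting_time n x y / waiting_time n x x')"

definition scaled_log_moment ::
    "((nat \<Rightarrow> 'a) \<times> (nat \<Rightarrow> 'a) \<times> (nat \<Rightarrow> 'a)) measure \<Rightarrow> real \<Rightarrow> nat \<Rightarrow> real \<Rightarrow> ereal" where
  "scaled_log_moment Q \<delta> n p =
     ereal (1 / (real n * \<delta>)) *
       ln_ennreal (\<integral>\<^sup>+ \<omega>. powr_ennreal (waiting_ratio n \<omega>) p \<partial>Q)"

definition limit_log_moment ::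
    "((nat \<Rightarrow> 'a) \<times> (nat \<Rightarrow> 'a) \<times> (nat \<Rightarrow> 'a)) measure \<Rightarrow> real \<Rightarrow> real \<Rightarrow> ereal" where
  "limit_log_moment Q \<delta> p = lim (\<lambda>n. scaled_log_moment Q \<delta> n p)"

section \<open>Convex analysis and analyticity on the real line\<close>

definition legendre_transform :: "(real \<Rightarrow> ereal) \<Rightarrow> real \<Rightarrow> ereal" where
  "legendre_transform F q = (SUP p. ereal (p * q) - F p)"

definition real_analytic_on :: "(real \<Rightarrow> real) \<Rightarrow> real set \<Rightarrow> bool" where
  "real_analytic_on f S \<longleftrightarrow>
     (\<forall>x\<in>S. \<exists>r>0. \<exists>a. \<forall>y. \<bar>y - x\<bar> < r \<longrightarrow> (\<lambda>n. a n * (y - x) ^ n) sums f y)"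

end

(*
  The discretized chains have strictly positive kernels P and P'. Given the word a that X spells,
  both waiting times are of the order of the reciprocal of the stationary probability of a, up to
  factors polynomial in n, with one exception: for s <= -1 the s-th moment of a waiting time is
  governed by the event that the waiting time is 1, so that moments below -1 decay only like the
  probability itself. Summing over a, the s-th moment of the ratio grows like the n-th power of
  the Perron root of P^(1 + min s 1) P'^(-max s (-1)) (entrywise powers). For |s| <= 1 this is the
  tilted kernel P exp(s ln(P/P')); its logarithmic Perron root, the pressure, is convex by
  Hoelder's inequality. It is analytic because the iterates of the complex tilted operator have no
  zeros near the real axis (a complex cone is preserved), so their normalized n-th roots form a
  normal family.

  The pressure vanishes at 0 and -1. If two of its slopes coincided it would vanish identically,
  which forces P = P' and then c = c'. So for c and c' distinct it is strictly convex, and the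
  large deviation bounds follow as in the Gaertner-Ellis theorem, by exponential tilting with
  parameters in (-1, 1). Outside [-1, 1] the limit still dominates the pressure, hence the Legendre
  transform at slopes attained in (-1, 1) is that of the pressure.
*)

theory Submission
  imports Defs "HOL-Complex_Analysis.Complex_Analysis" "HOL-Real_Asymp.Real_Asymp"
begin

subsection \<open>Positive kernels on a finite set\<close>

text \<open>The pressure is analytic on the whole line but agrees with the moment limit on [-1, 1]
  only. Its slopes at -1 and 1 are the limits c_minus and c_plus, and strict monotonicity makes the
  slopes at parameters in (-1, 1) exactly the points of (c_minus, c_plus). By Rolle a zero slope
  lies strictly between -1 and 0, which gives c_minus < 0 < c_plus. For c = c' the pressure is
  identically zero and the interval of slopes is empty. Intervals without interior are excluded
  because a quotient of finite waiting times is rational: fixing a single value of its logarithm may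
  be an event of probability zero for every n. All logarithms are divided by n \<delta>, in
  agreement with F. Every exponential rate is read off from the growth of
  \<open>transfer K ^^ n\<close> at the constant function 1. This quantity is a sum over words,
  hence accessible from moments, and it depends holomorphically on the tilt, hence accessible to
  complex analysis.\<close>

definition transfer :: "('a::finite \<Rightarrow> 'a \<Rightarrow> 'b::comm_semiring_1) \<Rightarrow> ('a \<Rightarrow> 'b) \<Rightarrow> 'a \<Rightarrow> 'b" where
  "transfer K f x = (\<Sum>y\<in>UNIV. K x y * f y)"

fun word_weight :: "('a \<Rightarrow> 'a \<Rightarrow> 'b::comm_semiring_1) \<Rightarrow> 'a list \<Rightarrow> 'b" where
  "word_weight K (x # y # l) = K x y * word_weight K (y # l)"
| "word_weight K [x] = 1"
| "word_weight K [] = 1"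

lemma words_Suc: "{l. length l = Suc n} = (\<lambda>(y, l). y # l) ` (UNIV \<times> {l. length l = n})"
  by (auto simp: length_Suc_conv image_iff)

lemma finite_words [simp]: "finite {l :: 'a::finite list. length l = n}"
  using finite_lists_length_eq[OF finite, of UNIV n] by simp

lemma sum_words_Suc:
  fixes f :: "'a::finite list \<Rightarrow> 'b::comm_monoid_add"
  shows "(\<Sum>l | length l = Suc n. f l) = (\<Sum>y\<in>UNIV. \<Sum>l | length l = n. f (y # l))"
  unfolding words_Suc
  by (subst sum.reindex) (auto simp: inj_on_def sum.cartesian_product intro!: sum.cong)

text \<open>Links operator growth to sums over words: a path of n steps from x is a word with n
  letters after x.\<close>

lemma transfer_power_one:
  "(transfer K ^^ n) (\<lambda>_. 1) x = (\<Sum>l | length l = n. word_weight K (x # l))"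
proof (induction n arbitrary: x)
  case 0
  have "{l::'a list. length l = 0} = {[]}" by auto
  then show ?case by simp
next
  case (Suc n)
  then show ?case
    by (simp add: sum_words_Suc transfer_def sum_distrib_left)
qed

lemma sum_word_weight:
  "(\<Sum>l | length l = Suc n. word_weight K l) = (\<Sum>x\<in>UNIV. (transfer K ^^ n) (\<lambda>_. 1) x)"
  by (simp add: sum_words_Suc transfer_power_one)

lemma transfer_mono:
  fixes K :: "'a::finite \<Rightarrow> 'a \<Rightarrow> real"
  assumes "\<And>x y. 0 < K x y" "\<And>x. f x \<le> g x"
  shows "transfer K f x \<le> transfer K g x"
  unfolding transfer_def by (intro sum_mono mult_left_mono) (auto simp: assms less_imp_le)

lemma transfer_scale:
  fixes K :: "'a::finite \<Rightarrow> 'a \<Rightarrow> real"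
  shows "transfer K (\<lambda>x. t * f x) = (\<lambda>x. t * transfer K f x)"
  unfolding transfer_def by (auto simp: sum_distrib_left algebra_simps)

lemma transfer_pos:
  fixes K :: "'a::finite \<Rightarrow> 'a \<Rightarrow> real"
  assumes "\<And>x y. 0 < K x y" "\<And>x. 0 < f x"
  shows "0 < transfer K f x"
  unfolding transfer_def by (intro sum_pos) (auto simp: assms)

lemma transfer_power_mono:
  fixes K :: "'a::finite \<Rightarrow> 'a \<Rightarrow> real"
  assumes "\<And>x y. 0 < K x y" "\<And>x. f x \<le> g x"
  shows "(transfer K ^^ n) f x \<le> (transfer K ^^ n) g x"
  using assms(2) by (induction n arbitrary: x) (auto intro!: transfer_mono assms(1))

lemma transfer_power_scale:
  fixes K :: "'a::finite \<Rightarrow> 'a \<Rightarrow> real"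
  shows "(transfer K ^^ n) (\<lambda>x. t * f x) = (\<lambda>x. t * (transfer K ^^ n) f x)"
  by (induction n) (auto simp: transfer_scale)

lemma transfer_power_pos:
  fixes K :: "'a::finite \<Rightarrow> 'a \<Rightarrow> real"
  assumes "\<And>x y. 0 < K x y"
  shows "0 < (transfer K ^^ n) (\<lambda>_. 1) x"
  by (induction n arbitrary: x) (auto intro!: transfer_pos assms)

section \<open>Positive eigenvectors, the Perron root and the growth of iterates\<close>

lemma transfer_power_eigen:
  fixes K :: "'a::finite \<Rightarrow> 'a \<Rightarrow> real"
  assumes "\<And>x. transfer K v x = r * v x"
  shows "(transfer K ^^ n) v = (\<lambda>x. r ^ n * v x)"
proof (induction n)
  case (Suc n)
  have "transfer K (\<lambda>x. r ^ n * v x) = (\<lambda>x. r ^ n * (r * v x))"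
    by (simp add: transfer_scale assms)
  then show ?case
    by (simp add: Suc mult_ac)
qed simp

text \<open>The choice is harmless: squeezing the constant 1 between multiples of a positive
  eigenvector identifies the eigenvalue with the growth rate of the iterates.\<close>

definition perron_root :: "('a::finite \<Rightarrow> 'a \<Rightarrow> real) \<Rightarrow> real" where
  "perron_root K = (SOME r. 0 < r \<and> (\<exists>v. (\<forall>x. 0 < v x) \<and> (\<forall>x. transfer K v x = r * v x)))"

text \<open>The normalised operator maps the probability simplex to itself, so Brouwer's theorem
  provides an eigenvector.\<close>

lemma perron_exists:
  fixes K :: "'a::finite \<Rightarrow> 'a \<Rightarrow> real"
  assumes K: "\<And>x y. 0 < K x y"
  shows "\<exists>r. 0 < r \<and> (\<exists>v. (\<forall>x. 0 < v x) \<and> (\<forall>x. transfer K v x = r * v x))"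
proof -
  define S where "S = {v::real^'a. (\<forall>i. 0 \<le> v $ i) \<and> (\<Sum>i\<in>UNIV. v $ i) = 1}"
  define N where "N v = (\<Sum>j\<in>UNIV. transfer K (($) v) j)" for v :: "real^'a"
  define f where "f v = (\<chi> i. transfer K (($) v) i / N v)" for v :: "real^'a"
  have T_pos: "0 < transfer K (($) v) i" if "v \<in> S" for v i
  proof -
    have "\<not> (\<forall>j. v $ j = 0)"
    proof
      assume "\<forall>j. v $ j = 0"
      then have "(\<Sum>j\<in>UNIV. v $ j) = 0" by simp
      then show False using that by (simp add: S_def)
    qed
    then obtain j where "v $ j \<noteq> 0" by blast
    then have j: "0 < v $ j"
      using that by (auto simp: S_def order_less_le)
    have "0 < K i j * v $ j" using j K by simp
    also have "\<dots> \<le> transfer K (($) v) i"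
      unfolding transfer_def
      by (rule member_le_sum) (use that K in \<open>auto simp: S_def less_imp_le\<close>)
    finally show ?thesis .
  qed
  have N_pos: "0 < N v" if "v \<in> S" for v
    unfolding N_def by (intro sum_pos) (auto simp: T_pos that)
  have cont_T: "continuous_on S (\<lambda>v. transfer K (($) v) i)" for i
    unfolding transfer_def by (intro continuous_intros)
  have cont: "continuous_on S f"
    unfolding f_def N_def
    using N_pos by (intro continuous_intros cont_T) (auto simp: N_def less_imp_neq[symmetric])
  have "bounded S"
  proof (rule boundedI)
    fix v assume v: "v \<in> S"
    have "norm v \<le> (\<Sum>i\<in>UNIV. \<bar>v $ i\<bar>)" by (rule norm_le_l1_cart)
    also have "\<dots> = 1" using v by (simp add: S_def)
    finally show "norm v \<le> 1" .
  qed
  moreover have "closed S"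
    unfolding S_def by (intro closed_Collect_conj closed_Collect_all closed_Collect_le closed_Collect_eq continuous_intros)
  ultimately have "compact S" by (simp add: compact_eq_bounded_closed)
  moreover have "convex S"
    unfolding S_def convex_def
    by (auto simp: sum.distrib sum_distrib_left[symmetric])
  moreover have "(\<chi> i. 1 / real CARD('a)) \<in> S" by (simp add: S_def)
  moreover have "f \<in> S \<rightarrow> S"
  proof
    fix v assume v: "v \<in> S"
    have "(\<Sum>i\<in>UNIV. f v $ i) = 1"
      using N_pos[OF v] by (simp add: f_def N_def sum_divide_distrib[symmetric])
    then show "f v \<in> S"
      using T_pos[OF v] N_pos[OF v] by (simp add: S_def f_def less_imp_le)
  qed
  ultimately obtain v where v: "v \<in> S" "f v = v"
    using brouwer[of S f] cont by blast
  have "transfer K (($) v) i = N v * v $ i" for i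
  proof -
    have "v $ i = f v $ i" using v(2) by simp
    then show ?thesis using N_pos[OF v(1)] by (simp add: f_def field_simps)
  qed
  moreover have "0 < v $ i" for i
    using T_pos[OF v(1), of i] N_pos[OF v(1)] \<open>transfer K (($) v) i = N v * v $ i\<close>
    by (metis zero_less_mult_pos)
  ultimately show ?thesis using N_pos[OF v(1)] by blast
qed

lemma perron_vector:
  fixes K :: "'a::finite \<Rightarrow> 'a \<Rightarrow> real"
  assumes "\<And>x y. 0 < K x y"
  obtains v where "\<And>x. 0 < v x" "\<And>x. transfer K v x = perron_root K * v x"
  using someI_ex[OF perron_exists[of K, OF assms]] unfolding perron_root_def by blast

lemma perron_root_pos:
  fixes K :: "'a::finite \<Rightarrow> 'a \<Rightarrow> real"
  assumes "\<And>x y. 0 < K x y"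
  shows "0 < perron_root K"
  using someI_ex[OF perron_exists[of K, OF assms]] unfolding perron_root_def by blast

lemma finite_pos_bounds:
  fixes v :: "'a::finite \<Rightarrow> real"
  assumes "\<And>x. 0 < v x"
  obtains m where "0 < m" "\<And>x. m \<le> v x"
proof
  show "0 < Min (range v)" using assms by (auto simp: Min_gr_iff)
  show "Min (range v) \<le> v x" for x by simp
qed

lemma finite_upper_bound:
  fixes v :: "'a::finite \<Rightarrow> real"
  obtains m where "0 < m" "\<And>x. v x \<le> m"
proof
  show "0 < max 1 (Max (range v))" by simp
  show "v x \<le> max 1 (Max (range v))" for x by (simp add: le_max_iff_disj)
qed

text \<open>The constant 1 lies between two multiples of the positive eigenvector, on which the
  operator acts by scaling. The ratio of an upper to a lower bound for its entries serves as C for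
  all n.\<close>

lemma transfer_power_bounds:
  fixes K :: "'a::finite \<Rightarrow> 'a \<Rightarrow> real"
  assumes K: "\<And>x y. 0 < K x y"
  obtains C where "1 \<le> C"
    "\<And>n x. perron_root K ^ n / C \<le> (transfer K ^^ n) (\<lambda>_. 1) x"
    "\<And>n x. (transfer K ^^ n) (\<lambda>_. 1) x \<le> C * perron_root K ^ n"
proof -
  let ?r = "perron_root K"
  obtain v where v: "\<And>x. 0 < v x" "\<And>x. transfer K v x = ?r * v x"
    using perron_vector K by blast
  obtain a where a: "0 < a" "\<And>x. a \<le> v x" using finite_pos_bounds v(1) by blast
  obtain b where b: "0 < b" "\<And>x. v x \<le> b" using finite_upper_bound by blast
  have ab: "a \<le> b" using a(2) b(2) order_trans by blast
  have r: "0 < ?r" using perron_root_pos K by blast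
  show ?thesis
  proof (rule that[of "b / a"])
    show "1 \<le> b / a" using ab a by simp
    fix n x
    have eig: "(transfer K ^^ n) v x = ?r ^ n * v x"
      using transfer_power_eigen[OF v(2)] by metis
    have "(transfer K ^^ n) v x \<le> (transfer K ^^ n) (\<lambda>x. b * 1) x"
      by (rule transfer_power_mono) (auto simp: K b)
    then have "?r ^ n * v x \<le> b * (transfer K ^^ n) (\<lambda>_. 1) x"
      using transfer_power_scale[of n K b "\<lambda>_. 1"] eig by simp
    moreover have "?r ^ n * a \<le> ?r ^ n * v x"
      using r a by (intro mult_left_mono) auto
    ultimately show "?r ^ n / (b / a) \<le> (transfer K ^^ n) (\<lambda>_. 1) x"
      using b(1) a(1) by (simp add: field_simps)
    have "(transfer K ^^ n) (\<lambda>x. a * 1) x \<le> (transfer K ^^ n) v x"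
      by (rule transfer_power_mono) (auto simp: K a)
    then have "a * (transfer K ^^ n) (\<lambda>_. 1) x \<le> ?r ^ n * v x"
      using transfer_power_scale[of n K a "\<lambda>_. 1"] eig by simp
    moreover have "?r ^ n * v x \<le> ?r ^ n * b"
      using r b by (intro mult_left_mono) auto
    ultimately show "(transfer K ^^ n) (\<lambda>_. 1) x \<le> b / a * ?r ^ n"
      using b(1) a(1) by (simp add: field_simps)
  qed
qed

text \<open>Subexponential factors do not change a rate. The factor D is constant for operator
  iterates and polynomial in n for moments.\<close>

lemma ln_power_rate:
  fixes r C :: real and Z D :: "nat \<Rightarrow> real"
  assumes "0 < r" and D: "\<And>n. 0 < D n" "(\<lambda>n. ln (D n) / real n) \<longlonglongrightarrow> 0"
    and bounds: "\<And>n. 1 \<le> n \<Longrightarrow> r ^ n / D n \<le> Z n" "\<And>n. 1 \<le> n \<Longrightarrow> Z n \<le> D n * r ^ n"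
  shows "(\<lambda>n. ln (Z n) / real n) \<longlonglongrightarrow> ln r"
proof (rule tendsto_sandwich)
  have pos: "0 < Z n" if "1 \<le> n" for n
    using bounds(1)[OF that] D(1)[of n] \<open>0 < r\<close> by (metis divide_pos_pos less_le_trans zero_less_power)
  show "\<forall>\<^sub>F n in sequentially. ln r - ln (D n) / real n \<le> ln (Z n) / real n"
  proof (rule eventually_sequentiallyI[of 1])
    fix n :: nat assume n: "1 \<le> n"
    have "ln (r ^ n / D n) \<le> ln (Z n)" using bounds(1)[OF n] D(1)[of n] \<open>0 < r\<close> pos[OF n] by simp
    then have "real n * ln r - ln (D n) \<le> ln (Z n)" using D(1)[of n] \<open>0 < r\<close> by (simp add: ln_div ln_realpow)
    then have "(real n * ln r - ln (D n)) / real n \<le> ln (Z n) / real n" by (rule divide_right_mono) simp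
    then show "ln r - ln (D n) / real n \<le> ln (Z n) / real n" using n by (simp add: diff_divide_distrib)
  qed
  show "\<forall>\<^sub>F n in sequentially. ln (Z n) / real n \<le> ln r + ln (D n) / real n"
  proof (rule eventually_sequentiallyI[of 1])
    fix n :: nat assume n: "1 \<le> n"
    have "ln (Z n) \<le> ln (D n * r ^ n)" using bounds(2)[OF n] D(1)[of n] \<open>0 < r\<close> pos[OF n] by simp
    then have "ln (Z n) \<le> real n * ln r + ln (D n)" using D(1)[of n] \<open>0 < r\<close> by (simp add: ln_mult ln_realpow)
    then have "ln (Z n) / real n \<le> (real n * ln r + ln (D n)) / real n" by (rule divide_right_mono) simp
    then show "ln (Z n) / real n \<le> ln r + ln (D n) / real n" using n by (simp add: add_divide_distrib)
  qed
  show "(\<lambda>n. ln r - ln (D n) / real n) \<longlonglongrightarrow> ln r"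
    using tendsto_diff[OF tendsto_const D(2), of "ln r"] by simp
  show "(\<lambda>n. ln r + ln (D n) / real n) \<longlonglongrightarrow> ln r"
    using tendsto_add[OF tendsto_const D(2), of "ln r"] by simp
qed

lemma const_subexponential: "(\<lambda>n. ln C / real n) \<longlonglongrightarrow> (0::real)"
  by real_asymp

lemma perron_root_limit:
  fixes K :: "'a::finite \<Rightarrow> 'a \<Rightarrow> real"
  assumes K: "\<And>x y. 0 < K x y"
  shows "(\<lambda>n. ln ((transfer K ^^ n) (\<lambda>_. 1) x) / real n) \<longlonglongrightarrow> ln (perron_root K)"
proof -
  obtain C where "1 \<le> C"
    "\<And>n x. perron_root K ^ n / C \<le> (transfer K ^^ n) (\<lambda>_. 1) x"
    "\<And>n x. (transfer K ^^ n) (\<lambda>_. 1) x \<le> C * perron_root K ^ n"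
    using transfer_power_bounds K by blast
  then show ?thesis
    using perron_root_pos[of K, OF K] const_subexponential[of C] by (intro ln_power_rate[where D = "\<lambda>_. C"]) auto
qed

text \<open>Collatz-Wielandt bound: scale the test function v by the largest ratio of the
  eigenvector to v, so that the two touch at some x, and compare the images at x.\<close>

lemma perron_root_le:
  fixes K :: "'a::finite \<Rightarrow> 'a \<Rightarrow> real"
  assumes K: "\<And>x y. 0 < K x y" and v: "\<And>x. 0 < v x" and le: "\<And>x. transfer K v x \<le> r * v x"
  shows "perron_root K \<le> r"
proof -
  obtain w where w: "\<And>x. 0 < w x" "\<And>x. transfer K w x = perron_root K * w x"
    using perron_vector K by blast
  define t where "t = Max (range (\<lambda>x. w x / v x))"
  have "t \<in> range (\<lambda>x. w x / v x)" unfolding t_def by (rule Max_in) auto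
  then obtain x where x: "t = w x / v x" by auto
  have t: "w y \<le> t * v y" for y
  proof -
    have "w y / v y \<le> t" unfolding t_def by simp
    then show ?thesis using v[of y] by (simp add: field_simps)
  qed
  have t0: "0 < t" using x v w by simp
  have "perron_root K * w x \<le> transfer K (\<lambda>y. t * v y) x"
    using transfer_mono[of K w "\<lambda>y. t * v y" x, OF K t] w by simp
  also have "\<dots> \<le> t * (r * v x)"
    unfolding transfer_scale using le t0 by (intro mult_left_mono) auto
  also have "\<dots> = r * w x" using x v[of x] by simp
  finally show ?thesis using w(1)[of x] by simp
qed

lemma perron_root_stochastic:
  fixes K :: "'a::finite \<Rightarrow> 'a \<Rightarrow> real"
  assumes K: "\<And>x y. 0 < K x y" and st: "\<And>x. (\<Sum>y\<in>UNIV. K x y) = 1"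
  shows "perron_root K = 1"
proof -
  have "(transfer K ^^ n) (\<lambda>_. 1) = (\<lambda>_. 1)" for n
    by (induction n) (auto simp: transfer_def st)
  then have "(\<lambda>n. 0::real) \<longlonglongrightarrow> ln (perron_root K)"
    using perron_root_limit[of K, OF K] by simp
  then have "ln (perron_root K) = 0" using LIMSEQ_unique tendsto_const by blast
  then show ?thesis using perron_root_pos[of K, OF K] by simp
qed

subsection \<open>Exponentially tilted kernels\<close>

definition tilted :: "('a \<Rightarrow> 'a \<Rightarrow> real) \<Rightarrow> ('a \<Rightarrow> 'a \<Rightarrow> real) \<Rightarrow> real \<Rightarrow> 'a \<Rightarrow> 'a \<Rightarrow> real" where
  "tilted A b s x y = A x y * exp (s * b x y)"

definition ctilted :: "('a \<Rightarrow> 'a \<Rightarrow> real) \<Rightarrow> ('a \<Rightarrow> 'a \<Rightarrow> real) \<Rightarrow> complex \<Rightarrow> 'a \<Rightarrow> 'a \<Rightarrow> complex" where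
  "ctilted A b z x y = of_real (A x y) * exp (z * of_real (b x y))"

text \<open>Any two entries differ in argument by at most a quarter of pi. The products with
  conjugates make the condition invariant under a common complex factor, and x = y shows that no
  entry vanishes.\<close>

definition in_cone :: "('a \<Rightarrow> complex) \<Rightarrow> bool" where
  "in_cone u \<longleftrightarrow> (\<forall>x y. 0 < Re (u x * cnj (u y)) \<and> \<bar>Im (u x * cnj (u y))\<bar> \<le> Re (u x * cnj (u y)))"

lemma tilted_pos: "(\<And>x y. 0 < A x y) \<Longrightarrow> 0 < tilted A b s x y"
  by (simp add: tilted_def)

lemma ctilted_cis: "ctilted A b z x y = of_real (tilted A b (Re z) x y) * cis (Im z * b x y)"
  unfolding ctilted_def tilted_def
  by (rule complex_eqI) (auto simp: Re_exp Im_exp algebra_simps)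

lemma one_minus_cos_le: "1 - cos d \<le> \<bar>d::real\<bar>"
proof -
  have "1 - cos d = 2 * (sin (d / 2))\<^sup>2"
    using cos_double_sin[of "d / 2"] by simp
  also have "\<dots> = 2 * (\<bar>sin (d / 2)\<bar> * \<bar>sin (d / 2)\<bar>)" by (simp add: power2_eq_square)
  also have "\<dots> \<le> 2 * (\<bar>sin (d / 2)\<bar> * 1)"
    by (intro mult_left_mono) auto
  also have "\<dots> \<le> \<bar>d\<bar>" using abs_sin_x_le_abs_x[of "d / 2"] by simp
  finally show ?thesis .
qed

text \<open>The imaginary part of \<open>Tu(x) \<cdot> cnj (Tu(x'))\<close> is a sum of terms antisymmetric in the two
  summation indices. Antisymmetrising the positive weights as well gains a factor \<open>1 - r\<close>,
  which absorbs small phases of the kernel.\<close>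

lemma in_cone_transfer:
  fixes K \<phi> :: "'a::finite \<Rightarrow> 'a \<Rightarrow> real"
  assumes K: "\<And>x y. 0 < K x y"
    and r: "\<And>x y x' y'. r * (K x y * K x' y') \<le> K x y' * K x' y" "0 < r" "r \<le> 1"
    and \<phi>: "\<And>x y x' y'. \<bar>\<phi> x y - \<phi> x' y'\<bar> \<le> \<eta>" and \<eta>: "4 * \<eta> \<le> r"
    and u: "in_cone u"
  shows "in_cone (transfer (\<lambda>x y. of_real (K x y) * cis (\<phi> x y)) u)" (is "in_cone ?Tu")
  unfolding in_cone_def
proof (intro allI)
  fix x x'
  define w where "w y y' = u y * cnj (u y')" for y y'
  define a where "a y y' = K x y * K x' y'" for y y'
  define d where "d y y' = \<phi> x y - \<phi> x' y'" for y y'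
  define R where "R = (\<Sum>y\<in>UNIV. \<Sum>y'\<in>UNIV. a y y' * Re (w y y'))"
  have \<eta>0: "0 \<le> \<eta>" using \<phi> abs_ge_zero order_trans by blast
  have w: "0 < Re (w y y')" "\<bar>Im (w y y')\<bar> \<le> Re (w y y')" for y y'
    using u by (auto simp: in_cone_def w_def)
  have w_sym: "Re (w y' y) = Re (w y y')" "Im (w y' y) = - Im (w y y')" for y y'
    by (auto simp: w_def)
  have a: "0 < a y y'" for y y' using K by (simp add: a_def)
  have R_pos: "0 < R" unfolding R_def using a w by (intro sum_pos) auto
  have prod: "?Tu x * cnj (?Tu x') =
      (\<Sum>y\<in>UNIV. \<Sum>y'\<in>UNIV. of_real (a y y') * (cis (d y y') * w y y'))"
    unfolding transfer_def cnj_sum sum_product a_def d_def w_def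
    by (intro sum.cong refl) (simp add: cis_cnj cis_divide[symmetric] divide_inverse)
  have sd: "\<bar>sin (d y y')\<bar> \<le> \<eta>" for y y'
    using abs_sin_x_le_abs_x[of "d y y'"] \<phi> by (auto simp: d_def intro: order_trans)
  have cd: "1 - cos (d y y') \<le> \<eta>" for y y'
    using one_minus_cos_le[of "d y y'"] \<phi> by (auto simp: d_def intro: order_trans)
  \<comment> \<open>A phase of size \<eta> costs at most \<eta> through the cosine and \<eta>
    through the sine, because imaginary parts are dominated by real parts in the cone.\<close>
  have Re_ge: "(1 - 2 * \<eta>) * R \<le> Re (?Tu x * cnj (?Tu x'))"
  proof -
    have "(1 - 2 * \<eta>) * R = (\<Sum>y\<in>UNIV. \<Sum>y'\<in>UNIV. a y y' * ((1 - 2 * \<eta>) * Re (w y y')))"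
      unfolding R_def sum_distrib_left by (intro sum.cong refl) simp
    also have "\<dots> \<le> (\<Sum>y\<in>UNIV. \<Sum>y'\<in>UNIV. a y y' * Re (cis (d y y') * w y y'))"
    proof (intro sum_mono mult_left_mono)
      fix y y'
      have "sin (d y y') * Im (w y y') \<le> \<bar>sin (d y y')\<bar> * \<bar>Im (w y y')\<bar>"
        by (metis abs_ge_self abs_mult)
      also have "\<dots> \<le> \<eta> * Re (w y y')" by (intro mult_mono sd w) (auto simp: \<eta>0)
      finally have 1: "sin (d y y') * Im (w y y') \<le> \<eta> * Re (w y y')" .
      have "(1 - \<eta>) * Re (w y y') \<le> cos (d y y') * Re (w y y')"
        using cd[of y y'] w(1)[of y y'] by (intro mult_right_mono) auto
      with 1 show "(1 - 2 * \<eta>) * Re (w y y') \<le> Re (cis (d y y') * w y y')"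
        by (simp add: algebra_simps)
    qed (use a in \<open>auto simp: less_imp_le\<close>)
    also have "\<dots> = Re (?Tu x * cnj (?Tu x'))" unfolding prod by simp
    finally show ?thesis .
  qed
  define I where "I = (\<Sum>y\<in>UNIV. \<Sum>y'\<in>UNIV. a y y' * Im (w y y'))"
  have I_swap: "I = (\<Sum>y\<in>UNIV. \<Sum>y'\<in>UNIV. - (a y' y * Im (w y y')))"
  proof -
    have "a y' y * Im (w y' y) = - (a y' y * Im (w y y'))" for y y'
      using w_sym(2)[of y' y] by simp
    then show ?thesis unfolding I_def by (subst sum.swap, intro sum.cong refl)
  qed
  have R_swap: "R = (\<Sum>y\<in>UNIV. \<Sum>y'\<in>UNIV. a y' y * Re (w y y'))"
    unfolding R_def by (subst sum.swap, intro sum.cong refl arg_cong2[where f = "(*)"] w_sym(1))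
  have "\<bar>2 * I\<bar> = \<bar>\<Sum>y\<in>UNIV. \<Sum>y'\<in>UNIV. (a y y' - a y' y) * Im (w y y')\<bar>"
  proof -
    have "2 * I = I + I" by simp
    also have "\<dots> = (\<Sum>y\<in>UNIV. \<Sum>y'\<in>UNIV. (a y y' - a y' y) * Im (w y y'))"
      by (subst (2) I_swap) (simp add: I_def sum.distrib[symmetric] sum_subtractf sum_negf algebra_simps)
    finally show ?thesis by simp
  qed
  also have "\<dots> \<le> (\<Sum>y\<in>UNIV. \<Sum>y'\<in>UNIV. \<bar>(a y y' - a y' y) * Im (w y y')\<bar>)"
    by (intro order_trans[OF sum_abs] sum_mono sum_abs)
  also have "\<dots> \<le> (\<Sum>y\<in>UNIV. \<Sum>y'\<in>UNIV. ((1 - r) * (a y y' + a y' y)) * Re (w y y'))"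
  proof (intro sum_mono)
    fix y y'
    have "r * a y y' \<le> a y' y" "r * a y' y \<le> a y y'"
      using r(1)[of x y x' y'] r(1)[of x y' x' y] by (auto simp: a_def mult_ac)
    moreover have "r * a y y' \<le> a y y'" "r * a y' y \<le> a y' y"
      using a[of y y'] a[of y' y] r(3) by auto
    ultimately have "\<bar>a y y' - a y' y\<bar> \<le> (1 - r) * (a y y' + a y' y)"
      by (simp add: algebra_simps abs_le_iff)
    moreover have "0 \<le> (1 - r) * (a y y' + a y' y)"
      using a[of y y'] a[of y' y] r by simp
    ultimately show "\<bar>(a y y' - a y' y) * Im (w y y')\<bar> \<le> ((1 - r) * (a y y' + a y' y)) * Re (w y y')"
      unfolding abs_mult using w by (intro mult_mono) auto
  qed
  also have "\<dots> = (1 - r) * (R + R)"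
    by (subst (2) R_swap)
       (simp add: R_def sum_distrib_left sum.distrib[symmetric] algebra_simps)
  finally have I_le: "\<bar>I\<bar> \<le> (1 - r) * R" by simp
  have "Im (?Tu x * cnj (?Tu x')) - I =
      (\<Sum>y\<in>UNIV. \<Sum>y'\<in>UNIV. a y y' * (Im (cis (d y y') * w y y') - Im (w y y')))"
    unfolding prod I_def by (simp add: sum_subtractf[symmetric] algebra_simps)
  also have "\<bar>\<dots>\<bar> \<le> (\<Sum>y\<in>UNIV. \<Sum>y'\<in>UNIV. \<bar>a y y' * (Im (cis (d y y') * w y y') - Im (w y y'))\<bar>)"
    by (intro order_trans[OF sum_abs] sum_mono sum_abs)
  also have "\<dots> \<le> (\<Sum>y\<in>UNIV. \<Sum>y'\<in>UNIV. a y y' * (2 * \<eta> * Re (w y y')))"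
  proof (intro sum_mono)
    fix y y'
    have "\<bar>sin (d y y') * Re (w y y')\<bar> \<le> \<eta> * Re (w y y')"
      unfolding abs_mult using w(1)[of y y'] sd \<eta>0 by (intro mult_mono) auto
    moreover have "\<bar>(1 - cos (d y y')) * Im (w y y')\<bar> \<le> \<eta> * Re (w y y')"
      unfolding abs_mult using w[of y y'] cd[of y y'] \<eta>0 by (intro mult_mono) auto
    ultimately have "\<bar>Im (cis (d y y') * w y y') - Im (w y y')\<bar> \<le> 2 * \<eta> * Re (w y y')"
      by (simp add: algebra_simps abs_le_iff)
    then show "\<bar>a y y' * (Im (cis (d y y') * w y y') - Im (w y y'))\<bar> \<le> a y y' * (2 * \<eta> * Re (w y y'))"
      unfolding abs_mult using a[of y y'] by (simp add: mult_left_mono)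
  qed
  also have "\<dots> = 2 * \<eta> * R"
    unfolding R_def sum_distrib_left by (intro sum.cong refl) simp
  finally have "\<bar>Im (?Tu x * cnj (?Tu x'))\<bar> \<le> (1 - r) * R + 2 * \<eta> * R" using I_le by linarith
  also have "\<dots> = (1 - r + 2 * \<eta>) * R" by (simp add: algebra_simps)
  \<comment> \<open>The gain r has to pay for 2 \<eta> lost in the real part and 2 \<eta> added to
    the imaginary part, whence the assumption 4 \<eta> \<le> r.\<close>
  also have "\<dots> \<le> (1 - 2 * \<eta>) * R" using \<eta> R_pos by (intro mult_right_mono) auto
  finally have "\<bar>Im (?Tu x * cnj (?Tu x'))\<bar> \<le> (1 - 2 * \<eta>) * R" .
  moreover have "0 < (1 - 2 * \<eta>) * R" using \<eta> r R_pos by simp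
  ultimately show "0 < Re (?Tu x * cnj (?Tu x')) \<and> \<bar>Im (?Tu x * cnj (?Tu x'))\<bar> \<le> Re (?Tu x * cnj (?Tu x'))"
    using Re_ge by linarith
qed

section \<open>Uniform cone invariance and the holomorphic extension of the Perron root\<close>

lemma finite_upper_bound2:
  fixes f :: "'a::finite \<Rightarrow> 'a \<Rightarrow> real"
  obtains m where "0 < m" "\<And>x y. f x y \<le> m"
  using finite_upper_bound[of "\<lambda>(x, y). f x y"] by auto

lemma finite_pos_bounds2:
  fixes f :: "'a::finite \<Rightarrow> 'a \<Rightarrow> real"
  assumes "\<And>x y. 0 < f x y"
  obtains m where "0 < m" "\<And>x y. m \<le> f x y"
proof -
  have "0 < (case z of (x, y) \<Rightarrow> f x y)" for z using assms by (cases z) auto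
  then obtain m where "0 < m" "\<And>z. m \<le> (case z of (x, y) \<Rightarrow> f x y)"
    using finite_pos_bounds by blast
  then show ?thesis using that[of m] by (metis case_prod_conv)
qed

lemma tilted_bounds:
  fixes A b :: "'a::finite \<Rightarrow> 'a \<Rightarrow> real"
  assumes A: "\<And>x y. 0 < A x y"
  obtains m M where "0 < m" "m \<le> M"
    "\<And>s x y. \<bar>s\<bar> \<le> N \<Longrightarrow> m \<le> tilted A b s x y \<and> tilted A b s x y \<le> M"
proof -
  obtain B where B: "0 < B" "\<And>x y. \<bar>b x y\<bar> \<le> B" using finite_upper_bound2[of "\<lambda>x y. \<bar>b x y\<bar>"] by blast
  obtain a where a: "0 < a" "\<And>x y. a \<le> A x y" using finite_pos_bounds2[of A] A by blast
  obtain a' where a': "0 < a'" "\<And>x y. A x y \<le> a'" using finite_upper_bound2[of A] by blast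
  have *: "a * exp (- N * B) \<le> tilted A b s x y \<and> tilted A b s x y \<le> a' * exp (N * B)"
    if "\<bar>s\<bar> \<le> N" for s x y
  proof -
    have "\<bar>s * b x y\<bar> \<le> N * B"
      unfolding abs_mult using that B by (intro mult_mono) auto
    then show ?thesis unfolding tilted_def
      using a a' by (auto intro!: mult_mono simp: less_imp_le abs_le_iff)
        (use a(1) a(2) less_imp_le order_trans in blast)
  qed
  have "a \<le> a'" using a a' order_trans by blast
  show ?thesis
  proof (cases "0 \<le> N")
    case True
    then have "exp (- N * B) \<le> exp (N * B)" using B by simp
    then have "a * exp (- N * B) \<le> a' * exp (N * B)"
      using \<open>a \<le> a'\<close> a by (intro mult_mono) auto
    then show ?thesis using that[OF _ _ *] a by simp
  next
    case False
    then show ?thesis using that[of 1 1] by auto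
  qed
qed

text \<open>The cone survives in a strip of uniform width. The cross ratios of the kernel are at
  least r = (m / M)^2, and phases differ by at most 2 B times the imaginary part, so the width r /
  (8 B) yields phase differences of at most r / 4.\<close>

lemma ctilted_power_in_cone:
  fixes A b :: "'a::finite \<Rightarrow> 'a \<Rightarrow> real"
  assumes A: "\<And>x y. 0 < A x y"
  obtains \<epsilon> where "0 < \<epsilon>"
    "\<And>z n. \<bar>Re z\<bar> \<le> N \<Longrightarrow> \<bar>Im z\<bar> \<le> \<epsilon> \<Longrightarrow> in_cone ((transfer (ctilted A b z) ^^ n) (\<lambda>_. 1))"
proof -
  obtain B where B: "0 < B" "\<And>x y. \<bar>b x y\<bar> \<le> B" using finite_upper_bound2[of "\<lambda>x y. \<bar>b x y\<bar>"] by blast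
  obtain m M where m: "0 < m" "m \<le> M"
    and mM: "\<And>s x y. \<bar>s\<bar> \<le> N \<Longrightarrow> m \<le> tilted A b s x y \<and> tilted A b s x y \<le> M"
    using tilted_bounds[of A N b] A by blast
  define r where "r = (m / M)\<^sup>2"
  have r: "0 < r" "r \<le> 1" using m by (auto simp: r_def power_le_one)
  show ?thesis
  proof (rule that[of "r / (8 * B)"])
    show "0 < r / (8 * B)" using r B by simp
    fix z n assume z: "\<bar>Re z\<bar> \<le> N" "\<bar>Im z\<bar> \<le> r / (8 * B)"
    show "in_cone ((transfer (ctilted A b z) ^^ n) (\<lambda>_. 1))"
    proof (induction n)
      case (Suc n)
      have "in_cone (transfer (\<lambda>x y. of_real (tilted A b (Re z) x y) * cis (Im z * b x y))
        ((transfer (ctilted A b z) ^^ n) (\<lambda>_. 1)))"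
      proof (rule in_cone_transfer[OF _ _ r, where \<eta> = "r / 4"])
        fix x y x' y'
        show "0 < tilted A b (Re z) x y" by (rule tilted_pos[OF A])
        have "tilted A b (Re z) x y * tilted A b (Re z) x' y' \<le> M * M"
          using mM[OF z(1)] m by (intro mult_mono) (auto intro: order_trans[of 0 m])
        then have "r * (tilted A b (Re z) x y * tilted A b (Re z) x' y') \<le> r * (M * M)"
          using r by simp
        also have "\<dots> = m * m" using m by (simp add: r_def power2_eq_square)
        also have "\<dots> \<le> tilted A b (Re z) x y' * tilted A b (Re z) x' y"
          using mM[OF z(1)] m by (intro mult_mono) (auto intro: order_trans[of 0 m])
        finally show "r * (tilted A b (Re z) x y * tilted A b (Re z) x' y')
          \<le> tilted A b (Re z) x y' * tilted A b (Re z) x' y" .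
        have "\<bar>Im z * b x y - Im z * b x' y'\<bar> = \<bar>Im z\<bar> * \<bar>b x y - b x' y'\<bar>"
          by (simp add: abs_mult[symmetric] right_diff_distrib)
        also have "\<dots> \<le> r / (8 * B) * (2 * B)"
          using z B(2)[of x y] B(2)[of x' y'] by (intro mult_mono) auto
        finally show "\<bar>Im z * b x y - Im z * b x' y'\<bar> \<le> r / 4" using B by simp
      qed (use Suc in auto)
      then show ?case by (simp add: ctilted_cis[abs_def])
    qed (simp add: in_cone_def)
  qed
qed

lemma transfer_power_of_real:
  "(transfer (\<lambda>x y. of_real (K x y) :: complex) ^^ n) (\<lambda>_. 1) x = of_real ((transfer K ^^ n) (\<lambda>_. 1) x)"
  by (induction n arbitrary: x) (auto simp: transfer_def)

lemma ctilted_of_real: "ctilted A b (of_real s) = (\<lambda>x y. of_real (tilted A b s x y))"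
  unfolding ctilted_def tilted_def
  by (metis (no_types, opaque_lifting) exp_of_real of_real_mult)

text \<open>The iterates have no zeros near the real segment, so their \<open>n\<close>-th roots form a normal
  family of holomorphic functions; a limit function has modulus \<open>perron_root\<close> on the segment.\<close>

lemma perron_root_holomorphic:
  fixes A b :: "'a::finite \<Rightarrow> 'a \<Rightarrow> real"
  assumes A: "\<And>x y. 0 < A x y" and N: "0 < N"
  obtains S H where "open S" "convex S" "H holomorphic_on S"
    "\<And>s. \<bar>s\<bar> < N \<Longrightarrow> of_real s \<in> S"
    "\<And>s. \<bar>s\<bar> < N \<Longrightarrow> H (of_real s) = of_real (ln (perron_root (tilted A b s)))"
proof -
  obtain \<epsilon> where \<epsilon>: "0 < \<epsilon>" and cone:
    "\<And>z n. \<bar>Re z\<bar> \<le> N \<Longrightarrow> \<bar>Im z\<bar> \<le> \<epsilon> \<Longrightarrow> in_cone ((transfer (ctilted A b z) ^^ n) (\<lambda>_. 1))"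
    using ctilted_power_in_cone[of A N b] A by blast
  obtain m M where m: "0 < m" "m \<le> M"
    and mM: "\<And>s x y. \<bar>s\<bar> \<le> N \<Longrightarrow> m \<le> tilted A b s x y \<and> tilted A b s x y \<le> M"
    using tilted_bounds[of A N b] A by blast
  define S where "S = box (Complex (- N) (- \<epsilon>)) (Complex N \<epsilon>)"
  have S: "z \<in> S \<longleftrightarrow> \<bar>Re z\<bar> < N \<and> \<bar>Im z\<bar> < \<epsilon>" for z
    by (auto simp: S_def in_box_complex_iff)
  have opS: "open S" and cvS: "convex S" by (auto simp: S_def open_box convex_box)
  have realS: "of_real s \<in> S" if "\<bar>s\<bar> < N" for s using that \<epsilon> by (simp add: S)
  have zero_S: "of_real 0 \<in> S" using realS[of 0] N by simp
  obtain x0 :: 'a where True by blast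
  define f where "f n z = (transfer (ctilted A b z) ^^ n) (\<lambda>_. 1) x0" for n z
  have hol: "(\<lambda>z. (transfer (ctilted A b z) ^^ n) (\<lambda>_. 1) x) holomorphic_on S" for n x
  proof (induction n arbitrary: x)
    case (Suc n)
    then show ?case
      unfolding funpow.simps comp_def transfer_def[of _ "(transfer _ ^^ n) _"] ctilted_def[of A b _ x]
      by (intro holomorphic_intros) auto
  qed simp
  have f0: "f n z \<noteq> 0" if "z \<in> S" for n z
  proof -
    have "in_cone ((transfer (ctilted A b z) ^^ n) (\<lambda>_. 1))" using cone that by (auto simp: S)
    then have "0 < Re (f n z * cnj (f n z))" unfolding in_cone_def f_def by blast
    then show ?thesis by auto
  qed
  define C where "C = real CARD('a) * M"
  have C: "0 < C" using m by (simp add: C_def)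
  have bound: "norm ((transfer (ctilted A b z) ^^ n) (\<lambda>_. 1) x) \<le> C ^ n" if "z \<in> S" for n z x
  proof (induction n arbitrary: x)
    case (Suc n)
    have "norm ((transfer (ctilted A b z) ^^ Suc n) (\<lambda>_. 1) x)
        \<le> (\<Sum>y\<in>UNIV. norm (ctilted A b z x y * (transfer (ctilted A b z) ^^ n) (\<lambda>_. 1) y))"
      by (simp add: transfer_def norm_sum)
    also have "\<dots> \<le> (\<Sum>y\<in>(UNIV::'a set). M * C ^ n)"
    proof (intro sum_mono)
      fix y
      have "norm (ctilted A b z x y) \<le> M"
        using mM[of "Re z" x y] that m(1) by (simp add: ctilted_cis norm_mult S)
      then show "norm (ctilted A b z x y * (transfer (ctilted A b z) ^^ n) (\<lambda>_. 1) y) \<le> M * C ^ n"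
        unfolding norm_mult using Suc m by (intro mult_mono) auto
    qed
    finally show ?case by (simp add: C_def)
  qed simp
  have "\<exists>g. g holomorphic_on S \<and> (\<forall>z\<in>S. exp (g z) = f n z)" for n
  proof -
    have "f n holomorphic_on S" using hol[of n x0] by (simp add: f_def[abs_def])
    then obtain g where "g holomorphic_on S" "\<And>z. z \<in> S \<Longrightarrow> exp (g z) = f n z"
      using holomorphic_logarithm_exists[OF cvS opS \<open>f n holomorphic_on S\<close> f0 zero_S] by blast
    then show ?thesis by blast
  qed
  then obtain g where g: "\<And>n. g n holomorphic_on S" "\<And>n z. z \<in> S \<Longrightarrow> exp (g n z) = f n z"
    by metis
  \<comment> \<open>The root is taken of the iterate number Suc n, so that no division by zero
    occurs; the holomorphic logarithm of the zero-free iterate fixes its branch.\<close>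
  define h where "h n z = exp (g (Suc n) z / of_nat (Suc n))" for n z
  have h_hol: "h n holomorphic_on S" for n
    unfolding h_def by (intro holomorphic_intros g(1)) auto
  have norm_h: "norm (h n z) = exp (ln (norm (f (Suc n) z)) / real (Suc n))" if "z \<in> S" for n z
  proof -
    have "norm (f (Suc n) z) = exp (Re (g (Suc n) z))" using g(2)[OF that] by (metis norm_exp_eq_Re)
    then show ?thesis
      by (simp add: h_def Re_divide_of_nat del: of_nat_Suc)
  qed
  have h_bound: "norm (h n z) \<le> C" if "z \<in> S" for n z
  proof -
    have "ln (norm (f (Suc n) z)) \<le> ln (C ^ Suc n)"
      using bound[OF that, of "Suc n" x0] f0[OF that, of "Suc n"] C unfolding f_def
      by (subst ln_le_cancel_iff) (auto simp del: funpow.simps)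
    then have "ln (norm (f (Suc n) z)) / real (Suc n) \<le> ln C"
      using C by (simp add: ln_realpow divide_le_eq mult.commute del: power_Suc of_nat_Suc)
    then show ?thesis
      unfolding norm_h[OF that] using C by (metis exp_le_cancel_iff exp_ln)
  qed
  obtain G q where G: "G holomorphic_on S" and q: "strict_mono (q :: nat \<Rightarrow> nat)"
    and lim: "\<And>z. z \<in> S \<Longrightarrow> (\<lambda>n. h (q n) z) \<longlonglongrightarrow> G z"
    and ul: "\<And>K. compact K \<Longrightarrow> K \<subseteq> S \<Longrightarrow> uniform_limit K (h \<circ> q) G sequentially"
  proof (rule Montel[of S "range h" h])
    show "\<exists>B. \<forall>k\<in>range h. \<forall>z\<in>K. norm (k z) \<le> B" if "K \<subseteq> S" for K
      using h_bound that by blast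
  qed (use opS h_hol in auto)
  have G_real: "norm (G (of_real s)) = perron_root (tilted A b s)" if s: "\<bar>s\<bar> < N" for s
  proof -
    have p: "0 < tilted A b s x y" for x y by (rule tilted_pos[OF A])
    have f_real: "norm (f n (of_real s)) = (transfer (tilted A b s) ^^ n) (\<lambda>_. 1) x0" for n
      unfolding f_def ctilted_of_real transfer_power_of_real
      using transfer_power_pos[of "tilted A b s" n x0, OF p] by simp
    have "(\<lambda>n. exp (ln ((transfer (tilted A b s) ^^ Suc n) (\<lambda>_. 1) x0) / real (Suc n)))
        \<longlonglongrightarrow> exp (ln (perron_root (tilted A b s)))"
      by (intro tendsto_exp LIMSEQ_Suc perron_root_limit p)
    then have "(\<lambda>n. norm (h n (of_real s))) \<longlonglongrightarrow> perron_root (tilted A b s)"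
      unfolding norm_h[OF realS[OF s]] f_real using perron_root_pos[of "tilted A b s", OF p] by simp
    then have "(\<lambda>n. norm (h (q n) (of_real s))) \<longlonglongrightarrow> perron_root (tilted A b s)"
      using LIMSEQ_subseq_LIMSEQ[OF _ q] by (fastforce simp: o_def)
    moreover have "(\<lambda>n. norm (h (q n) (of_real s))) \<longlonglongrightarrow> norm (G (of_real s))"
      by (intro tendsto_norm lim realS s)
    ultimately show ?thesis using LIMSEQ_unique by blast
  qed
  have G_real_pos: "0 < norm (G (of_real s))" if "\<bar>s\<bar> < N" for s
    using G_real[OF that] perron_root_pos[of "tilted A b s", OF tilted_pos[OF A]] by simp
  \<comment> \<open>Hurwitz's theorem concerns nonconstant limits. A constant limit is nonzero since
    its modulus at 0 is a Perron root.\<close>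
  have G0: "G z \<noteq> 0" if z: "z \<in> S" for z
  proof (cases "G constant_on S")
    case True
    then show ?thesis using z realS[of 0] G_real_pos[of 0] N unfolding constant_on_def by force
  next
    case False
    show ?thesis
      by (rule Hurwitz_no_zeros[of S "h \<circ> q" G])
         (use opS cvS convex_connected h_hol G ul False z in \<open>auto simp: h_def\<close>)
  qed
  obtain H where H: "H holomorphic_on S" "\<And>z. z \<in> S \<Longrightarrow> exp (H z) = G z"
    using holomorphic_logarithm_exists[OF cvS opS G G0 zero_S] by blast
  have S_cnj: "cnj ` S = S"
  proof
    show "S \<subseteq> cnj ` S"
    proof
      fix z assume "z \<in> S"
      then show "z \<in> cnj ` S" by (intro image_eqI[of _ _ "cnj z"]) (auto simp: S)
    qed
  qed (auto simp: S)
  \<comment> \<open>On the segment only the modulus of G, that is the real part of H, is known.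
    Averaging H with this reflection keeps the real part there and cancels the imaginary
    part.\<close>
  have H_cnj: "(cnj \<circ> H \<circ> cnj) holomorphic_on S"
    using H(1) opS by (simp add: holomorphic_on_compose_cnj_cnj S_cnj)
  show ?thesis
  proof (rule that[OF opS cvS _ realS, of "\<lambda>z. (H z + (cnj \<circ> H \<circ> cnj) z) / 2"])
    show "(\<lambda>z. (H z + (cnj \<circ> H \<circ> cnj) z) / 2) holomorphic_on S"
      by (intro holomorphic_intros H(1) H_cnj) auto
    fix s assume s: "\<bar>s\<bar> < N"
    have "exp (Re (H (of_real s))) = perron_root (tilted A b s)"
      using H(2)[OF realS[OF s]] G_real[OF s] by (metis norm_exp_eq_Re)
    then have "Re (H (of_real s)) = ln (perron_root (tilted A b s))" by (metis ln_exp)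
    moreover have "(H (of_real s) + (cnj \<circ> H \<circ> cnj) (of_real s)) / 2 = of_real (Re (H (of_real s)))"
      by (simp add: complex_add_cnj)
    ultimately show "(H (of_real s) + (cnj \<circ> H \<circ> cnj) (of_real s)) / 2
      = of_real (ln (perron_root (tilted A b s)))" by simp
  qed auto
qed

subsection \<open>The pressure of a tilted kernel\<close>

definition pressure :: "('a::finite \<Rightarrow> 'a \<Rightarrow> real) \<Rightarrow> ('a \<Rightarrow> 'a \<Rightarrow> real) \<Rightarrow> real \<Rightarrow> real" where
  "pressure A b s = ln (perron_root (tilted A b s))"

text \<open>Normalise both sums to 1 and apply Young's inequality termwise.\<close>

lemma Hoelder_sum:
  fixes f g :: "'a \<Rightarrow> real"
  assumes S: "finite S" "S \<noteq> {}" and pos: "\<And>x. 0 < f x" "\<And>x. 0 < g x"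
    and \<alpha>: "0 \<le> \<alpha>" "0 \<le> \<beta>" "\<alpha> + \<beta> = 1"
  shows "(\<Sum>x\<in>S. f x powr \<alpha> * g x powr \<beta>) \<le> sum f S powr \<alpha> * sum g S powr \<beta>"
proof -
  have F: "0 < sum f S" and G: "0 < sum g S" using S pos by (auto intro: sum_pos)
  have "(\<Sum>x\<in>S. f x powr \<alpha> * g x powr \<beta>) / (sum f S powr \<alpha> * sum g S powr \<beta>)
      = (\<Sum>x\<in>S. (f x / sum f S) powr \<alpha> * (g x / sum g S) powr \<beta>)"
    unfolding sum_divide_distrib using F G pos
    by (intro sum.cong refl) (simp add: powr_divide less_imp_le)
  also have "\<dots> \<le> (\<Sum>x\<in>S. \<alpha> * (f x / sum f S) + \<beta> * (g x / sum g S))"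
    using F G pos \<alpha> by (intro sum_mono Youngs_inequality_0) auto
  also have "\<dots> = 1"
    using F G \<alpha> by (simp add: sum.distrib sum_distrib_left[symmetric] sum_divide_distrib[symmetric])
  finally show ?thesis using F G by (simp add: divide_le_eq)
qed

text \<open>The weighted geometric mean of the eigenvectors at r and s is a test function for
  \<open>perron_root_le\<close> at the intermediate parameter; Hoelder gives the required inequality
  row by row.\<close>

lemma pressure_convex:
  fixes A b :: "'a::finite \<Rightarrow> 'a \<Rightarrow> real"
  assumes A: "\<And>x y. 0 < A x y"
  shows "convex_on UNIV (pressure A b)"
proof (rule convex_onI)
  fix t r s :: real assume t: "0 < t" "t < 1"
  let ?K = "tilted A b"
  have K: "0 < ?K q x y" for q x y by (rule tilted_pos[OF A])
  have pr: "0 < perron_root (?K q)" for q by (rule perron_root_pos, rule K)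
  obtain u where u: "\<And>x. 0 < u x" "\<And>x. transfer (?K r) u x = perron_root (?K r) * u x"
    using perron_vector[of "?K r"] K by blast
  obtain v where v: "\<And>x. 0 < v x" "\<And>x. transfer (?K s) v x = perron_root (?K s) * v x"
    using perron_vector[of "?K s"] K by blast
  define q where "q = (1 - t) * r + t * s"
  define \<rho> where "\<rho> = perron_root (?K r) powr (1 - t) * perron_root (?K s) powr t"
  have K_q: "?K q x y = ?K r x y powr (1 - t) * ?K s x y powr t" for x y
  proof -
    have "?K r x y powr (1 - t) * ?K s x y powr t
        = (A x y powr (1 - t) * A x y powr t) * (exp ((1 - t) * (r * b x y)) * exp (t * (s * b x y)))"
      unfolding tilted_def using A[of x y] by (simp add: powr_mult exp_powr_real mult_ac)
    also have "\<dots> = A x y * exp (q * b x y)"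
      using A[of x y] by (simp add: powr_add[symmetric] exp_add[symmetric] q_def algebra_simps)
    finally show ?thesis by (simp add: tilted_def)
  qed
  have "perron_root (?K q) \<le> \<rho>"
  proof (rule perron_root_le)
    fix x
    show "0 < ?K q x y" for y by (rule K)
    show "0 < u x powr (1 - t) * v x powr t" using u(1)[of x] v(1)[of x] by simp
    have "transfer (?K q) (\<lambda>x. u x powr (1 - t) * v x powr t) x
        = (\<Sum>y\<in>UNIV. (?K r x y * u y) powr (1 - t) * (?K s x y * v y) powr t)"
      unfolding transfer_def K_q using K u(1) v(1) by (intro sum.cong refl) (simp add: powr_mult less_imp_le mult_ac)
    also have "\<dots> \<le> (\<Sum>y\<in>UNIV. ?K r x y * u y) powr (1 - t) * (\<Sum>y\<in>UNIV. ?K s x y * v y) powr t"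
      using t K u(1) v(1) by (intro Hoelder_sum) auto
    also have "\<dots> = (perron_root (?K r) * u x) powr (1 - t) * (perron_root (?K s) * v x) powr t"
      using u(2) v(2) by (simp add: transfer_def)
    also have "\<dots> = \<rho> * (u x powr (1 - t) * v x powr t)"
      unfolding \<rho>_def using pr[of r] pr[of s] u(1)[of x] v(1)[of x] by (simp add: powr_mult less_imp_le mult_ac)
    finally show "transfer (?K q) (\<lambda>x. u x powr (1 - t) * v x powr t) x \<le> \<rho> * (u x powr (1 - t) * v x powr t)" .
  qed
  moreover have "0 < \<rho>" using pr[of r] pr[of s] by (simp add: \<rho>_def)
  ultimately have "ln (perron_root (?K q)) \<le> ln \<rho>"
    using pr[of q] by (subst ln_le_cancel_iff)
  also have "\<dots> = (1 - t) * pressure A b r + t * pressure A b s"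
    using pr[of r] pr[of s] by (simp add: \<rho>_def pressure_def ln_mult ln_powr)
  finally show "pressure A b ((1 - t) *\<^sub>R r + t *\<^sub>R s) \<le> (1 - t) * pressure A b r + t * pressure A b s"
    by (simp add: pressure_def q_def)
qed simp

section \<open>Smoothness, tangents and affine pieces of the pressure\<close>

lemma pressure_holomorphic:
  fixes A b :: "'a::finite \<Rightarrow> 'a \<Rightarrow> real"
  assumes A: "\<And>x y. 0 < A x y" and N: "0 < N"
  obtains S H where "open S" "convex S" "H holomorphic_on S"
    "\<And>s. \<bar>s\<bar> < N \<Longrightarrow> of_real s \<in> S"
    "\<And>s. \<bar>s\<bar> < N \<Longrightarrow> H (of_real s) = complex_of_real (pressure A b s)"
  using perron_root_holomorphic[of A N b, OF A N] unfolding pressure_def by blast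

lemma pressure_deriv:
  fixes A b :: "'a::finite \<Rightarrow> 'a \<Rightarrow> real"
  assumes A: "\<And>x y. 0 < A x y"
  shows "(pressure A b has_real_derivative deriv (pressure A b) s) (at s)"
    and "isCont (deriv (pressure A b)) s"
proof -
  define N where "N = \<bar>s\<bar> + 1"
  have "0 < N" by (simp add: N_def)
  obtain S H where S: "open S" "convex S" and H: "H holomorphic_on S"
    and real: "\<And>s. \<bar>s\<bar> < N \<Longrightarrow> of_real s \<in> S"
      "\<And>s. \<bar>s\<bar> < N \<Longrightarrow> H (of_real s) = complex_of_real (pressure A b s)"
    using pressure_holomorphic[of A N b, OF A \<open>0 < N\<close>] by blast
  have der: "(pressure A b has_real_derivative Re (deriv H (of_real x))) (at x)" if x: "x \<in> {- N<..<N}" for x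
  proof (rule has_field_derivative_transform_within_open)
    have "complex_of_real x \<in> S" using x by (intro real(1)) auto
    then have "((\<lambda>x. H (of_real x)) has_vector_derivative deriv H (of_real x)) (at x)"
      by (intro has_vector_derivative_real_field holomorphic_derivI[OF H S(1)])
    then show "((\<lambda>x. Re (H (of_real x))) has_real_derivative Re (deriv H (of_real x))) (at x)"
      by (rule has_field_derivative_Re)
    show "Re (H (of_real y)) = pressure A b y" if "y \<in> {- N<..<N}" for y
      using that by (subst real(2)) auto
  qed (use x in auto)
  have s: "s \<in> {- N<..<N}" by (auto simp: N_def)
  show "(pressure A b has_real_derivative deriv (pressure A b) s) (at s)"
    using der[OF s] DERIV_imp_deriv by metis
  have "continuous_on S (deriv H)"
    using H S by (intro holomorphic_on_imp_continuous_on holomorphic_deriv)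
  then have "continuous_on {- N<..<N} (\<lambda>y. Re (deriv H (of_real y)))"
    by (rule continuous_on_Re[OF continuous_on_compose2[of S "deriv H" _ complex_of_real]])
       (auto intro!: real(1) continuous_on_of_real continuous_on_id)
  then have "continuous_on {- N<..<N} (deriv (pressure A b))"
    by (rule continuous_on_eq) (rule DERIV_imp_deriv[symmetric], rule der)
  then show "isCont (deriv (pressure A b)) s"
    using s by (simp add: continuous_on_eq_continuous_at)
qed

lemma pressure_analytic:
  fixes A b :: "'a::finite \<Rightarrow> 'a \<Rightarrow> real"
  assumes A: "\<And>x y. 0 < A x y"
  shows "real_analytic_on (pressure A b) UNIV"
  unfolding real_analytic_on_def
proof
  fix s :: real
  define N where "N = \<bar>s\<bar> + 1"
  have "0 < N" by (simp add: N_def)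
  obtain S H where S: "open S" "convex S" and H: "H holomorphic_on S"
    and real: "\<And>s. \<bar>s\<bar> < N \<Longrightarrow> of_real s \<in> S"
      "\<And>s. \<bar>s\<bar> < N \<Longrightarrow> H (of_real s) = complex_of_real (pressure A b s)"
    using pressure_holomorphic[of A N b, OF A \<open>0 < N\<close>] by blast
  have s: "\<bar>s\<bar> < N" by (simp add: N_def)
  obtain \<epsilon> where \<epsilon>: "0 < \<epsilon>" "ball (of_real s) \<epsilon> \<subseteq> S"
    using S(1) real(1)[OF s] open_contains_ball by blast
  \<comment> \<open>H is real on the segment and the powers of y - s are real, so taking real parts
    termwise suffices; that the Taylor coefficients are real is never shown.\<close>
  define a where "a n = Re ((deriv ^^ n) H (of_real s) / fact n)" for n
  show "\<exists>r>0. \<exists>a. \<forall>y. \<bar>y - s\<bar> < r \<longrightarrow> (\<lambda>n. a n * (y - s) ^ n) sums pressure A b y"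
  proof (intro exI[of _ "min \<epsilon> 1"] conjI exI[of _ a] allI impI)
    fix y assume y: "\<bar>y - s\<bar> < min \<epsilon> 1"
    have yN: "\<bar>y\<bar> < N" using y by (auto simp: N_def)
    have yb: "complex_of_real y \<in> ball (of_real s) \<epsilon>"
      using y by (simp add: dist_of_real dist_real_def abs_minus_commute)
    have "(\<lambda>n. (deriv ^^ n) H (of_real s) / fact n * (of_real y - of_real s) ^ n) sums H (of_real y)"
      by (rule holomorphic_power_series[OF holomorphic_on_subset[OF H \<epsilon>(2)] yb])
    then have "(\<lambda>n. Re ((deriv ^^ n) H (of_real s) / fact n * (of_real y - of_real s) ^ n)) sums Re (H (of_real y))"
      by (rule sums_Re)
    moreover have "Re ((deriv ^^ n) H (of_real s) / fact n * (of_real y - of_real s) ^ n) = a n * (y - s) ^ n" for n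
    proof -
      have "(complex_of_real y - of_real s) ^ n = of_real ((y - s) ^ n)" by simp
      then show ?thesis unfolding a_def
        by (metis Re_complex_of_real Im_complex_of_real mult_zero_right diff_zero times_complex.sel(1))
    qed
    ultimately show "(\<lambda>n. a n * (y - s) ^ n) sums pressure A b y"
      using real(2)[OF yN] by simp
  qed (use \<epsilon> in auto)
qed

lemma pressure_tangent:
  fixes A b :: "'a::finite \<Rightarrow> 'a \<Rightarrow> real"
  assumes A: "\<And>x y. 0 < A x y"
  shows "pressure A b s + deriv (pressure A b) s * (r - s) \<le> pressure A b r"
  using convex_on_imp_above_tangent[OF pressure_convex[of A b, OF A] _ _ _
      pressure_deriv(1)[of A b, OF A], of s r] by simp

lemma pressure_deriv_mono:
  fixes A b :: "'a::finite \<Rightarrow> 'a \<Rightarrow> real"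
  assumes A: "\<And>x y. 0 < A x y" and "s \<le> r"
  shows "deriv (pressure A b) s \<le> deriv (pressure A b) r"
proof (cases "s = r")
  case False
  have "deriv (pressure A b) s * (r - s) \<le> pressure A b r - pressure A b s"
    "pressure A b r - pressure A b s \<le> deriv (pressure A b) r * (r - s)"
    using pressure_tangent[of A b s r, OF A] pressure_tangent[of A b r s, OF A]
    by (auto simp: algebra_simps)
  then have "deriv (pressure A b) s * (r - s) \<le> deriv (pressure A b) r * (r - s)" by linarith
  then show ?thesis using False \<open>s \<le> r\<close> by simp
qed simp

text \<open>Equal slopes at two points force the convex function to be affine in between, hence
  everywhere by the identity theorem.\<close>

lemma pressure_affine:
  fixes A b :: "'a::finite \<Rightarrow> 'a \<Rightarrow> real"
  assumes A: "\<And>x y. 0 < A x y" and ab: "l < u"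
    and eq: "deriv (pressure A b) l = deriv (pressure A b) u"
  shows "pressure A b s = pressure A b l + deriv (pressure A b) l * (s - l)"
proof -
  let ?P = "pressure A b" and ?k = "deriv (pressure A b) l"
  have tan: "?P x + deriv ?P x * (y - x) \<le> ?P y" for x y
    using pressure_tangent[of A b, OF A] by blast
  \<comment> \<open>The tangents at l and u have the same slope and both lie below the graph, so
    they are the same line.\<close>
  have u: "?P u = ?P l + ?k * (u - l)"
    using tan[of l u] tan[of u l] eq by (simp add: algebra_simps)
  have mid: "?P x = ?P l + ?k * (x - l)" if x: "x \<in> {l..u}" for x
  proof (rule antisym)
    have "convex_on {l..u} ?P"
      using convex_on_subset[OF pressure_convex[of A b, OF A]] by auto
    then have "?P x \<le> (?P u - ?P l) / (u - l) * (x - l) + ?P l"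
      using x by (rule convex_onD_Icc')
    then show "?P x \<le> ?P l + ?k * (x - l)" using ab u by simp
    show "?P l + ?k * (x - l) \<le> ?P x" by (rule tan)
  qed
  define N where "N = \<bar>s\<bar> + \<bar>l\<bar> + \<bar>u\<bar> + 1"
  have "0 < N" by (simp add: N_def)
  obtain S H where S: "open S" "convex S" and H: "H holomorphic_on S"
    and real: "\<And>s. \<bar>s\<bar> < N \<Longrightarrow> of_real s \<in> S"
      "\<And>s. \<bar>s\<bar> < N \<Longrightarrow> H (of_real s) = complex_of_real (?P s)"
    using pressure_holomorphic[of A N b, OF A \<open>0 < N\<close>] by blast
  define J where "J z = H z - (of_real (?P l) + of_real ?k * (z - of_real l))" for z
  have lim: "complex_of_real l islimpt of_real ` {l..u}"
    unfolding islimpt_approachable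
  proof (intro allI impI)
    fix e :: real assume e: "0 < e"
    define x where "x = min u (l + e / 2)"
    have "x \<in> {l..u}" "x \<noteq> l" "\<bar>x - l\<bar> < e" using ab e by (auto simp: x_def)
    then have "complex_of_real x \<in> of_real ` {l..u}" "complex_of_real x \<noteq> of_real l"
      "dist (complex_of_real x) (of_real l) < e"
      by (auto simp: dist_norm simp flip: of_real_diff)
    then show "\<exists>x'\<in>of_real ` {l..u}. x' \<noteq> complex_of_real l \<and> dist x' (complex_of_real l) < e" by blast
  qed
  have "J (of_real s) = 0"
  proof (rule analytic_continuation[of J S "of_real ` {l..u}" "of_real l"])
    show "J holomorphic_on S" unfolding J_def by (intro holomorphic_intros H)
    show "connected S" using S convex_connected by blast
    show "of_real ` {l..u} \<subseteq> S" using real(1) by (auto simp: N_def)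
    show "J z = 0" if z: "z \<in> of_real ` {l..u}" for z
    proof -
      obtain x where x: "x \<in> {l..u}" "z = of_real x" using z by blast
      have "H (of_real x) = of_real (?P x)" using x by (intro real) (auto simp: N_def)
      then show ?thesis unfolding J_def x(2) mid[OF x(1)] by simp
    qed
  qed (use S lim real(1) in \<open>auto simp: N_def\<close>)
  moreover have "H (of_real s) = of_real (?P s)" by (intro real) (auto simp: N_def)
  ultimately have "complex_of_real (?P s) = of_real (?P l + ?k * (s - l))" by (simp add: J_def)
  then show ?thesis by (simp only: of_real_eq_iff)
qed

section \<open>Rigidity: a vanishing pressure identifies the two kernels\<close>

lemma exp_mult_bounded:
  fixes a \<beta> :: real
  assumes "0 < a" "\<And>s. a * exp (s * \<beta>) \<le> 1"
  shows "\<beta> = 0"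
proof (rule ccontr)
  assume "\<beta> \<noteq> 0"
  \<comment> \<open>The exponent is chosen so that the value becomes e, which exceeds the bound
    1.\<close>
  then have "a * exp ((1 - ln a) / \<beta> * \<beta>) = exp 1" using assms(1) by (simp add: exp_diff)
  moreover have "1 < exp (1::real)" by simp
  ultimately show False using assms(2)[of "(1 - ln a) / \<beta>"] by linarith
qed

text \<open>Zero pressure forces the weights of all \<open>3\<close>-cycles under \<open>P\<close> and \<open>P'\<close> to agree, so the two
  kernels differ by a coboundary, which is trivial by the maximum principle.\<close>

lemma pressure_zero_imp_eq:
  fixes P P' :: "'a::finite \<Rightarrow> 'a \<Rightarrow> real"
  assumes P: "\<And>x y. 0 < P x y" "\<And>x. (\<Sum>y\<in>UNIV. P x y) = 1"
    and P': "\<And>x y. 0 < P' x y" "\<And>x. (\<Sum>y\<in>UNIV. P' x y) = 1"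
    and zero: "\<And>s. pressure P (\<lambda>x y. ln (P x y / P' x y)) s = 0"
  shows "P = P'"
proof -
  define b where "b x y = ln (P x y / P' x y)" for x y
  have cycle: "b x y + b y z + b z x = 0" for x y z
  proof (rule exp_mult_bounded)
    show "0 < P x y * P y z * P z x" using P by simp
    fix s
    have K: "0 < tilted P b s x y" for x y by (rule tilted_pos[OF P(1)])
    have root: "perron_root (tilted P b s) = 1"
      using zero[of s] perron_root_pos[of "tilted P b s", OF K]
      unfolding pressure_def b_def[symmetric, abs_def] by simp
    obtain v where v: "\<And>x. 0 < v x" "\<And>x. transfer (tilted P b s) v x = v x"
      using perron_vector[of "tilted P b s"] K unfolding root by auto
    \<comment> \<open>A single term of the eigenvector equation with root 1 bounds each entry by a
      ratio of eigenvector entries. These ratios cancel around a cycle, which leaves a bound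
      independent of s.\<close>
    have le: "tilted P b s x y \<le> v x / v y" for x y
    proof -
      have "tilted P b s x y * v y \<le> transfer (tilted P b s) v x"
        unfolding transfer_def using K v(1) by (intro member_le_sum) (auto simp: less_imp_le)
      then show ?thesis using v by (simp add: field_simps)
    qed
    have "P x y * P y z * P z x * exp (s * (b x y + b y z + b z x))
        = tilted P b s x y * tilted P b s y z * tilted P b s z x"
      by (simp add: tilted_def distrib_left exp_add mult_ac)
    also have "\<dots> \<le> (v x / v y) * (v y / v z) * (v z / v x)"
      using le K v(1) by (intro mult_mono) (auto simp: less_imp_le)
    also have "\<dots> = 1" using v(1)[of x] v(1)[of y] v(1)[of z] by simp
    finally show "P x y * P y z * P z x * exp (s * (b x y + b y z + b z x)) \<le> 1" .
  qed
  obtain x0 :: 'a where True by blast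
  define h where "h x = exp (b x0 x)" for x
  \<comment> \<open>Cycles with repeated letters show that b vanishes on the diagonal at x0 and is
    antisymmetric against x0; then b is the coboundary of its row at x0.\<close>
  have b: "b x y = b x0 y - b x0 x" for x y
    using cycle[of x0 x y] cycle[of y x0 x0] cycle[of x0 x0 x0] cycle[of x0 y x0] by linarith
  have PP': "P x y * h x = P' x y * h y" for x y
  proof -
    have "P x y = P' x y * exp (b x y)" using P(1)[of x y] P'(1)[of x y] by (simp add: b_def)
    also have "exp (b x y) = h y / h x" unfolding b[of x y] h_def by (rule exp_diff)
    finally show ?thesis by (simp add: h_def)
  qed
  have harm: "(\<Sum>y\<in>UNIV. P' x y * h y) = h x" for x
    using P(2)[of x] by (simp add: PP'[symmetric] sum_distrib_right[symmetric])
  define m where "m = Max (range h)"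
  have "m \<in> range h" unfolding m_def by (rule Max_in) auto
  then obtain x where x: "m = h x" by auto
  have le: "h y \<le> m" for y by (simp add: m_def)
  have "(\<Sum>y\<in>UNIV. P' x y * (m - h y)) = 0"
    using harm[of x] P'(2)[of x] x by (simp add: right_diff_distrib sum_subtractf sum_distrib_right[symmetric])
  moreover have "0 \<le> P' x y * (m - h y)" for y using P'(1)[of x y] le[of y] by simp
  ultimately have "P' x y * (m - h y) = 0" for y by (subst (asm) sum_nonneg_eq_0_iff) auto
  then have hm: "h y = m" for y using P'(1)[of x y] by (metis less_irrefl mult_eq_0_iff right_minus_eq)
  have "0 < m" using x by (simp add: h_def)
  then have "P x y = P' x y" for x y using PP'[of x y] by (simp add: hm)
  then show ?thesis by blast
qed

lemma pressure_at_0: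
  fixes P b :: "'a::finite \<Rightarrow> 'a \<Rightarrow> real"
  assumes "\<And>x y. 0 < P x y" "\<And>x. (\<Sum>y\<in>UNIV. P x y) = 1"
  shows "pressure P b 0 = 0"
  using perron_root_stochastic[of P] assms by (simp add: pressure_def tilted_def[abs_def])

text \<open>Tilting by -1 replaces P by P', which is stochastic as well.\<close>

lemma pressure_at_minus_1:
  fixes P P' :: "'a::finite \<Rightarrow> 'a \<Rightarrow> real"
  assumes P: "\<And>x y. 0 < P x y"
    and P': "\<And>x y. 0 < P' x y" "\<And>x. (\<Sum>y\<in>UNIV. P' x y) = 1"
  shows "pressure P (\<lambda>x y. ln (P x y / P' x y)) (- 1) = 0"
proof -
  have "tilted P (\<lambda>x y. ln (P x y / P' x y)) (- 1) = P'"
  proof (intro ext)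
    fix x y
    show "tilted P (\<lambda>x y. ln (P x y / P' x y)) (- 1) x y = P' x y"
      using P[of x y] P'(1)[of x y] by (simp add: tilted_def exp_minus)
  qed
  then show ?thesis using perron_root_stochastic[of P'] P' by (simp add: pressure_def)
qed

subsection \<open>Exponentials of kernels\<close>

lemma transfer_lincomb:
  fixes G :: "'a::finite \<Rightarrow> 'a \<Rightarrow> real"
  shows "transfer G (\<lambda>x. \<Sum>i\<in>I. a i * f i x) x = (\<Sum>i\<in>I. a i * transfer G (f i) x)"
  unfolding transfer_def sum_distrib_left by (subst sum.swap) (simp add: mult_ac)

lemma transfer_power_bound:
  fixes G :: "'a::finite \<Rightarrow> 'a \<Rightarrow> real"
  obtains B where "0 \<le> B"
    "\<And>f m k x. (\<And>y. \<bar>f y\<bar> \<le> m) \<Longrightarrow> \<bar>(transfer G ^^ k) f x\<bar> \<le> B ^ k * m"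
proof -
  define B where "B = (\<Sum>x\<in>UNIV. \<Sum>y\<in>UNIV. \<bar>G x y\<bar>)"
  have B: "0 \<le> B" by (auto simp: B_def intro!: sum_nonneg)
  have "\<bar>(transfer G ^^ k) f x\<bar> \<le> B ^ k * m" if f: "\<And>y. \<bar>f y\<bar> \<le> m" for f m k x
  proof (induction k arbitrary: x)
    case 0
    then show ?case using f by simp
  next
    case (Suc k)
    have m: "0 \<le> m" using f abs_ge_zero order_trans by blast
    have "\<bar>(transfer G ^^ Suc k) f x\<bar> \<le> (\<Sum>y\<in>UNIV. \<bar>G x y\<bar> * \<bar>(transfer G ^^ k) f y\<bar>)"
      by (simp add: transfer_def abs_mult[symmetric])
    also have "\<dots> \<le> (\<Sum>y\<in>UNIV. \<bar>G x y\<bar> * (B ^ k * m))"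
      by (intro sum_mono mult_left_mono Suc) auto
    also have "\<dots> = (\<Sum>y\<in>UNIV. \<bar>G x y\<bar>) * (B ^ k * m)" by (simp add: sum_distrib_right)
    also have "\<dots> \<le> B * (B ^ k * m)"
      unfolding B_def[of]
      using m B by (intro mult_right_mono member_le_sum[of x UNIV "\<lambda>x. \<Sum>y\<in>UNIV. \<bar>G x y\<bar>"])
        (auto simp: B_def[symmetric] intro: sum_nonneg)
    finally show ?case by simp
  qed
  then show ?thesis using that B by blast
qed

lemma finite_abs_bound:
  fixes f :: "'a::finite \<Rightarrow> real"
  obtains m where "0 < m" "\<And>y. \<bar>f y\<bar> \<le> m"
  using finite_upper_bound[of "\<lambda>y. \<bar>f y\<bar>"] by blast

lemma semigroup_summable:
  fixes G :: "'a::finite \<Rightarrow> 'a \<Rightarrow> real"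
  shows "summable (\<lambda>k. t ^ k / fact k * (transfer G ^^ k) f x)"
proof -
  obtain B where B: "0 \<le> B"
    "\<And>f m k x. (\<And>y. \<bar>f y\<bar> \<le> m) \<Longrightarrow> \<bar>(transfer G ^^ k) f x\<bar> \<le> B ^ k * m"
    using transfer_power_bound by blast
  obtain m where m: "0 < m" "\<And>y. \<bar>f y\<bar> \<le> m" using finite_abs_bound by blast
  have "summable (\<lambda>k. m * ((\<bar>t\<bar> * B) ^ k /\<^sub>R fact k))"
    by (intro summable_mult summable_exp_generic)
  then show ?thesis
  proof (rule summable_comparison_test')
    fix k :: nat
    have "\<bar>(transfer G ^^ k) f x\<bar> \<le> B ^ k * m" using B m by blast
    then have "\<bar>t\<bar> ^ k / fact k * \<bar>(transfer G ^^ k) f x\<bar> \<le> \<bar>t\<bar> ^ k / fact k * (B ^ k * m)"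
      by (intro mult_left_mono) auto
    then show "norm (t ^ k / fact k * (transfer G ^^ k) f x) \<le> m * ((\<bar>t\<bar> * B) ^ k /\<^sub>R fact k)"
      by (simp add: abs_mult power_abs power_mult_distrib field_simps)
  qed
qed

lemma transfer_semigroup:
  fixes G :: "'a::finite \<Rightarrow> 'a \<Rightarrow> real"
  shows "transfer G (semigroup_of (transfer G) t f) x = (\<Sum>k. t ^ k / fact k * (transfer G ^^ Suc k) f x)"
proof -
  have "(\<lambda>k. \<Sum>y\<in>UNIV. G x y * (t ^ k / fact k * (transfer G ^^ k) f y)) sums
      (\<Sum>y\<in>UNIV. G x y * semigroup_of (transfer G) t f y)"
    unfolding semigroup_of_def
    by (intro sums_sum sums_mult summable_sums semigroup_summable)
  moreover have "(\<Sum>y\<in>UNIV. G x y * (t ^ k / fact k * (transfer G ^^ k) f y))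
      = t ^ k / fact k * (transfer G ^^ Suc k) f x" for k
    by (simp add: transfer_def sum_distrib_left mult_ac)
  ultimately show ?thesis
    unfolding transfer_def[of G "semigroup_of (transfer G) t f"] by (simp add: sums_iff)
qed

lemma semigroup_0: "semigroup_of (transfer G) 0 f = f"
  unfolding semigroup_of_def
  using powser_zero[of "\<lambda>k. (transfer G ^^ k) f x / fact k" for x]
  by (intro ext) (simp add: mult.commute)

lemma semigroup_deriv:
  fixes G :: "'a::finite \<Rightarrow> 'a \<Rightarrow> real"
  shows "((\<lambda>t. semigroup_of (transfer G) t f x) has_real_derivative
    transfer G (semigroup_of (transfer G) t f) x) (at t)"
proof -
  define a where "a k = (transfer G ^^ k) f x / fact k" for k
  have "summable (\<lambda>k. a k * t ^ k)" for t
    using semigroup_summable[of t G f x] by (simp add: a_def mult.commute)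
  then have "((\<lambda>t. \<Sum>k. a k * t ^ k) has_real_derivative (\<Sum>k. diffs a k * t ^ k)) (at t)"
    by (rule termdiffs_strong_converges_everywhere)
  moreover have "diffs a k * t ^ k = t ^ k / fact k * (transfer G ^^ Suc k) f x" for k
    by (simp add: diffs_def a_def del: of_nat_Suc)
  moreover have "(\<Sum>k. a k * t ^ k) = semigroup_of (transfer G) t f x" for t
    by (simp add: semigroup_of_def a_def mult.commute)
  ultimately show ?thesis by (simp add: transfer_semigroup)
qed

text \<open>The derivatives of a solution are \<open>G^k w\<close>, so its Taylor remainder tends to zero.\<close>

lemma semigroup_unique:
  fixes G :: "'a::finite \<Rightarrow> 'a \<Rightarrow> real"
  assumes w: "\<And>t x. ((\<lambda>t. w t x) has_real_derivative transfer G (w t) x) (at t)"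
  shows "w t = semigroup_of (transfer G) t (w 0)"
proof
  fix x
  obtain B where B: "0 \<le> B"
    "\<And>f m k x. (\<And>y. \<bar>f y\<bar> \<le> m) \<Longrightarrow> \<bar>(transfer G ^^ k) f x\<bar> \<le> B ^ k * m"
    using transfer_power_bound by blast
  \<comment> \<open>A bound for w on the whole interval of possible intermediate points, needed
    because the Taylor remainder evaluates w at an unknown point that varies with n.\<close>
  have "compact ((\<lambda>s. \<Sum>y\<in>UNIV. \<bar>w s y\<bar>) ` {- \<bar>t\<bar>..\<bar>t\<bar>})"
    using DERIV_isCont[OF w]
    by (intro compact_continuous_image continuous_intros continuous_at_imp_continuous_on) auto
  then have "bounded ((\<lambda>s. \<Sum>y\<in>UNIV. \<bar>w s y\<bar>) ` {- \<bar>t\<bar>..\<bar>t\<bar>})" by (rule compact_imp_bounded)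
  then obtain m where m: "\<And>s. s \<in> {- \<bar>t\<bar>..\<bar>t\<bar>} \<Longrightarrow> norm (\<Sum>y\<in>UNIV. \<bar>w s y\<bar>) \<le> m"
    unfolding bounded_iff by blast
  have wm: "\<bar>w s y\<bar> \<le> m" if "\<bar>s\<bar> \<le> \<bar>t\<bar>" for s y
  proof -
    have "\<bar>w s y\<bar> \<le> (\<Sum>y\<in>UNIV. \<bar>w s y\<bar>)" by (rule member_le_sum) auto
    also have "\<dots> \<le> m" using m[of s] that by (simp add: abs_le_iff)
    finally show ?thesis .
  qed
  have D: "((\<lambda>t. (transfer G ^^ k) (w t) x) has_real_derivative (transfer G ^^ Suc k) (w t) x) (at t)" for k t x
  proof (induction k arbitrary: x)
    case (Suc k)
    have "((\<lambda>t. \<Sum>y\<in>UNIV. G x y * (transfer G ^^ k) (w t) y) has_real_derivative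
        (\<Sum>y\<in>UNIV. G x y * (transfer G ^^ Suc k) (w t) y)) (at t)"
      by (intro DERIV_sum DERIV_cmult Suc)
    then show ?case
      by (simp only: funpow.simps comp_def transfer_def[of G _ x])
  qed (simp add: w)
  have T: "\<bar>w t x - (\<Sum>k<n. t ^ k / fact k * (transfer G ^^ k) (w 0) x)\<bar> \<le> m * ((B * \<bar>t\<bar>) ^ n / fact n)" for n
  proof -
    obtain \<xi> where \<xi>: "\<bar>\<xi>\<bar> \<le> \<bar>t\<bar>" "w t x = (\<Sum>k<n. (transfer G ^^ k) (w 0) x / fact k * t ^ k)
        + (transfer G ^^ n) (w \<xi>) x / fact n * t ^ n"
      using Maclaurin_all_le[of "\<lambda>k t. (transfer G ^^ k) (w t) x" "\<lambda>t. w t x" t n] D by auto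
    have "w t x - (\<Sum>k<n. t ^ k / fact k * (transfer G ^^ k) (w 0) x) = (transfer G ^^ n) (w \<xi>) x / fact n * t ^ n"
      using \<xi>(2) by (simp add: mult.commute)
    also have "\<bar>\<dots>\<bar> = \<bar>(transfer G ^^ n) (w \<xi>) x\<bar> * (\<bar>t\<bar> ^ n / fact n)" by (simp add: abs_mult power_abs)
    also have "\<dots> \<le> (B ^ n * m) * (\<bar>t\<bar> ^ n / fact n)"
      using wm[OF \<xi>(1)] by (intro mult_right_mono B(2)) auto
    finally show ?thesis by (simp add: power_mult_distrib mult_ac)
  qed
  have "(\<lambda>n. m * ((B * \<bar>t\<bar>) ^ n / fact n)) \<longlonglongrightarrow> m * 0"
    using summable_LIMSEQ_zero[OF summable_exp_generic[of "B * \<bar>t\<bar>"]]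
    by (intro tendsto_mult tendsto_const) (simp add: divide_inverse mult.commute)
  then have "(\<lambda>n. m * ((B * \<bar>t\<bar>) ^ n / fact n)) \<longlonglongrightarrow> 0" by simp
  then have "(\<lambda>n. w t x - (\<Sum>k<n. t ^ k / fact k * (transfer G ^^ k) (w 0) x)) \<longlonglongrightarrow> 0"
    by (rule Lim_null_comparison[rotated]) (use T in auto)
  from tendsto_diff[OF tendsto_const this, of "w t x"]
  have "(\<lambda>n. \<Sum>k<n. t ^ k / fact k * (transfer G ^^ k) (w 0) x) \<longlonglongrightarrow> w t x" by simp
  then show "w t x = semigroup_of (transfer G) t (w 0) x"
    by (simp add: semigroup_of_def sums_def[symmetric] sums_iff)
qed

text \<open>Both sides solve the same linear equation in t and agree at t = 0. Times of either sign
  are allowed, so the operators form a group; this is used below to invert them.\<close>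

lemma semigroup_add:
  fixes G :: "'a::finite \<Rightarrow> 'a \<Rightarrow> real"
  shows "semigroup_of (transfer G) (t + s) f = semigroup_of (transfer G) t (semigroup_of (transfer G) s f)"
proof -
  have "((\<lambda>t. semigroup_of (transfer G) (t + s) f x) has_real_derivative
    transfer G (semigroup_of (transfer G) (t + s) f) x) (at t)" for t x
    using semigroup_deriv[of G f x "t + s"] by (simp add: DERIV_shift)
  from semigroup_unique[of "\<lambda>t. semigroup_of (transfer G) (t + s) f" G, OF this] show ?thesis by simp
qed

lemma semigroup_scale:
  fixes G :: "'a::finite \<Rightarrow> 'a \<Rightarrow> real"
  shows "semigroup_of (transfer (\<lambda>x y. q * G x y)) t f = semigroup_of (transfer G) (q * t) f"
proof -
  let ?S = "semigroup_of (transfer G)"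
  have "((\<lambda>t. ?S (q * t) f x) has_real_derivative transfer (\<lambda>x y. q * G x y) (?S (q * t) f) x) (at t)" for t x
  proof -
    have "((\<lambda>t. ?S (q * t) f x) has_real_derivative transfer G (?S (q * t) f) x * q) (at t)"
      by (rule DERIV_chain2[OF semigroup_deriv]) (auto intro!: derivative_eq_intros)
    then show ?thesis by (simp add: transfer_def sum_distrib_left mult_ac)
  qed
  from semigroup_unique[of "\<lambda>t. ?S (q * t) f" "\<lambda>x y. q * G x y", OF this, of t] show ?thesis
    by (simp add: semigroup_0)
qed

text \<open>The combination of the solutions started from indicators solves the same equation and
  starts at f.\<close>

lemma semigroup_kernel:
  fixes G :: "'a::finite \<Rightarrow> 'a \<Rightarrow> real"
  shows "semigroup_of (transfer G) t f x = (\<Sum>y\<in>UNIV. transition_prob (transfer G) t x y * f y)"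
proof -
  have D: "((\<lambda>t. \<Sum>y\<in>UNIV. f y * transition_prob (transfer G) t x y) has_real_derivative
      transfer G (\<lambda>x. \<Sum>y\<in>UNIV. f y * transition_prob (transfer G) t x y) x) (at t)" for t x
    unfolding transfer_lincomb transition_prob_def
    by (intro DERIV_sum DERIV_cmult semigroup_deriv)
  have 0: "(\<lambda>x. \<Sum>y\<in>UNIV. f y * transition_prob (transfer G) 0 x y) = f"
    by (intro ext) (simp add: transition_prob_def semigroup_0 indicator_def mult.commute if_distrib cong: if_cong)
  show ?thesis
    using semigroup_unique[of "\<lambda>t x. \<Sum>y\<in>UNIV. f y * transition_prob (transfer G) t x y" G, OF D, of t]
    unfolding 0 by (simp add: mult.commute fun_eq_iff)
qed

lemma transition_prob_sum:
  fixes G :: "'a::finite \<Rightarrow> 'a \<Rightarrow> real"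
  assumes "\<And>x. (\<Sum>y\<in>UNIV. G x y) = 0"
  shows "(\<Sum>y\<in>UNIV. transition_prob (transfer G) t x y) = 1"
proof -
  have "((\<lambda>t. 1::real) has_real_derivative transfer G (\<lambda>_. 1) x) (at t)" for t x
    using assms by (simp add: transfer_def)
  from semigroup_unique[of "\<lambda>_ _. 1" G, OF this, of t]
  show ?thesis using semigroup_kernel[of G t "\<lambda>_. 1" x] by (simp add: fun_eq_iff)
qed

lemma left_null_invariant:
  fixes G :: "'a::finite \<Rightarrow> 'a \<Rightarrow> real"
  assumes "\<And>y. (\<Sum>x\<in>UNIV. \<nu> x * G x y) = 0"
  shows "(\<Sum>x\<in>UNIV. \<nu> x * transition_prob (transfer G) t x y) = \<nu> y"
proof -
  let ?g = "\<lambda>t. \<Sum>x\<in>UNIV. \<nu> x * transition_prob (transfer G) t x y"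
  have "(?g has_real_derivative 0) (at t)" for t
  proof -
    have "(?g has_real_derivative (\<Sum>x\<in>UNIV. \<nu> x * transfer G (semigroup_of (transfer G) t (indicator {y})) x)) (at t)"
      unfolding transition_prob_def by (intro DERIV_sum DERIV_cmult semigroup_deriv)
    moreover have "(\<Sum>x\<in>UNIV. \<nu> x * transfer G f x) = 0" for f
    proof -
      have "(\<Sum>x\<in>UNIV. \<nu> x * transfer G f x) = (\<Sum>z\<in>UNIV. (\<Sum>x\<in>UNIV. \<nu> x * G x z) * f z)"
        unfolding transfer_def sum_distrib_left sum_distrib_right
        by (subst sum.swap) (simp add: mult_ac)
      then show ?thesis by (simp add: assms)
    qed
    ultimately show ?thesis by simp
  qed
  then have "?g t = ?g 0" using DERIV_isconst_all by blast
  also have "\<dots> = \<nu> y"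
    by (simp add: transition_prob_def semigroup_0 indicator_def if_distrib cong: if_cong)
  finally show ?thesis .
qed

text \<open>Invariance is assumed for t \<ge> 0, so it is differentiated at the interior time 1.
  Starting from the indicator moved back by one unit of time makes the derivative there a column of
  G.\<close>

lemma invariant_imp_left_null:
  fixes G :: "'a::finite \<Rightarrow> 'a \<Rightarrow> real"
  assumes inv: "\<And>t f. 0 \<le> t \<Longrightarrow> (\<Sum>x\<in>UNIV. \<nu> x * semigroup_of (transfer G) t f x) = (\<Sum>x\<in>UNIV. \<nu> x * f x)"
  shows "(\<Sum>x\<in>UNIV. \<nu> x * G x y) = 0"
proof -
  let ?S = "semigroup_of (transfer G)"
  define f where "f = ?S (- 1) (indicator {y})"
  have "((\<lambda>t. \<Sum>x\<in>UNIV. \<nu> x * ?S t f x) has_real_derivative (\<Sum>x\<in>UNIV. \<nu> x * transfer G (?S 1 f) x)) (at 1)"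
    by (intro DERIV_sum DERIV_cmult semigroup_deriv)
  moreover have "((\<lambda>t. \<Sum>x\<in>UNIV. \<nu> x * ?S t f x) has_real_derivative 0) (at 1)"
    by (rule has_field_derivative_transform_within_open[where f = "\<lambda>_. \<Sum>x\<in>UNIV. \<nu> x * f x" and S = "{0<..}"])
       (auto simp: inv)
  ultimately have "(\<Sum>x\<in>UNIV. \<nu> x * transfer G (?S 1 f) x) = 0" by (rule DERIV_unique)
  moreover have "?S 1 f = indicator {y}"
    unfolding f_def semigroup_add[symmetric] by (simp add: semigroup_0)
  ultimately show ?thesis by (simp add: transfer_def indicator_def if_distrib cong: if_cong)
qed

subsection \<open>Generators of irreducible chains\<close>

definition generator_kernel :: "('a::finite \<Rightarrow> real) \<Rightarrow> ('a \<Rightarrow> 'a pmf) \<Rightarrow> 'a \<Rightarrow> 'a \<Rightarrow> real" where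
  "generator_kernel c p x y = c x * (pmf (p x) y - (if y = x then 1 else 0))"

lemma sum_pmf_finite: "(\<Sum>y\<in>UNIV. pmf (q :: 'a::finite pmf) y) = 1"
  by (rule sum_pmf_eq_1) auto

lemma generator_kernel_sum: "(\<Sum>y\<in>UNIV. generator_kernel c p x y) = 0"
  unfolding generator_kernel_def sum_distrib_left[symmetric]
  by (simp add: sum_subtractf sum_pmf_finite)

lemma generator_eq_transfer: "generator c p = transfer (generator_kernel c p)"
proof (intro ext)
  fix f x
  have "generator c p f x = (\<Sum>y\<in>UNIV. c x * pmf (p x) y * f y) - (c x * f x) * (\<Sum>y\<in>UNIV. pmf (p x) y)"
    unfolding generator_def by (simp add: right_diff_distrib sum_subtractf sum_distrib_left mult_ac)
  also have "\<dots> = (\<Sum>y\<in>UNIV. c x * pmf (p x) y * f y) - (\<Sum>y\<in>UNIV. (if y = x then c x * f y else 0))"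
    by (simp add: sum_pmf_finite)
  also have "\<dots> = transfer (generator_kernel c p) f x"
    unfolding transfer_def generator_kernel_def sum_subtractf[symmetric]
    by (intro sum.cong refl) (simp add: algebra_simps)
  finally show "generator c p f x = transfer (generator_kernel c p) f x" .
qed

text \<open>Uniformization: adding a large multiple of the identity to the generator makes its kernel
  nonnegative and only multiplies the exponential by a positive scalar.\<close>

lemma transition_prob_pos:
  fixes p :: "'a::finite \<Rightarrow> 'a pmf"
  assumes irr: "irreducible_chain p" and c: "\<And>x. 0 < c x" and t: "0 < t"
  shows "0 < transition_prob (generator c p) t x y"
proof -
  define G where "G = generator_kernel c p"
  obtain m where m: "0 < m" "\<And>x. c x \<le> m" using finite_upper_bound by blast
  define R where "R x y = G x y + (if y = x then m else 0)" for x y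
  have R_ge: "c x * pmf (p x) y \<le> R x y" for x y
    using c[of x] m(2)[of x] by (simp add: R_def G_def generator_kernel_def right_diff_distrib)
  have R0: "0 \<le> R x y" for x y
    using R_ge[of x y] c[of x] by (meson less_imp_le mult_nonneg_nonneg order_trans pmf_nonneg)
  have mono: "transfer R f x \<le> transfer R g x" if "\<And>x. f x \<le> g x" for f g x
    unfolding transfer_def by (intro sum_mono mult_left_mono that R0)
  have mono_k: "(transfer R ^^ k) f x \<le> (transfer R ^^ k) g x" if "\<And>x. f x \<le> g x" for k f g x
    using that by (induction k arbitrary: x) (auto intro!: mono)
  have nonneg: "0 \<le> (transfer R ^^ k) (indicator {y}) x" for k x y
    by (induction k arbitrary: x) (auto simp: transfer_def R0 intro!: sum_nonneg)
  have pos: "0 < (transfer R ^^ n) (indicator {y}) x" if "0 < pmf (n_step p n x) y" for n y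
    using that
  proof (induction n arbitrary: y)
    case 0
    then show ?case by (simp add: n_step_def pmf_return split: if_splits)
  next
    case (Suc n)
    have "n_step p (Suc n) x = bind_pmf (n_step p n x) p" by (simp add: n_step_def)
    then have "y \<in> set_pmf (bind_pmf (n_step p n x) p)" using Suc.prems unfolding set_pmf_iff by (metis less_irrefl)
    then obtain z where "z \<in> set_pmf (n_step p n x)" "y \<in> set_pmf (p z)" by auto
    then have z: "0 < pmf (n_step p n x) z" "0 < pmf (p z) y" by (auto intro: pmf_positive)
    have Ry: "transfer R (indicator {y}) u = R u y" for u
      by (simp add: transfer_def indicator_def if_distrib cong: if_cong)
    have Rz: "0 < R z y" using R_ge[of z y] c[of z] z(2) by (meson less_le_trans mult_pos_pos)
    have "0 < R z y * (transfer R ^^ n) (indicator {z}) x" using Rz Suc.IH z by simp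
    also have "\<dots> = (transfer R ^^ n) (\<lambda>u. R z y * indicator {z} u) x"
      by (simp add: transfer_power_scale)
    also have "\<dots> \<le> (transfer R ^^ n) (transfer R (indicator {y})) x"
      by (rule mono_k) (auto simp: Ry R0 indicator_def)
    finally show ?case by (simp add: funpow_swap1)
  qed
  obtain n where n: "0 < pmf (n_step p n x) y" using irr by (auto simp: irreducible_chain_def)
  have "0 < t ^ n / fact n * (transfer R ^^ n) (indicator {y}) x" using pos[OF n] t by simp
  also have "\<dots> \<le> semigroup_of (transfer R) t (indicator {y}) x"
    unfolding semigroup_of_def
    using sum_le_suminf[OF semigroup_summable[of t R "indicator {y}" x], of "{n}"] nonneg t by auto
  finally have *: "0 < semigroup_of (transfer R) t (indicator {y}) x" .
  define w where "w t x = exp (- m * t) * semigroup_of (transfer R) t (indicator {y}) x" for t x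
  have "((\<lambda>t. w t x) has_real_derivative transfer G (w t) x) (at t)" for t x
  proof -
    let ?S = "semigroup_of (transfer R) t (indicator {y})"
    have "((\<lambda>t. w t x) has_real_derivative
        exp (- m * t) * transfer R ?S x + (exp (- m * t) * - m) * ?S x) (at t)"
      unfolding w_def by (rule derivative_eq_intros semigroup_deriv | simp)+
    moreover have "transfer R ?S x = transfer G ?S x + m * ?S x"
      by (simp add: transfer_def R_def distrib_right sum.distrib if_distrib[of "\<lambda>u. u * _"] cong: if_cong)
    moreover have "transfer G (w t) x = exp (- m * t) * transfer G ?S x"
      using fun_cong[OF transfer_scale[of G "exp (- m * t)" ?S], of x] by (simp add: w_def[abs_def])
    ultimately show ?thesis by (simp add: algebra_simps)
  qed
  from semigroup_unique[of w G, OF this, of t]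
  have "w t = semigroup_of (transfer G) t (w 0)" .
  moreover have "w 0 = indicator {y}" by (simp add: w_def fun_eq_iff semigroup_0)
  ultimately have "transition_prob (transfer G) t x y = w t x"
    by (simp add: transition_prob_def)
  then show ?thesis using * by (simp add: w_def generator_eq_transfer G_def)
qed

lemma transition_prob_stochastic: "(\<Sum>y\<in>UNIV. transition_prob (generator c p) t x y) = 1"
  unfolding generator_eq_transfer by (rule transition_prob_sum[OF generator_kernel_sum])

section \<open>Stationary distributions and recovery of the rates\<close>

lemma stationary_left_null:
  assumes "stationary_dist (generator c p) \<mu>"
  shows "(\<Sum>x\<in>UNIV. pmf \<mu> x * generator_kernel c p x y) = 0"
  using assms invariant_imp_left_null[of "pmf \<mu>" "generator_kernel c p" y]
  by (simp add: stationary_dist_def generator_eq_transfer integral_measure_pmf[of UNIV])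

lemma stationary_invariant:
  assumes "stationary_dist (generator c p) \<mu>"
  shows "(\<Sum>x\<in>UNIV. pmf \<mu> x * transition_prob (generator c p) t x y) = pmf \<mu> y"
  unfolding generator_eq_transfer
  by (rule left_null_invariant[OF stationary_left_null[OF assms]])

lemma stationary_pos:
  fixes p :: "'a::finite \<Rightarrow> 'a pmf"
  assumes irr: "irreducible_chain p" and c: "\<And>x. 0 < c x" and st: "stationary_dist (generator c p) \<mu>"
  shows "0 < pmf \<mu> y"
proof -
  obtain x where "x \<in> set_pmf \<mu>" using set_pmf_not_empty[of \<mu>] by auto
  then have x: "0 < pmf \<mu> x" by (rule pmf_positive)
  have "0 < pmf \<mu> x * transition_prob (generator c p) 1 x y"
    using x transition_prob_pos[of p c 1, OF irr c] by simp
  also have "\<dots> \<le> (\<Sum>x\<in>UNIV. pmf \<mu> x * transition_prob (generator c p) 1 x y)"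
    using transition_prob_pos[of p c 1, OF irr c]
    by (intro member_le_sum) (auto simp: less_imp_le)
  also have "\<dots> = pmf \<mu> y" by (rule stationary_invariant[OF st])
  finally show ?thesis .
qed

text \<open>Subtract from \<nu>' the largest multiple of \<nu> that stays below it. The difference
  is invariant, nonnegative and zero at some z, and the positive entries of column z force it to
  vanish everywhere.\<close>

lemma invariant_proportional:
  fixes P :: "'a::finite \<Rightarrow> 'a \<Rightarrow> real"
  assumes P: "\<And>x y. 0 < P x y"
    and \<nu>: "\<And>x. 0 < \<nu> x" "\<And>y. (\<Sum>x\<in>UNIV. \<nu> x * P x y) = \<nu> y"
    and \<nu>': "\<And>x. 0 < \<nu>' x" "\<And>y. (\<Sum>x\<in>UNIV. \<nu>' x * P x y) = \<nu>' y"
  obtains k where "0 < k" "\<And>x. \<nu>' x = k * \<nu> x"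
proof -
  define k where "k = Min (range (\<lambda>x. \<nu>' x / \<nu> x))"
  have "k \<in> range (\<lambda>x. \<nu>' x / \<nu> x)" unfolding k_def by (rule Min_in) auto
  then obtain z where z: "k = \<nu>' z / \<nu> z" by auto
  have le: "0 \<le> \<nu>' x - k * \<nu> x" for x
  proof -
    have "k \<le> \<nu>' x / \<nu> x" by (simp add: k_def)
    then show ?thesis using \<nu>(1)[of x] by (simp add: field_simps)
  qed
  have "(\<Sum>x\<in>UNIV. (\<nu>' x - k * \<nu> x) * P x z) = \<nu>' z - k * \<nu> z"
    by (simp add: left_diff_distrib sum_subtractf \<nu>' \<nu> mult.assoc sum_distrib_left[symmetric])
  also have "\<dots> = 0" using z \<nu>(1)[of z] by simp
  finally have "(\<nu>' x - k * \<nu> x) * P x z = 0" for x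
    using le P by (subst (asm) sum_nonneg_eq_0_iff) (auto simp: less_imp_le)
  then have "\<nu>' x = k * \<nu> x" for x
    using P[of x z] by (metis less_irrefl mult_eq_0_iff right_minus_eq)
  moreover have "0 < k" using z \<nu> \<nu>' by simp
  ultimately show ?thesis using that by blast
qed

text \<open>Matrix exponentials are not injective in general. Here equality of the exponentials makes
  the generators proportional, and a proportionality factor other than \<open>1\<close> would make
  the transition matrix trivial at a positive time.\<close>

lemma transition_prob_inject:
  fixes p :: "'a::finite \<Rightarrow> 'a pmf"
  assumes irr: "irreducible_chain p" and p0: "\<And>x. pmf (p x) x = 0"
    and c: "\<And>x. 0 < c x" and c': "\<And>x. 0 < c' x"
    and st: "stationary_dist (generator c p) \<mu>" and st': "stationary_dist (generator c' p) \<mu>'"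
    and \<delta>: "0 < \<delta>"
    and eq: "transition_prob (generator c p) \<delta> = transition_prob (generator c' p) \<delta>"
  shows "c = c'"
proof -
  let ?P = "transition_prob (generator c p) \<delta>" and ?G = "generator_kernel c p"
  let ?S = "semigroup_of (transfer ?G)"
  have P: "0 < ?P x y" for x y by (rule transition_prob_pos[OF irr c \<delta>])
  note \<mu> = stationary_pos[of p c \<mu>, OF irr c st] and \<mu>' = stationary_pos[of p c' \<mu>', OF irr c' st']
  obtain a where a: "0 < a" "\<And>x. pmf \<mu>' x = a * pmf \<mu> x"
  proof (rule invariant_proportional[of ?P "pmf \<mu>" "pmf \<mu>'"])
    show "(\<Sum>x\<in>UNIV. pmf \<mu>' x * ?P x y) = pmf \<mu>' y" for y
      unfolding eq by (rule stationary_invariant[OF st'])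
  qed (use P \<mu> \<mu>' stationary_invariant[OF st] in auto)
  have "a * (\<Sum>x\<in>UNIV. pmf \<mu> x) = (\<Sum>x\<in>UNIV. pmf \<mu>' x)" by (simp add: a(2) sum_distrib_left)
  then have "a = 1" by (simp add: sum_pmf_finite)
  \<comment> \<open>The two stationary laws coincide and the generators share p, so this reweighting
    by c' / c turns the balance equation for c' into one for c. Proportionality of \<nu> to the
    stationary law then says that c' / c is constant.\<close>
  define \<nu> where "\<nu> x = pmf \<mu> x * c' x / c x" for x
  have "(\<Sum>x\<in>UNIV. \<nu> x * ?G x y) = (\<Sum>x\<in>UNIV. pmf \<mu>' x * generator_kernel c' p x y)" for y
  proof (intro sum.cong refl)
    fix x show "\<nu> x * ?G x y = pmf \<mu>' x * generator_kernel c' p x y"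
      using c[of x] a(2)[of x] \<open>a = 1\<close> by (simp add: \<nu>_def generator_kernel_def)
  qed
  then have "(\<Sum>x\<in>UNIV. \<nu> x * ?G x y) = 0" for y using stationary_left_null[OF st'] by simp
  then have \<nu>_inv: "(\<Sum>x\<in>UNIV. \<nu> x * ?P x y) = \<nu> y" for y
    unfolding generator_eq_transfer by (rule left_null_invariant)
  obtain k where k: "0 < k" "\<And>x. \<nu> x = k * pmf \<mu> x"
  proof (rule invariant_proportional[of ?P "pmf \<mu>" \<nu>])
    show "0 < \<nu> x" for x using \<mu>[of x] c[of x] c'[of x] by (simp add: \<nu>_def)
  qed (use P \<mu> \<nu>_inv stationary_invariant[OF st] in auto)
  have c'_eq: "c' x = k * c x" for x
    using k(2)[of x] c[of x] \<mu>[of x] by (simp add: \<nu>_def field_simps)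
  have "generator_kernel c' p = (\<lambda>x y. k * ?G x y)"
    by (intro ext) (simp add: generator_kernel_def c'_eq)
  then have "?S \<delta> (indicator {y}) x = ?S (k * \<delta>) (indicator {y}) x" for x y
    using fun_cong[OF fun_cong[OF eq, of x], of y]
    by (simp add: transition_prob_def generator_eq_transfer semigroup_scale)
  then have S_eq: "?S \<delta> (indicator {y}) = ?S (k * \<delta>) (indicator {y})" for y by blast
  \<comment> \<open>By the group property, equal values at times s and r make the operator at time s
    - r fix the indicator. At a positive time difference this contradicts positivity off the
    diagonal.\<close>
  have trivial: "transition_prob (generator c p) (s - r) x y = indicator {y} x"
    if "?S s (indicator {y}) = ?S r (indicator {y})" for s r x y
  proof -
    have "?S (- r + s) (indicator {y}) = ?S (- r) (?S r (indicator {y}))"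
      by (simp only: semigroup_add that)
    also have "\<dots> = indicator {y}" by (simp add: semigroup_add[symmetric] semigroup_0)
    finally show ?thesis by (simp add: transition_prob_def generator_eq_transfer)
  qed
  obtain x :: 'a where True by blast
  obtain y where "y \<in> set_pmf (p x)" using set_pmf_not_empty[of "p x"] by auto
  then have xy: "x \<noteq> y" using p0[of x] by (auto simp: set_pmf_iff)
  have "k = 1"
  proof (rule ccontr)
    assume "k \<noteq> 1"
    then consider "\<delta> < k * \<delta>" | "k * \<delta> < \<delta>" using \<delta> by fastforce
    then show False
    proof cases
      case 1
      then show ?thesis
        using trivial[OF S_eq[of y, symmetric], of x] transition_prob_pos[of p c "k * \<delta> - \<delta>" x y, OF irr c] xy by simp
    next
      case 2
      then show ?thesis
        using trivial[OF S_eq[of y], of x] transition_prob_pos[of p c "\<delta> - k * \<delta>" x y, OF irr c] xy by simp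
    qed
  qed
  then show ?thesis using c'_eq by auto
qed

subsection \<open>Words of a stationary Markov chain\<close>

definition word_prob :: "('a \<Rightarrow> real) \<Rightarrow> ('a \<Rightarrow> 'a \<Rightarrow> real) \<Rightarrow> 'a list \<Rightarrow> real" where
  "word_prob m P l = m (hd l) * word_weight P l"

text \<open>A hit at k occupies the indices k + 1 to k + \<open>length a\<close>. This matches
  \<open>waiting_time\<close>, where the word to be found starts at index 1.\<close>

definition hit :: "'a list \<Rightarrow> nat \<Rightarrow> (nat \<Rightarrow> 'a) \<Rightarrow> bool" where
  "hit a k y \<longleftrightarrow> map y [Suc k..<Suc (k + length a)] = a"

definition hitting_time :: "'a list \<Rightarrow> (nat \<Rightarrow> 'a) \<Rightarrow> ennreal" where
  "hitting_time a y = (INF k\<in>{k. 1 \<le> k \<and> hit a k y}. of_nat k)"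

lemma word_weight_append:
  assumes "l \<noteq> []" "r \<noteq> []"
  shows "word_weight K (l @ r) = word_weight K l * (K (last l) (hd r) * word_weight K r)"
  using assms
proof (induction l rule: induct_list012)
  case (2 x)
  then show ?case by (cases r) auto
qed (auto simp: mult_ac)

lemma word_weight_map:
  "word_weight K (map x [0..<Suc n]) = (\<Prod>i<n. K (x i) (x (Suc i)))"
proof (induction n)
  case (Suc n)
  have "map x [0..<Suc (Suc n)] = map x [0..<Suc n] @ [x (Suc n)]" by simp
  then have "word_weight K (map x [0..<Suc (Suc n)])
      = word_weight K (map x [0..<Suc n]) * (K (last (map x [0..<Suc n])) (x (Suc n)) * 1)"
    using word_weight_append[of "map x [0..<Suc n]" "[x (Suc n)]" K] by simp
  also have "last (map x [0..<Suc n]) = x n" by simp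
  finally show ?case using Suc by simp
qed simp

lemma word_weight_pos:
  fixes K :: "'a \<Rightarrow> 'a \<Rightarrow> real"
  assumes "\<And>x y. 0 < K x y"
  shows "0 < word_weight K l"
  by (induction l rule: induct_list012) (auto simp: assms)

lemma hitting_time_ge_1: "1 \<le> hitting_time a y"
  unfolding hitting_time_def by (rule INF_greatest) (metis (no_types, lifting) mem_Collect_eq of_nat_1 of_nat_mono)

lemma hitting_time_cases:
  obtains "hitting_time a y = \<infinity>" "\<And>k. 1 \<le> k \<Longrightarrow> \<not> hit a k y"
  | k where "1 \<le> k" "hit a k y" "hitting_time a y = of_nat k" "\<And>j. 1 \<le> j \<Longrightarrow> j < k \<Longrightarrow> \<not> hit a j y"
proof (cases "\<exists>k\<ge>1. hit a k y")
  case False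
  then have "{k. 1 \<le> k \<and> hit a k y} = {}" by auto
  then have "hitting_time a y = \<infinity>" by (simp add: hitting_time_def)
  then show ?thesis using that(1) False by blast
next
  case True
  define k where "k = (LEAST k. 1 \<le> k \<and> hit a k y)"
  have k: "1 \<le> k \<and> hit a k y"
    using True LeastI_ex[of "\<lambda>k. 1 \<le> k \<and> hit a k y"] unfolding k_def by blast
  have least: "k \<le> j" if "1 \<le> j" "hit a j y" for j
    unfolding k_def using that by (intro Least_le) auto
  have "hitting_time a y = of_nat k"
    unfolding hitting_time_def
  proof (rule antisym)
    show "(INF k\<in>{k. 1 \<le> k \<and> hit a k y}. of_nat k) \<le> (of_nat k :: ennreal)"
      using k by (intro INF_lower2[of k]) auto
    show "(of_nat k :: ennreal) \<le> (INF k\<in>{k. 1 \<le> k \<and> hit a k y}. of_nat k)"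
      using least by (intro INF_greatest) (auto intro: of_nat_mono)
  qed
  moreover have "\<not> hit a j y" if "1 \<le> j" "j < k" for j
    using least[OF that(1)] that(2) by auto
  ultimately show ?thesis using that(2) k by blast
qed

text \<open>All that is kept of the continuous-time process: the cylinder probabilities of the
  sampled path, with an entrywise positive kernel and an invariant initial law.\<close>

locale stationary_chain =
  fixes P :: "'a::finite \<Rightarrow> 'a \<Rightarrow> real" and m :: "'a \<Rightarrow> real" and D :: "(nat \<Rightarrow> 'a) measure"
  assumes P_pos: "\<And>x y. 0 < P x y" and P_sum: "\<And>x. (\<Sum>y\<in>UNIV. P x y) = 1"
    and m_pos: "\<And>x. 0 < m x" and m_sum: "(\<Sum>x\<in>UNIV. m x) = 1"
    and m_inv: "\<And>y. (\<Sum>x\<in>UNIV. m x * P x y) = m y"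
    and prob_D: "prob_space D" and sets_D: "sets D = sets (\<Pi>\<^sub>M i\<in>UNIV. count_space UNIV)"
    and cylinder: "\<And>n x. measure D {\<omega>. \<forall>i\<le>n. \<omega> i = x i} = m (x 0) * (\<Prod>i<n. P (x i) (x (Suc i)))"
begin

sublocale prob_space D by (rule prob_D)

lemma space_D: "space D = UNIV"
  using sets_eq_imp_space_eq[OF sets_D] by (simp add: space_PiM)

lemma coordinate_measurable [measurable]: "(\<lambda>\<omega>. \<omega> i) \<in> measurable D (count_space UNIV)"
  unfolding measurable_cong_sets[OF sets_D refl] by (rule measurable_component_singleton) simp

lemma word_measurable [measurable]: "(\<lambda>\<omega>. map \<omega> [i..<j]) \<in> measurable D (count_space UNIV)"
proof -
  have "(\<lambda>\<omega>. map \<omega> [i..<j]) -` {l} \<inter> space D \<in> sets D" for l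
  proof -
    have "(\<lambda>\<omega>. map \<omega> [i..<j]) -` {l} \<inter> space D
        = (if length l = j - i then {\<omega>\<in>space D. \<forall>k<j - i. \<omega> (i + k) = l ! k} else {})"
      by (auto simp: list_eq_iff_nth_eq)
    then show ?thesis by simp measurable
  qed
  then show ?thesis
    by (subst measurable_count_space_eq2_countable) auto
qed

lemma cylinder_word:
  assumes "length l = Suc n"
  shows "prob {\<omega>. map \<omega> [0..<Suc n] = l} = word_prob m P l"
proof -
  have l: "l = map ((!) l) [0..<Suc n]" using assms by (metis map_nth)
  have "{\<omega>. map \<omega> [0..<Suc n] = l} = {\<omega>. \<forall>i\<le>n. \<omega> i = l ! i}"
    using assms by (auto simp: list_eq_iff_nth_eq less_Suc_eq_le simp del: upt_Suc)
  then have "prob {\<omega>. map \<omega> [0..<Suc n] = l} = m (l ! 0) * (\<Prod>i<n. P (l ! i) (l ! Suc i))"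
    by (simp add: cylinder)
  also have "(\<Prod>i<n. P (l ! i) (l ! Suc i)) = word_weight P l"
    using word_weight_map[of P "(!) l" n] l by simp
  also have "l ! 0 = hd l" using assms by (subst hd_conv_nth) auto
  finally show ?thesis by (simp add: word_prob_def)
qed

lemma word_prob_pos: "0 < word_prob m P l"
  by (simp add: word_prob_def m_pos word_weight_pos P_pos)

lemma prob_words:
  assumes "0 < k"
  shows "prob {\<omega>. map \<omega> [0..<k] \<in> B} = (\<Sum>l | length l = k \<and> l \<in> B. word_prob m P l)"
proof -
  have fin: "finite {l :: 'a list. length l = k \<and> l \<in> B}"
    by (rule finite_subset[OF _ finite_words[of k]]) auto
  have "{\<omega>. map \<omega> [0..<k] \<in> B} = (\<Union>l\<in>{l. length l = k \<and> l \<in> B}. {\<omega>\<in>space D. map \<omega> [0..<k] = l})"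
    by (auto simp: space_D)
  also have "prob \<dots> = (\<Sum>l | length l = k \<and> l \<in> B. prob {\<omega>\<in>space D. map \<omega> [0..<k] = l})"
  proof (rule finite_measure_finite_Union[OF fin])
    show "(\<lambda>l. {\<omega>\<in>space D. map \<omega> [0..<k] = l}) ` {l. length l = k \<and> l \<in> B} \<subseteq> sets D"
      by auto
  qed (auto simp: disjoint_family_on_def)
  also have "\<dots> = (\<Sum>l | length l = k \<and> l \<in> B. word_prob m P l)"
  proof (rule sum.cong[OF refl])
    fix l :: "'a list" assume "l \<in> {l. length l = k \<and> l \<in> B}"
    then show "prob {\<omega>\<in>space D. map \<omega> [0..<k] = l} = word_prob m P l"
      using cylinder_word[of l "k - 1"] assms by (simp add: space_D)
  qed
  finally show ?thesis .
qed

lemma word_prob_append: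
  assumes "a \<noteq> []"
  shows "word_prob m P (l @ a) = word_prob m P (l @ [hd a]) * word_weight P a"
  using assms by (cases "l = []") (auto simp: word_prob_def word_weight_append)

text \<open>Summing out the letters from the left uses invariance of m once per letter.\<close>

lemma sum_word_prob_snoc: "(\<Sum>l | length l = k. word_prob m P (l @ [z])) = m z"
proof (induction k)
  case 0
  have "{l :: 'a list. length l = 0} = {[]}" by auto
  then show ?case by (simp add: word_prob_def)
next
  case (Suc k)
  have "(\<Sum>x\<in>UNIV. word_prob m P (x # l @ [z])) = word_prob m P (l @ [z])" for l
  proof -
    have "word_prob m P (x # l @ [z]) = (m x * P x (hd (l @ [z]))) * word_weight P (l @ [z])" for x
      by (cases l) (auto simp: word_prob_def)
    then have "(\<Sum>x\<in>UNIV. word_prob m P (x # l @ [z]))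
        = (\<Sum>x\<in>UNIV. m x * P x (hd (l @ [z]))) * word_weight P (l @ [z])"
      unfolding sum_distrib_right by (intro sum.cong refl)
    then show ?thesis by (simp only: m_inv word_prob_def)
  qed
  then show ?case using Suc
    by (simp add: sum_words_Suc) (subst sum.swap, simp)
qed

lemma prob_append:
  assumes "a \<noteq> []"
  shows "prob {\<omega>. map \<omega> [0..<k] \<in> B \<and> map \<omega> [k..<k + length a] = a}
    = (\<Sum>l | length l = k \<and> l \<in> B. word_prob m P (l @ a))"
proof -
  have split: "map \<omega> [0..<k + length a] = map \<omega> [0..<k] @ map \<omega> [k..<k + length a]" for \<omega> :: "nat \<Rightarrow> 'a"
    by (metis le_add1 le_add2 le_add_same_cancel2 map_append upt_add_eq_append)
  define B' where "B' = (\<lambda>l. l @ a) ` {l. length l = k \<and> l \<in> B}"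
  have "{\<omega>. map \<omega> [0..<k] \<in> B \<and> map \<omega> [k..<k + length a] = a} = {\<omega>. map \<omega> [0..<k + length a] \<in> B'}"
    unfolding split B'_def by (auto simp: image_iff append_eq_append_conv)
  also have "prob \<dots> = (\<Sum>l | length l = k + length a \<and> l \<in> B'. word_prob m P l)"
    using assms by (intro prob_words) auto
  also have "{l. length l = k + length a \<and> l \<in> B'} = B'" by (auto simp: B'_def)
  also have "(\<Sum>l\<in>B'. word_prob m P l) = (\<Sum>l | length l = k \<and> l \<in> B. word_prob m P (l @ a))"
    unfolding B'_def by (subst sum.reindex) (auto simp: inj_on_def)
  finally show ?thesis .
qed

lemma prob_word:
  assumes "a \<noteq> []"
  shows "prob {\<omega>. map \<omega> [k..<k + length a] = a} = word_prob m P a"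
proof -
  have "prob {\<omega>. map \<omega> [k..<k + length a] = a} = (\<Sum>l | length l = k. word_prob m P (l @ a))"
    using prob_append[OF assms, of k UNIV] by simp
  also have "\<dots> = (\<Sum>l | length l = k. word_prob m P (l @ [hd a])) * word_weight P a"
    unfolding sum_distrib_right by (intro sum.cong refl word_prob_append assms)
  finally show ?thesis by (simp only: sum_word_prob_snoc) (simp add: word_prob_def)
qed

section \<open>Hitting times of a fixed word\<close>

lemma word_prob_le_1: "a \<noteq> [] \<Longrightarrow> word_prob m P a \<le> 1"
  using prob_word[of a 0] prob_le_1 by metis

lemma prob_hit: "a \<noteq> [] \<Longrightarrow> prob {\<omega>. hit a k \<omega>} = word_prob m P a"
  using prob_word[of a "Suc k"] by (simp add: hit_def)

lemma hit_measurable [measurable]: "Measurable.pred D (hit a k)"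
  unfolding hit_def by measurable

text \<open>Looking only at disjoint blocks, each block matches \<open>a\<close> with conditional probability at
  least \<open>\<kappa> P(a)\<close> whatever happened before.\<close>

lemma prob_no_hit_blocks:
  assumes a: "a \<noteq> []" and \<kappa>: "0 \<le> \<kappa>" "\<And>x y. \<kappa> * m y \<le> P x y"
  shows "prob {\<omega>. \<forall>i\<in>{1..j}. \<not> hit a (i * length a) \<omega>} \<le> (1 - \<kappa> * word_prob m P a) ^ j"
proof -
  let ?n = "length a" and ?\<rho> = "\<kappa> * word_prob m P a"
  define N where "N j = {\<omega>. \<forall>i\<in>{1..j}. \<not> hit a (i * ?n) \<omega>}" for j
  have sets_N: "N j \<in> events" for j
  proof -
    have "N j = {\<omega>\<in>space D. \<forall>i\<in>{1..j}. \<not> hit a (i * ?n) \<omega>}" by (auto simp: N_def space_D)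
    also have "\<dots> \<in> events" by measurable
    finally show ?thesis .
  qed
  have \<rho>_le: "?\<rho> \<le> 1"
  proof -
    have "\<kappa> = (\<Sum>y\<in>UNIV. \<kappa> * m y)" by (simp add: sum_distrib_left[symmetric] m_sum)
    also have "\<dots> \<le> (\<Sum>y\<in>UNIV. P undefined y)" by (intro sum_mono \<kappa>)
    finally have "\<kappa> \<le> 1" by (simp add: P_sum)
    then show ?thesis using word_prob_le_1[OF a] word_prob_pos[of a] \<kappa>(1)
      by (simp add: mult_le_one less_imp_le)
  qed
  have step: "prob (N (Suc j)) \<le> prob (N j) * (1 - ?\<rho>)" for j
  proof -
    \<comment> \<open>The prefix with indices 0 to (j + 1) n contains the blocks 1 to j entirely,
      and block j + 1 starts at the next index \<open>?k\<close>.\<close>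
    let ?k = "Suc (Suc j * ?n)"
    define B where "B = {l :: 'a list. \<forall>i\<in>{1..j}. take ?n (drop (Suc (i * ?n)) l) \<noteq> a}"
    have hit_B: "hit a (i * ?n) \<omega> \<longleftrightarrow> take ?n (drop (Suc (i * ?n)) (map \<omega> [0..<?k])) = a"
      if "i \<in> {1..j}" for i \<omega>
    proof -
      have "i * ?n + ?n \<le> Suc j * ?n"
        using mult_le_mono1[of "Suc i" "Suc j" ?n] that by simp
      then show ?thesis
        by (simp add: hit_def drop_map take_map take_upt del: upt_Suc mult_Suc)
    qed
    have N_B: "N j = {\<omega>. map \<omega> [0..<?k] \<in> B}"
      unfolding N_def B_def using hit_B by auto
    define A where "A = {\<omega>. map \<omega> [0..<?k] \<in> B \<and> map \<omega> [?k..<?k + ?n] = a}"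
    have "?\<rho> * prob (N j) = (\<Sum>l | length l = ?k \<and> l \<in> B. ?\<rho> * word_prob m P l)"
      unfolding N_B by (subst prob_words) (auto simp: sum_distrib_left)
    also have "\<dots> \<le> (\<Sum>l | length l = ?k \<and> l \<in> B. word_prob m P (l @ a))"
    proof (rule sum_mono)
      fix l :: "'a list" assume "l \<in> {l. length l = ?k \<and> l \<in> B}"
      then have l: "l \<noteq> []" by auto
      have "?\<rho> * word_prob m P l = (\<kappa> * m (hd a)) * (word_prob m P l * word_weight P a)"
        by (simp add: word_prob_def)
      also have "\<dots> \<le> P (last l) (hd a) * (word_prob m P l * word_weight P a)"
        using word_prob_pos[of l] word_weight_pos[of P a, OF P_pos]
        by (intro mult_right_mono \<kappa>) auto
      also have "\<dots> = word_prob m P (l @ a)"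
        using l a by (simp add: word_prob_def word_weight_append)
      finally show "?\<rho> * word_prob m P l \<le> word_prob m P (l @ a)" .
    qed
    also have "\<dots> = prob A" unfolding A_def by (subst prob_append[OF a]) auto
    finally have A: "?\<rho> * prob (N j) \<le> prob A" .
    have "A = N j \<inter> {\<omega>. hit a (Suc j * ?n) \<omega>}"
      unfolding N_B A_def hit_def by (auto simp del: upt_Suc)
    then have A_eq: "A = N j - N (Suc j)"
      by (auto simp: N_def atLeastAtMostSuc_conv)
    have sub: "N (Suc j) \<subseteq> N j" by (auto simp: N_def)
    have "prob A = prob (N j) - prob (N (Suc j))"
      unfolding A_eq by (rule finite_measure_Diff[OF sets_N sets_N sub])
    then show ?thesis using A by (simp add: algebra_simps)
  qed
  have "prob (N j) \<le> (1 - ?\<rho>) ^ j"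
  proof (induction j)
    case (Suc j)
    have "prob (N (Suc j)) \<le> prob (N j) * (1 - ?\<rho>)" by (rule step)
    also have "\<dots> \<le> (1 - ?\<rho>) ^ j * (1 - ?\<rho>)" using Suc \<rho>_le by (intro mult_right_mono) auto
    finally show ?case by (simp add: mult.commute)
  qed simp
  then show ?thesis by (simp add: N_def)
qed

lemma hitting_time_measurable [measurable]: "hitting_time a \<in> borel_measurable D"
proof -
  have "hitting_time a = (\<lambda>y. INF k. if 1 \<le> k \<and> hit a k y then of_nat k else \<infinity>)"
  proof
    fix y
    show "hitting_time a y = (INF k. if 1 \<le> k \<and> hit a k y then of_nat k else \<infinity>)"
      unfolding hitting_time_def
    proof (rule antisym)
      show "(INF k\<in>{k. 1 \<le> k \<and> hit a k y}. of_nat k) \<le> (INF k. if 1 \<le> k \<and> hit a k y then of_nat k else (\<infinity>::ennreal))"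
        by (rule INF_greatest) (auto intro: INF_lower)
      show "(INF k. if 1 \<le> k \<and> hit a k y then of_nat k else (\<infinity>::ennreal)) \<le> (INF k\<in>{k. 1 \<le> k \<and> hit a k y}. of_nat k)"
      proof (rule INF_greatest)
        fix k assume "k \<in> {k. 1 \<le> k \<and> hit a k y}"
        then show "(INF k. if 1 \<le> k \<and> hit a k y then of_nat k else (\<infinity>::ennreal)) \<le> of_nat k"
          by (intro INF_lower2[of k]) auto
      qed
    qed
  qed
  then show ?thesis by (simp only:) measurable
qed

lemma hitting_time_tail:
  assumes a: "a \<noteq> []" and \<kappa>: "0 \<le> \<kappa>" "\<And>x y. \<kappa> * m y \<le> P x y"
  shows "prob {\<omega>. of_nat (j * length a) < hitting_time a \<omega>} \<le> (1 - \<kappa> * word_prob m P a) ^ j"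
proof -
  have "{\<omega>\<in>space D. of_nat (j * length a) < hitting_time a \<omega>} \<subseteq> {\<omega>\<in>space D. \<forall>i\<in>{1..j}. \<not> hit a (i * length a) \<omega>}"
  proof (intro subsetI CollectI conjI ballI notI)
    fix \<omega> i assume \<omega>: "\<omega> \<in> {\<omega>\<in>space D. of_nat (j * length a) < hitting_time a \<omega>}"
      and i: "i \<in> {1..j}" "hit a (i * length a) \<omega>"
    have "1 \<le> i * length a" using i a by (simp add: Suc_le_eq)
    then have "hitting_time a \<omega> \<le> of_nat (i * length a)"
      unfolding hitting_time_def using i by (intro INF_lower) auto
    also have "\<dots> \<le> of_nat (j * length a)" using i by (intro of_nat_mono mult_le_mono1) auto
    finally show False using \<omega> by auto
  qed (auto simp: space_D)
  then have "prob {\<omega>\<in>space D. of_nat (j * length a) < hitting_time a \<omega>}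
      \<le> prob {\<omega>\<in>space D. \<forall>i\<in>{1..j}. \<not> hit a (i * length a) \<omega>}"
    by (intro finite_measure_mono) measurable
  then show ?thesis using prob_no_hit_blocks[OF a \<kappa>, of j] by (simp add: space_D)
qed

lemma hitting_time_early:
  assumes a: "a \<noteq> []"
  shows "prob {\<omega>. hitting_time a \<omega> \<le> of_nat k} \<le> real k * word_prob m P a"
proof -
  have "{\<omega>. hitting_time a \<omega> \<le> of_nat k} \<subseteq> (\<Union>i\<in>{1..k}. {\<omega>\<in>space D. hit a i \<omega>})"
  proof
    fix \<omega> assume "\<omega> \<in> {\<omega>. hitting_time a \<omega> \<le> of_nat k}"
    then have le: "hitting_time a \<omega> \<le> of_nat k" by simp
    show "\<omega> \<in> (\<Union>i\<in>{1..k}. {\<omega>\<in>space D. hit a i \<omega>})"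
    proof (cases rule: hitting_time_cases[of a \<omega>])
      case 1
      then show ?thesis using le by (simp add: top_unique)
    next
      case (2 i)
      then show ?thesis using le by (auto simp: space_D)
    qed
  qed
  then have "prob {\<omega>. hitting_time a \<omega> \<le> of_nat k} \<le> prob (\<Union>i\<in>{1..k}. {\<omega>\<in>space D. hit a i \<omega>})"
    by (intro finite_measure_mono) auto
  also have "\<dots> \<le> (\<Sum>i\<in>{1..k}. prob {\<omega>\<in>space D. hit a i \<omega>})"
    by (intro finite_measure_subadditive_finite) auto
  also have "\<dots> = real k * word_prob m P a" using prob_hit[OF a] by (simp add: space_D)
  finally show ?thesis .
qed

lemma hitting_time_finite:
  assumes a: "a \<noteq> []"
  shows "AE \<omega> in D. hitting_time a \<omega> \<noteq> \<infinity>"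
proof -
  obtain p where p: "0 < p" "\<And>x y. p \<le> P x y" using finite_pos_bounds2[of P] P_pos by blast
  have m1: "m y \<le> 1" for y
    using member_le_sum[of y UNIV m] m_pos m_sum by (auto simp: less_imp_le)
  have \<kappa>: "p * m y \<le> P x y" for x y
    using p m1[of y] m_pos[of y] by (meson less_imp_le mult_left_le order_trans)
  let ?\<rho> = "p * word_prob m P a"
  have \<rho>: "0 < ?\<rho>" using p word_prob_pos[of a] by simp
  have "prob {\<omega>\<in>space D. hitting_time a \<omega> = \<infinity>} \<le> (1 - ?\<rho>) ^ j" for j
  proof -
    have "prob {\<omega>\<in>space D. hitting_time a \<omega> = \<infinity>} \<le> prob {\<omega>\<in>space D. of_nat (j * length a) < hitting_time a \<omega>}"
      by (intro finite_measure_mono) (auto simp: less_top[symmetric] simp del: of_nat_mult)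
    then show ?thesis using hitting_time_tail[OF a _ \<kappa>, of j] p by (simp add: space_D)
  qed
  moreover have "(\<lambda>j. (1 - ?\<rho>) ^ j) \<longlonglongrightarrow> 0"
  proof (rule LIMSEQ_power_zero)
    have "p \<le> 1" using p P_sum member_le_sum[of undefined UNIV "P undefined"] P_pos
      by (metis UNIV_I finite less_imp_le order_trans)
    then have "?\<rho> \<le> 1" using word_prob_le_1[OF a] word_prob_pos[of a] p by (simp add: mult_le_one less_imp_le)
    then show "norm (1 - ?\<rho>) < 1" using \<rho> by simp
  qed
  ultimately have "prob {\<omega>\<in>space D. hitting_time a \<omega> = \<infinity>} \<le> 0"
    by (intro LIMSEQ_le_const) auto
  then have "prob {\<omega>\<in>space D. hitting_time a \<omega> = \<infinity>} = 0" using measure_nonneg antisym by blast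
  then have "emeasure D {\<omega>\<in>space D. hitting_time a \<omega> = \<infinity>} = 0" by (simp add: emeasure_eq_measure)
  then show ?thesis by (subst AE_iff_measurable[OF _ refl]) auto
qed

end

subsection \<open>Moments of hitting times\<close>

lemma powr_ennreal_of_nat:
  assumes "1 \<le> k"
  shows "powr_ennreal (of_nat k) q = ennreal (real k powr q)"
  using assms by (simp add: powr_ennreal_def ennreal_of_nat_eq_real_of_nat)

lemma powr_ennreal_measurable [measurable]: "(\<lambda>r. powr_ennreal r q) \<in> borel_measurable borel"
  unfolding powr_ennreal_def by measurable

lemma summable_powr_exp: "summable (\<lambda>i. real (Suc i) powr q * exp (- real i))"
proof (rule summable_comparison_test_bigo)
  show "summable (\<lambda>i. norm (exp (- 1 / 2) ^ i :: real))" by simp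
  show "(\<lambda>i. real (Suc i) powr q * exp (- real i)) \<in> O(\<lambda>i. exp (- 1 / 2) ^ i)"
    unfolding exp_of_nat_mult[symmetric] by real_asymp
qed

context stationary_chain
begin

text \<open>Doeblin's minorisation: whatever the current letter, the next one has at least \<kappa>
  times its stationary probability.\<close>

lemma kappa_exists:
  obtains \<kappa> where "0 < \<kappa>" "\<kappa> \<le> 1" "\<And>x y. \<kappa> * m y \<le> P x y"
proof -
  obtain p where p: "0 < p" "\<And>x y. p \<le> P x y" using finite_pos_bounds2[of P] P_pos by blast
  have m1: "m y \<le> 1" for y
    using member_le_sum[of y UNIV m] m_pos m_sum by (auto simp: less_imp_le)
  have "p * m y \<le> P x y" for x y
    using p m1[of y] m_pos[of y] by (meson less_imp_le mult_left_le order_trans)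
  moreover have "p \<le> 1"
    using p P_sum member_le_sum[of undefined UNIV "P undefined"] P_pos
    by (metis UNIV_I finite less_imp_le order_trans)
  ultimately show ?thesis using that p by blast
qed

text \<open>Word probabilities decay at most exponentially in the length. This makes the logarithm
  of 1 / \<pi>, which arises from a harmonic sum in \<open>moment_upper_neg\<close>, a factor linear
  in the length.\<close>

lemma word_prob_ge:
  obtains L where "0 \<le> L" "\<And>a. a \<noteq> [] \<Longrightarrow> - ln (word_prob m P a) \<le> L * real (length a)"
proof -
  obtain p where p: "0 < p" "\<And>x y. p \<le> P x y" using finite_pos_bounds2[of P] P_pos by blast
  obtain p' where p': "0 < p'" "\<And>x. p' \<le> m x" using finite_pos_bounds[of m] m_pos by blast
  define b where "b = min 1 (min p p')"
  have b: "0 < b" "b \<le> 1" "\<And>x y. b \<le> P x y" "\<And>x. b \<le> m x"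
    using p p' by (auto simp: b_def min_le_iff_disj)
  have ww: "b ^ length l \<le> word_weight P (x # l)" for x l
  proof (induction l arbitrary: x)
    case (Cons y l)
    then show ?case using b P_pos[of x y] by (simp add: mult_mono less_imp_le)
  qed simp
  show ?thesis
  proof (rule that[of "- ln b"])
    show "0 \<le> - ln b" using b by simp
    fix a :: "'a list" assume "a \<noteq> []"
    then obtain x l where a: "a = x # l" by (cases a) auto
    have "b ^ length a \<le> word_prob m P a"
      unfolding a word_prob_def using b ww[of l x] m_pos[of x] by (simp add: mult_mono less_imp_le)
    then have "ln (b ^ length a) \<le> ln (word_prob m P a)"
      using b word_prob_pos[of a] by (subst ln_le_cancel_iff) auto
    then show "- ln (word_prob m P a) \<le> - ln b * real (length a)"
      using b by (simp add: ln_realpow mult.commute)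
  qed
qed

lemma hitting_time_AE:
  assumes "a \<noteq> []"
  shows "AE y in D. \<exists>k\<ge>1. hitting_time a y = of_nat k \<and> hit a k y"
  using hitting_time_finite[OF assms]
proof eventually_elim
  case (elim y)
  then show ?case by (cases rule: hitting_time_cases[of a y]) auto
qed

text \<open>T is the natural time scale. About 1 / \<rho> disjoint blocks, each successful with
  conditional probability at least \<rho>, all fail with probability at most 1 / e, and i such
  groups with probability at most the i-th power.\<close>

lemma hitting_time_scale:
  assumes a: "a \<noteq> []" and \<kappa>: "0 < \<kappa>" "\<kappa> \<le> 1" "\<And>x y. \<kappa> * m y \<le> P x y"
  obtains T :: nat where "1 \<le> T" "real T \<le> 2 * real (length a) / (\<kappa> * word_prob m P a)"
    "\<And>i. prob {y. of_nat (i * T) < hitting_time a y} \<le> exp (- real i)"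
proof -
  define \<rho> where "\<rho> = \<kappa> * word_prob m P a"
  have \<rho>: "0 < \<rho>" "\<rho> \<le> 1"
    using \<kappa> word_prob_pos[of a] word_prob_le_1[OF a] by (auto simp: \<rho>_def mult_le_one)
  define K where "K = nat \<lceil>1 / \<rho>\<rceil>"
  have K1: "1 / \<rho> \<le> real K" unfolding K_def by linarith
  have "1 \<le> 1 / \<rho>" using \<rho> by simp
  then have K2: "real K \<le> 2 / \<rho>" "1 \<le> K" unfolding K_def by linarith+
  show ?thesis
  proof (rule that[of "K * length a"])
    show "1 \<le> K * length a" using K2 a by (simp add: Suc_le_eq)
    have "real (K * length a) \<le> 2 / \<rho> * real (length a)"
      using mult_right_mono[OF K2(1), of "real (length a)"] by simp
    then show "real (K * length a) \<le> 2 * real (length a) / (\<kappa> * word_prob m P a)"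
      by (simp add: \<rho>_def)
    fix i
    have "prob {y. of_nat (i * (K * length a)) < hitting_time a y} \<le> (1 - \<rho>) ^ (i * K)"
      using hitting_time_tail[OF a _ \<kappa>(3), of "i * K"] \<kappa>(1) by (simp add: \<rho>_def mult.assoc)
    also have "\<dots> \<le> exp (- \<rho>) ^ (i * K)"
      using \<rho> exp_ge_add_one_self[of "- \<rho>"] by (intro power_mono) auto
    also have "\<dots> = exp (- (real i * (real K * \<rho>)))"
      by (simp add: exp_of_nat_mult[symmetric] mult_ac)
    also have "\<dots> \<le> exp (- real i)"
      using K1 \<rho> mult_left_mono[of 1 "real K * \<rho>" "real i"] by (simp add: field_simps)
    finally show "prob {y. of_nat (i * (K * length a)) < hitting_time a y} \<le> exp (- real i)" .
  qed
qed

text \<open>Cut time into windows of length T. In window i the q-th power is at most that of (i + 1)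
  T and the probability at most exp (- i); the series converges and leaves a multiple of T to the
  power q.\<close>

lemma moment_upper_nonneg:
  assumes q: "0 \<le> q"
  obtains C where "1 \<le> C" "\<And>a. a \<noteq> [] \<Longrightarrow> (\<integral>\<^sup>+ y. powr_ennreal (hitting_time a y) q \<partial>D)
    \<le> ennreal (C * real (length a) powr q * word_prob m P a powr (- q))"
proof -
  obtain \<kappa> where \<kappa>: "0 < \<kappa>" "\<kappa> \<le> 1" "\<And>x y. \<kappa> * m y \<le> P x y" using kappa_exists by blast
  define S where "S = (\<Sum>i. real (Suc i) powr q * exp (- real i))"
  define C where "C = max 1 ((2 / \<kappa>) powr q * S)"
  have S0: "0 \<le> S" unfolding S_def by (intro suminf_nonneg summable_powr_exp) auto
  have "(\<integral>\<^sup>+ y. powr_ennreal (hitting_time a y) q \<partial>D)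
    \<le> ennreal (C * real (length a) powr q * word_prob m P a powr (- q))" if a: "a \<noteq> []" for a
  proof -
    let ?W = "hitting_time a"
    obtain T where T: "1 \<le> T" "real T \<le> 2 * real (length a) / (\<kappa> * word_prob m P a)"
      "\<And>i. prob {y. of_nat (i * T) < ?W y} \<le> exp (- real i)"
      using hitting_time_scale[OF a \<kappa>] by blast
    define F where "F i y = ennreal (real (Suc i * T) powr q) * indicator {y\<in>space D. of_nat (i * T) < ?W y} y" for i y
    have "(\<integral>\<^sup>+ y. powr_ennreal (?W y) q \<partial>D) \<le> (\<integral>\<^sup>+ y. (\<Sum>i. F i y) \<partial>D)"
    proof (rule nn_integral_mono_AE)
      show "AE y in D. powr_ennreal (?W y) q \<le> (\<Sum>i. F i y)"
        using hitting_time_AE[OF a]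
      proof eventually_elim
        case (elim y)
        then obtain k where k: "1 \<le> k" "?W y = of_nat k" by blast
        \<comment> \<open>The shift by 1 places k in the half-open window from i T, excluded, to (i
          + 1) T, included, as the strict tail event requires.\<close>
        define i where "i = (k - 1) div T"
        have iT: "i * T < k" "k \<le> Suc i * T"
        proof -
          have "i * T \<le> k - 1" unfolding i_def by (rule div_times_less_eq_dividend)
          then show "i * T < k" using k by simp
          have "k - 1 < Suc i * T" unfolding i_def using T(1) by (intro div_less_iff_less_mult[THEN iffD1]) auto
          then show "k \<le> Suc i * T" by simp
        qed
        have "real k \<le> real (Suc i * T)" using iT(2) of_nat_mono by blast
        then have "powr_ennreal (?W y) q \<le> ennreal (real (Suc i * T) powr q)"
          unfolding k(2) powr_ennreal_of_nat[OF k(1)] using q by (intro ennreal_leI powr_mono2) auto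
        also have "\<dots> = F i y"
          using iT(1) k(2) by (simp add: F_def space_D del: of_nat_mult)
        also have "\<dots> \<le> (\<Sum>i. F i y)"
          using sum_le_suminf[of "\<lambda>i. F i y" "{i}"] by simp
        finally show ?case .
      qed
    qed
    also have "\<dots> = (\<Sum>i. \<integral>\<^sup>+ y. F i y \<partial>D)"
      unfolding F_def by (intro nn_integral_suminf) measurable
    also have "\<dots> \<le> (\<Sum>i. ennreal (real T powr q * (real (Suc i) powr q * exp (- real i))))"
    proof (intro suminf_le summableI)
      fix i
      have "(\<integral>\<^sup>+ y. F i y \<partial>D) = ennreal (real (Suc i * T) powr q) * emeasure D {y\<in>space D. of_nat (i * T) < ?W y}"
        unfolding F_def by (intro nn_integral_cmult_indicator) measurable
      also have "\<dots> \<le> ennreal (real (Suc i * T) powr q) * ennreal (exp (- real i))"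
        using T(3)[of i] by (intro mult_left_mono) (auto simp: emeasure_eq_measure space_D intro!: ennreal_leI)
      also have "\<dots> = ennreal (real T powr q * (real (Suc i) powr q * exp (- real i)))"
      proof -
        have "real (Suc i * T) powr q = real (Suc i) powr q * real T powr q"
          unfolding of_nat_mult by (simp add: powr_mult del: of_nat_Suc)
        then show ?thesis by (subst ennreal_mult[symmetric]) (auto simp: mult_ac)
      qed
      finally show "(\<integral>\<^sup>+ y. F i y \<partial>D) \<le> ennreal (real T powr q * (real (Suc i) powr q * exp (- real i)))" .
    qed
    also have "\<dots> = ennreal (real T powr q * S)"
    proof -
      have "(\<Sum>i. ennreal (real T powr q * (real (Suc i) powr q * exp (- real i))))
          = ennreal (\<Sum>i. real T powr q * (real (Suc i) powr q * exp (- real i)))"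
        by (rule suminf_ennreal2[OF _ summable_mult[OF summable_powr_exp]]) simp
      also have "\<dots> = ennreal (real T powr q * S)"
        unfolding S_def by (subst suminf_mult[OF summable_powr_exp]) (rule refl)
      finally show ?thesis .
    qed
    also have "\<dots> \<le> ennreal (C * real (length a) powr q * word_prob m P a powr (- q))"
    proof (rule ennreal_leI)
      have \<pi>: "0 < word_prob m P a" by (rule word_prob_pos)
      have "real T powr q * S \<le> (2 * real (length a) / (\<kappa> * word_prob m P a)) powr q * S"
        using T q S0 by (intro mult_right_mono powr_mono2) auto
      also have "2 * real (length a) / (\<kappa> * word_prob m P a) = (2 / \<kappa>) * real (length a) / word_prob m P a" by simp
      also have "\<dots> powr q = (2 / \<kappa>) powr q * real (length a) powr q * word_prob m P a powr (- q)"
        using \<kappa> \<pi> by (simp add: powr_mult powr_divide powr_minus_divide)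
      also have "\<dots> * S = ((2 / \<kappa>) powr q * S) * real (length a) powr q * word_prob m P a powr (- q)" by simp
      also have "\<dots> \<le> C * real (length a) powr q * word_prob m P a powr (- q)"
        by (intro mult_right_mono) (auto simp: C_def)
      finally show "real T powr q * S \<le> C * real (length a) powr q * word_prob m P a powr (- q)" .
    qed
    finally show ?thesis .
  qed
  then show ?thesis using that[of C] by (simp add: C_def)
qed

text \<open>By the union bound the word occurs by time 1 / (2 \<pi>) with probability at most 1 / 2.
  On the remaining half the time is at least 1 / (2 \<pi>).\<close>

lemma moment_lower_nonneg:
  assumes q: "0 \<le> q" and a: "a \<noteq> []"
  shows "ennreal (1 / 2 * (1 / 2) powr q * word_prob m P a powr (- q))
    \<le> (\<integral>\<^sup>+ y. powr_ennreal (hitting_time a y) q \<partial>D)"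
proof -
  let ?W = "hitting_time a" and ?\<pi> = "word_prob m P a"
  have \<pi>: "0 < ?\<pi>" by (rule word_prob_pos)
  define k where "k = nat \<lfloor>1 / (2 * ?\<pi>)\<rfloor>"
  have "0 \<le> 1 / (2 * ?\<pi>)" using \<pi> by simp
  then have k: "real k \<le> 1 / (2 * ?\<pi>)" "1 / (2 * ?\<pi>) \<le> real (Suc k)" unfolding k_def by linarith+
  have "real k * ?\<pi> \<le> 1 / (2 * ?\<pi>) * ?\<pi>" using k \<pi> by (intro mult_right_mono) auto
  also have "\<dots> = 1 / 2" using \<pi> by simp
  finally have "prob {y\<in>space D. ?W y \<le> of_nat k} \<le> 1 / 2"
    using hitting_time_early[OF a, of k] by (simp add: space_D)
  moreover have "prob (space D - {y\<in>space D. ?W y \<le> of_nat k}) = 1 - prob {y\<in>space D. ?W y \<le> of_nat k}"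
    by (rule prob_compl) measurable
  ultimately have half: "1 / 2 \<le> prob (space D - {y\<in>space D. ?W y \<le> of_nat k})" by simp
  let ?A = "space D - {y\<in>space D. ?W y \<le> of_nat k}"
  have "ennreal (1 / 2 * (1 / 2) powr q * ?\<pi> powr (- q)) = ennreal ((1 / (2 * ?\<pi>)) powr q) * ennreal (1 / 2)"
  proof -
    have "(1 / (2 * ?\<pi>)) powr q = (1 / 2) powr q * ?\<pi> powr (- q)"
      using \<pi> by (simp add: powr_divide powr_mult powr_minus_divide)
    then show ?thesis by (subst ennreal_mult[symmetric]) (auto simp: mult_ac)
  qed
  also have "\<dots> \<le> ennreal ((1 / (2 * ?\<pi>)) powr q) * emeasure D ?A"
    unfolding emeasure_eq_measure using half by (intro mult_left_mono ennreal_leI) auto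
  also have "\<dots> = (\<integral>\<^sup>+ y. ennreal ((1 / (2 * ?\<pi>)) powr q) * indicator ?A y \<partial>D)"
    by (rule nn_integral_cmult_indicator[symmetric]) measurable
  also have "\<dots> \<le> (\<integral>\<^sup>+ y. powr_ennreal (?W y) q \<partial>D)"
  proof (rule nn_integral_mono_AE)
    show "AE y in D. ennreal ((1 / (2 * ?\<pi>)) powr q) * indicator ?A y \<le> powr_ennreal (?W y) q"
      using hitting_time_AE[OF a]
    proof eventually_elim
      case (elim y)
      then obtain j where j: "1 \<le> j" "?W y = of_nat j" by blast
      have "(1 / (2 * ?\<pi>)) powr q \<le> real j powr q" if "k < j"
        using k(2) that q \<pi> by (intro powr_mono2) auto
      then show ?case
        unfolding j(2) powr_ennreal_of_nat[OF j(1)]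
        by (auto simp: indicator_def space_D j(2) intro!: ennreal_leI)
    qed
  qed
  finally show ?thesis .
qed

text \<open>The probability of exceeding T is at most 1 / e, hence at most 1 / 2, so half of the
  mass has a time of at most T and contributes a negative power of T.\<close>

lemma moment_lower_neg:
  assumes r: "0 \<le> r" and a: "a \<noteq> []" and \<kappa>: "0 < \<kappa>" "\<kappa> \<le> 1" "\<And>x y. \<kappa> * m y \<le> P x y"
  shows "ennreal (1 / 2 * (\<kappa> / (2 * real (length a))) powr r * word_prob m P a powr r)
    \<le> (\<integral>\<^sup>+ y. powr_ennreal (hitting_time a y) (- r) \<partial>D)"
proof -
  let ?W = "hitting_time a" and ?\<pi> = "word_prob m P a"
  have \<pi>: "0 < ?\<pi>" by (rule word_prob_pos)
  obtain T where T: "1 \<le> T" "real T \<le> 2 * real (length a) / (\<kappa> * ?\<pi>)"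
    "\<And>i. prob {y. of_nat (i * T) < ?W y} \<le> exp (- real i)"
    using hitting_time_scale[OF a \<kappa>] by blast
  have "exp (- 1) \<le> (1 / 2 :: real)"
    using exp_ge_add_one_self[of 1] by (simp add: exp_minus field_simps)
  then have "prob {y\<in>space D. of_nat T < ?W y} \<le> 1 / 2" using T(3)[of 1] by (simp add: space_D)
  moreover have "prob (space D - {y\<in>space D. of_nat T < ?W y}) = 1 - prob {y\<in>space D. of_nat T < ?W y}"
    by (rule prob_compl) measurable
  ultimately have half: "1 / 2 \<le> prob (space D - {y\<in>space D. of_nat T < ?W y})" by simp
  let ?A = "space D - {y\<in>space D. of_nat T < ?W y}"
  have "1 / 2 * (\<kappa> / (2 * real (length a))) powr r * ?\<pi> powr r = 1 / 2 * ((\<kappa> * ?\<pi> / (2 * real (length a))) powr r)"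
    using \<kappa> \<pi> by (simp add: powr_mult powr_divide)
  also have "\<dots> \<le> 1 / 2 * ((1 / real T) powr r)"
    using T a r \<kappa> \<pi> by (intro mult_left_mono powr_mono2) (auto simp: field_simps)
  finally have "ennreal (1 / 2 * (\<kappa> / (2 * real (length a))) powr r * ?\<pi> powr r)
      \<le> ennreal (real T powr (- r)) * ennreal (1 / 2)"
    using T(1) by (subst ennreal_mult[symmetric]) (auto simp: powr_minus_divide powr_divide)
  also have "\<dots> \<le> ennreal (real T powr (- r)) * emeasure D ?A"
    unfolding emeasure_eq_measure using half by (intro mult_left_mono ennreal_leI) auto
  also have "\<dots> = (\<integral>\<^sup>+ y. ennreal (real T powr (- r)) * indicator ?A y \<partial>D)"
    by (rule nn_integral_cmult_indicator[symmetric]) measurable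
  also have "\<dots> \<le> (\<integral>\<^sup>+ y. powr_ennreal (?W y) (- r) \<partial>D)"
  proof (rule nn_integral_mono_AE)
    show "AE y in D. ennreal (real T powr (- r)) * indicator ?A y \<le> powr_ennreal (?W y) (- r)"
      using hitting_time_AE[OF a]
    proof eventually_elim
      case (elim y)
      then obtain j where j: "1 \<le> j" "?W y = of_nat j" by blast
      have "real T powr (- r) \<le> real j powr (- r)" if "j \<le> T"
        using that j r by (intro powr_mono2') auto
      then show ?case
        unfolding j(2) powr_ennreal_of_nat[OF j(1)]
        by (auto simp: indicator_def space_D j(2) intro!: ennreal_leI)
    qed
  qed
  finally show ?thesis .
qed

text \<open>A hit at time 1 contributes 1 to a moment of any order. For exponents below -1 this is
  the dominant event.\<close>

lemma moment_ge_word_prob: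
  assumes a: "a \<noteq> []"
  shows "ennreal (word_prob m P a) \<le> (\<integral>\<^sup>+ y. powr_ennreal (hitting_time a y) q \<partial>D)"
proof -
  let ?A = "{y\<in>space D. hit a 1 y}"
  have "ennreal (word_prob m P a) = emeasure D ?A"
    using prob_hit[OF a, of 1] by (simp add: emeasure_eq_measure space_D)
  also have "\<dots> = (\<integral>\<^sup>+ y. indicator ?A y \<partial>D)" by simp
  also have "\<dots> \<le> (\<integral>\<^sup>+ y. powr_ennreal (hitting_time a y) q \<partial>D)"
  proof (rule nn_integral_mono)
    fix y
    have "hitting_time a y = 1" if "hit a 1 y"
    proof (rule antisym[OF _ hitting_time_ge_1])
      have "hitting_time a y \<le> of_nat 1" unfolding hitting_time_def using that by (intro INF_lower) auto
      then show "hitting_time a y \<le> 1" by simp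
    qed
    then show "indicator ?A y \<le> powr_ennreal (hitting_time a y) q"
      using powr_ennreal_of_nat[of 1 q] by (auto simp: indicator_def)
  qed
  finally show ?thesis .
qed

text \<open>Factor out the largest power and compare with the harmonic sum. The logarithm is the
  price of the critical case r = 1; carrying it for every r keeps a single formula.\<close>

lemma sum_powr_le:
  assumes r: "0 \<le> r" and K: "1 \<le> K"
  shows "(\<Sum>k=1..K. real k powr (- r)) \<le> real K powr (1 - min r 1) * (1 + ln (real K))"
proof -
  let ?\<theta> = "min r 1"
  have "(\<Sum>k=1..K. real k powr (- r)) \<le> (\<Sum>k=1..K. real K powr (1 - ?\<theta>) * inverse (real k))"
  proof (rule sum_mono)
    fix k assume k: "k \<in> {1..K}"
    then have k1: "1 \<le> real k" by auto
    have "real k powr (- r) \<le> real k powr (1 - ?\<theta> + - 1)" using k1 by (intro powr_mono) auto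
    also have "\<dots> = real k powr (1 - ?\<theta>) * inverse (real k)"
      using k1 by (subst powr_add) (simp add: powr_minus)
    also have "\<dots> \<le> real K powr (1 - ?\<theta>) * inverse (real k)"
      using k k1 by (intro mult_right_mono powr_mono2) auto
    finally show "real k powr (- r) \<le> real K powr (1 - ?\<theta>) * inverse (real k)" .
  qed
  also have "\<dots> = real K powr (1 - ?\<theta>) * harm K"
    by (simp add: harm_def sum_distrib_left)
  \<comment> \<open>The difference of the harmonic number and the logarithm decreases from its value
    1 at K = 1.\<close>
  also have "\<dots> \<le> real K powr (1 - ?\<theta>) * (1 + ln (real K))"
    using euler_mascheroni_sequence_decreasing[of 1 K] K
    by (intro mult_left_mono) (auto simp: harm_expand)
  finally show ?thesis .
qed

text \<open>Up to K, about 1 / \<pi>, add the contributions of a hit at each k; later times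
  contribute at most K to the power -r. For r > 1 the first few k dominate the sum, which is why the
  exponent saturates at 1.\<close>

lemma moment_upper_neg:
  assumes r: "0 \<le> r"
  obtains C where "1 \<le> C" "\<And>a. a \<noteq> [] \<Longrightarrow> (\<integral>\<^sup>+ y. powr_ennreal (hitting_time a y) (- r) \<partial>D)
    \<le> ennreal (C * real (length a) * word_prob m P a powr (min r 1))"
proof -
  obtain L where L: "0 \<le> L" "\<And>a. a \<noteq> [] \<Longrightarrow> - ln (word_prob m P a) \<le> L * real (length a)"
    using word_prob_ge by blast
  define C where "C = 2 * (1 + ln 2 + L) + 1"
  have "(\<integral>\<^sup>+ y. powr_ennreal (hitting_time a y) (- r) \<partial>D)
    \<le> ennreal (C * real (length a) * word_prob m P a powr (min r 1))" if a: "a \<noteq> []" for a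
  proof -
    let ?W = "hitting_time a" and ?\<pi> = "word_prob m P a" and ?\<theta> = "min r 1"
    have \<pi>: "0 < ?\<pi>" "?\<pi> \<le> 1" by (rule word_prob_pos, rule word_prob_le_1[OF a])
    define K where "K = nat \<lceil>1 / ?\<pi>\<rceil>"
    have K1: "1 / ?\<pi> \<le> real K" unfolding K_def by linarith
    have "1 \<le> 1 / ?\<pi>" using \<pi> by simp
    then have K2: "real K \<le> 2 / ?\<pi>" "1 \<le> K" unfolding K_def by linarith+
    define F where "F k y = ennreal (real k powr (- r)) * indicator {y\<in>space D. hit a k y} y" for k y
    have F_meas: "F k \<in> borel_measurable D" for k unfolding F_def by measurable
    have "(\<integral>\<^sup>+ y. powr_ennreal (?W y) (- r) \<partial>D)
        \<le> (\<integral>\<^sup>+ y. (\<Sum>k=1..K. F k y) + ennreal (real K powr (- r)) \<partial>D)"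
    proof (rule nn_integral_mono_AE)
      show "AE y in D. powr_ennreal (?W y) (- r) \<le> (\<Sum>k=1..K. F k y) + ennreal (real K powr (- r))"
        using hitting_time_AE[OF a]
      proof eventually_elim
        case (elim y)
        then obtain j where j: "1 \<le> j" "?W y = of_nat j" "hit a j y" by blast
        show ?case
        proof (cases "j \<le> K")
          case True
          have "powr_ennreal (?W y) (- r) = F j y"
            unfolding j(2) powr_ennreal_of_nat[OF j(1)] using j(3) by (simp add: F_def space_D)
          also have "\<dots> \<le> (\<Sum>k=1..K. F k y)" using True j(1) by (intro member_le_sum) auto
          finally show ?thesis by (rule order_trans) simp
        next
          case False
          have "powr_ennreal (?W y) (- r) \<le> ennreal (real K powr (- r))"
            unfolding j(2) powr_ennreal_of_nat[OF j(1)]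
            using False K2(2) r by (intro ennreal_leI powr_mono2') auto
          then show ?thesis by (rule order_trans) simp
        qed
      qed
    qed
    also have "\<dots> = (\<integral>\<^sup>+ y. (\<Sum>k=1..K. F k y) \<partial>D) + ennreal (real K powr (- r))"
      by (subst nn_integral_add) (auto intro!: borel_measurable_sum F_meas simp: emeasure_space_1)
    also have "(\<integral>\<^sup>+ y. (\<Sum>k=1..K. F k y) \<partial>D) = (\<Sum>k=1..K. \<integral>\<^sup>+ y. F k y \<partial>D)"
      by (rule nn_integral_sum) (rule F_meas)
    also have "\<dots> = (\<Sum>k=1..K. ennreal (real k powr (- r) * ?\<pi>))"
    proof (rule sum.cong[OF refl])
      fix k
      have "(\<integral>\<^sup>+ y. F k y \<partial>D) = ennreal (real k powr (- r)) * emeasure D {y\<in>space D. hit a k y}"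
        unfolding F_def by (intro nn_integral_cmult_indicator) measurable
      also have "\<dots> = ennreal (real k powr (- r) * ?\<pi>)"
        using prob_hit[OF a, of k] \<pi> by (simp add: emeasure_eq_measure space_D ennreal_mult)
      finally show "(\<integral>\<^sup>+ y. F k y \<partial>D) = ennreal (real k powr (- r) * ?\<pi>)" .
    qed
    also have "\<dots> = ennreal ((\<Sum>k=1..K. real k powr (- r)) * ?\<pi>)"
      using \<pi> by (subst sum_ennreal) (auto simp: sum_distrib_right)
    also have "\<dots> + ennreal (real K powr (- r)) = ennreal ((\<Sum>k=1..K. real k powr (- r)) * ?\<pi> + real K powr (- r))"
      using \<pi> by (subst ennreal_plus) (auto intro!: mult_nonneg_nonneg sum_nonneg)
    also have "\<dots> \<le> ennreal (C * real (length a) * ?\<pi> powr ?\<theta>)"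
    proof (rule ennreal_leI)
      have n1: "1 \<le> real (length a)" using a by (cases a) auto
      have lnK: "1 + ln (real K) \<le> (1 + ln 2 + L) * real (length a)"
      proof -
        have "ln (real K) \<le> ln (2 / ?\<pi>)" using K2 \<pi> by (subst ln_le_cancel_iff) auto
        also have "\<dots> = ln 2 - ln ?\<pi>" using \<pi> by (simp add: ln_div)
        also have "\<dots> \<le> ln 2 + L * real (length a)" using L(2)[OF a] by simp
        finally have "1 + ln (real K) \<le> (1 + ln 2) * 1 + L * real (length a)" by simp
        also have "\<dots> \<le> (1 + ln 2) * real (length a) + L * real (length a)"
          using n1 by (intro add_right_mono mult_left_mono) auto
        finally show ?thesis by (simp add: algebra_simps)
      qed
      have "real K powr (1 - ?\<theta>) * ?\<pi> \<le> (2 / ?\<pi>) powr (1 - ?\<theta>) * ?\<pi>"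
        using K2 \<pi> by (intro mult_right_mono powr_mono2) auto
      also have "\<dots> = 2 powr (1 - ?\<theta>) * (?\<pi> powr (- (1 - ?\<theta>)) * ?\<pi> powr 1)"
        using \<pi> by (subst powr_minus_divide) (simp add: powr_divide)
      also have "\<dots> = 2 powr (1 - ?\<theta>) * ?\<pi> powr ?\<theta>"
        unfolding powr_add[symmetric] by simp
      also have "\<dots> \<le> 2 powr 1 * ?\<pi> powr ?\<theta>"
        using r by (intro mult_right_mono powr_mono) auto
      finally have A: "real K powr (1 - ?\<theta>) * ?\<pi> \<le> 2 * ?\<pi> powr ?\<theta>" by simp
      have "(\<Sum>k=1..K. real k powr (- r)) * ?\<pi> \<le> (real K powr (1 - ?\<theta>) * (1 + ln (real K))) * ?\<pi>"
        using \<pi> K2 by (intro mult_right_mono sum_powr_le r) auto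
      also have "\<dots> = (real K powr (1 - ?\<theta>) * ?\<pi>) * (1 + ln (real K))" by simp
      also have "\<dots> \<le> (2 * ?\<pi> powr ?\<theta>) * ((1 + ln 2 + L) * real (length a))"
        by (rule mult_mono[OF A lnK]) (use K2 in auto)
      finally have 1: "(\<Sum>k=1..K. real k powr (- r)) * ?\<pi> \<le> (2 * (1 + ln 2 + L)) * real (length a) * ?\<pi> powr ?\<theta>"
        by (simp only: mult_ac)
      have "real K powr (- r) \<le> (1 / ?\<pi>) powr (- r)" using K1 \<pi> r by (intro powr_mono2') auto
      also have "\<dots> = ?\<pi> powr r" using \<pi> by (simp add: powr_divide powr_minus)
      also have "\<dots> \<le> ?\<pi> powr ?\<theta>" using \<pi> by (intro powr_mono') auto
      also have "\<dots> \<le> real (length a) * ?\<pi> powr ?\<theta>" using n1 by (simp add: mult_le_cancel_right1)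
      finally have 2: "real K powr (- r) \<le> real (length a) * ?\<pi> powr ?\<theta>" .
      show "(\<Sum>k=1..K. real k powr (- r)) * ?\<pi> + real K powr (- r) \<le> C * real (length a) * ?\<pi> powr ?\<theta>"
        using 1 2 by (simp add: C_def algebra_simps)
    qed
    finally show ?thesis .
  qed
  moreover have "1 \<le> C" using L(1) by (simp add: C_def)
  ultimately show ?thesis using that by blast
qed

lemma moment_upper:
  obtains C c where "1 \<le> C" "0 \<le> c" "\<And>a. a \<noteq> [] \<Longrightarrow> (\<integral>\<^sup>+ y. powr_ennreal (hitting_time a y) q \<partial>D)
    \<le> ennreal (C * real (length a) powr c * word_prob m P a powr (- max q (- 1)))"
proof (cases "0 \<le> q")
  case True
  then have max: "max q (- 1) = q" by simp
  obtain C where "1 \<le> C" "\<And>a. a \<noteq> [] \<Longrightarrow> (\<integral>\<^sup>+ y. powr_ennreal (hitting_time a y) q \<partial>D)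
    \<le> ennreal (C * real (length a) powr q * word_prob m P a powr (- q))"
    using moment_upper_nonneg[OF True] by blast
  then show ?thesis using that[of C q] True unfolding max by blast
next
  case False
  then have "0 \<le> - q" by simp
  then obtain C where C: "1 \<le> C" "\<And>a. a \<noteq> [] \<Longrightarrow> (\<integral>\<^sup>+ y. powr_ennreal (hitting_time a y) (- (- q)) \<partial>D)
    \<le> ennreal (C * real (length a) * word_prob m P a powr (min (- q) 1))"
    using moment_upper_neg[of "- q"] by blast
  have max: "min (- q) 1 = - max q (- 1)" by (simp add: min_def max_def)
  show ?thesis
    by (rule that[of C 1]) (use C in \<open>auto simp: max\<close>)
qed

text \<open>Three regimes: half of the mass is late for q \<ge> 0, half of the mass is early for q
  between -1 and 0, and an immediate hit decides for q < -1.\<close>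

lemma moment_lower:
  obtains C c where "1 \<le> C" "0 \<le> c" "\<And>a. a \<noteq> [] \<Longrightarrow>
    ennreal (word_prob m P a powr (- max q (- 1)) / (C * real (length a) powr c))
    \<le> (\<integral>\<^sup>+ y. powr_ennreal (hitting_time a y) q \<partial>D)"
proof -
  consider "0 \<le> q" | "- 1 \<le> q" "q < 0" | "q < - 1" by linarith
  then show ?thesis
  proof cases
    case 1
    have "(1 / 2) powr q \<le> (1::real)" using 1 by (simp add: powr_le1)
    then have "1 \<le> 2 * 2 powr q" using 1 by (smt (verit) ge_one_powr_ge_zero)
    then show ?thesis
      using that[of "2 * 2 powr q" 0] moment_lower_nonneg[OF 1] 1
      by (simp add: powr_divide powr_minus max_def field_simps)
  next
    case 2
    obtain \<kappa> where \<kappa>: "0 < \<kappa>" "\<kappa> \<le> 1" "\<And>x y. \<kappa> * m y \<le> P x y" using kappa_exists by blast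
    let ?C = "2 * (2 / \<kappa>) powr (- q)"
    have "1 \<le> (2 / \<kappa>) powr (- q)" using \<kappa> 2 by (intro ge_one_powr_ge_zero) auto
    then have C: "1 \<le> ?C" by simp
    show ?thesis
    proof (rule that[OF C, of "- q"])
      fix a :: "'a list" assume a: "a \<noteq> []"
      have "word_prob m P a powr (- max q (- 1)) / (?C * real (length a) powr (- q))
          = 1 / 2 * (\<kappa> / (2 * real (length a))) powr (- q) * word_prob m P a powr (- q)"
        using 2 \<kappa> a by (simp add: max_def powr_divide powr_mult mult_ac)
      then show "ennreal (word_prob m P a powr (- max q (- 1)) / (?C * real (length a) powr (- q)))
          \<le> (\<integral>\<^sup>+ y. powr_ennreal (hitting_time a y) q \<partial>D)"
        using moment_lower_neg[of "- q", OF _ a \<kappa>] 2 by (simp only: minus_minus)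
    qed (use 2 in simp)
  next
    case 3
    then show ?thesis
      using that[of 1 0] moment_ge_word_prob[of _ q] word_prob_pos by (simp add: max_def less_imp_le)
  qed
qed

end

subsection \<open>Moments of the ratio of waiting times\<close>

lemma waiting_time_eq_hitting_time:
  "waiting_time n x y = hitting_time (map x [Suc 0..<Suc n]) y"
proof -
  have "(\<forall>i\<in>{1..n}. x i = y (k + i)) \<longleftrightarrow> hit (map x [Suc 0..<Suc n]) k y" for k
  proof -
    have "hit (map x [Suc 0..<Suc n]) k y \<longleftrightarrow> (\<forall>i<n. y (k + Suc i) = x (Suc i))"
      by (auto simp: hit_def list_eq_iff_nth_eq simp del: upt_Suc)
    also have "\<dots> \<longleftrightarrow> (\<forall>i\<in>{1..n}. x i = y (k + i))"
    proof safe
      fix i assume *: "\<forall>i<n. y (k + Suc i) = x (Suc i)" and i: "i \<in> {1..n}"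
      then have "i - 1 < n" "Suc (i - 1) = i" by auto
      then show "x i = y (k + i)" using * by metis
    qed auto
    finally show ?thesis by simp
  qed
  then show ?thesis by (simp add: waiting_time_def hitting_time_def)
qed

lemma powr_ennreal_ratio:
  assumes "1 \<le> j" "1 \<le> k"
  shows "powr_ennreal (of_nat j / of_nat k) q = powr_ennreal (of_nat j) q * powr_ennreal (of_nat k) (- q)"
proof -
  have "(of_nat j / of_nat k :: ennreal) = ennreal (real j / real k)"
    using assms by (simp add: ennreal_of_nat_eq_real_of_nat divide_ennreal)
  moreover have "real j / real k \<noteq> 0" using assms by simp
  ultimately have "powr_ennreal (of_nat j / of_nat k) q = ennreal ((real j / real k) powr q)"
    using assms by (simp add: powr_ennreal_def)
  also have "\<dots> = ennreal (real j powr q * real k powr (- q))"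
    by (simp add: powr_divide powr_minus_divide)
  finally show ?thesis
    using assms by (simp add: powr_ennreal_of_nat ennreal_mult)
qed

lemma word_weight_powr:
  fixes P P' :: "'a \<Rightarrow> 'a \<Rightarrow> real"
  assumes "\<And>x y. 0 < P x y" "\<And>x y. 0 < P' x y"
  shows "word_weight (\<lambda>x y. P x y powr \<alpha> * P' x y powr \<beta>) l = word_weight P l powr \<alpha> * word_weight P' l powr \<beta>"
  using word_weight_pos[of P, OF assms(1)] word_weight_pos[of P', OF assms(2)]
  by (induction l rule: induct_list012) (auto simp: powr_mult assms less_imp_le)

locale two_chains =
  X: stationary_chain P m D + Y: stationary_chain P' m' D'
  for P P' :: "'a::finite \<Rightarrow> 'a \<Rightarrow> real" and m m' and D D' :: "(nat \<Rightarrow> 'a) measure"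
begin

definition Q :: "((nat \<Rightarrow> 'a) \<times> (nat \<Rightarrow> 'a) \<times> (nat \<Rightarrow> 'a)) measure" where
  "Q = D \<Otimes>\<^sub>M (D' \<Otimes>\<^sub>M D)"

lemma prob_space_YX: "prob_space (D' \<Otimes>\<^sub>M D)"
  using X.prob_space_axioms Y.prob_space_axioms prob_space_pair by blast

lemma prob_space_Q: "prob_space Q"
  unfolding Q_def using X.prob_space_axioms prob_space_YX prob_space_pair by blast

lemma waiting_ratio_measurable [measurable]: "waiting_ratio n \<in> borel_measurable Q"
proof -
  have eq: "waiting_ratio n = (\<lambda>\<omega>. hitting_time (map (fst \<omega>) [Suc 0..<Suc n]) (fst (snd \<omega>))
      / hitting_time (map (fst \<omega>) [Suc 0..<Suc n]) (snd (snd \<omega>)))"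
    by (auto simp: waiting_ratio_def waiting_time_eq_hitting_time fun_eq_iff)
  have "(\<lambda>\<omega>. map (fst \<omega>) [Suc 0..<Suc n]) \<in> measurable Q (count_space UNIV)"
    unfolding Q_def by (rule measurable_compose[OF measurable_fst X.word_measurable])
  moreover have "(\<lambda>\<omega>. hitting_time a (fst (snd \<omega>)) / hitting_time a (snd (snd \<omega>))) \<in> borel_measurable Q" for a
    unfolding Q_def
    by (intro borel_measurable_divide_ennreal
          measurable_compose[OF _ X.hitting_time_measurable] measurable_compose[OF _ Y.hitting_time_measurable]) measurable
  ultimately show ?thesis
    unfolding eq by (rule measurable_compose_countable[rotated])
qed

text \<open>Once the word is fixed, the two waiting times are independent. The power of the quotient
  splits into a product where both times are finite, hence almost surely.\<close>

lemma ratio_finite_AE: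
  assumes "a \<noteq> []"
  shows "(\<integral>\<^sup>+ z. powr_ennreal (hitting_time a (fst z) / hitting_time a (snd z)) q \<partial>(D' \<Otimes>\<^sub>M D))
    = (\<integral>\<^sup>+ y. powr_ennreal (hitting_time a y) q \<partial>D') * (\<integral>\<^sup>+ x. powr_ennreal (hitting_time a x) (- q) \<partial>D)"
proof -
  have meas: "(\<lambda>z. powr_ennreal (hitting_time a (fst z) / hitting_time a (snd z)) q) \<in> borel_measurable (D' \<Otimes>\<^sub>M D)"
    by (rule measurable_compose[OF _ powr_ennreal_measurable])
       (intro borel_measurable_divide_ennreal
          measurable_compose[OF _ X.hitting_time_measurable] measurable_compose[OF _ Y.hitting_time_measurable]; measurable)
  have mX: "(\<lambda>x. powr_ennreal (hitting_time a x) r) \<in> borel_measurable D" for r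
    by (rule measurable_compose[OF X.hitting_time_measurable powr_ennreal_measurable])
  have mY: "(\<lambda>x. powr_ennreal (hitting_time a x) r) \<in> borel_measurable D'" for r
    by (rule measurable_compose[OF Y.hitting_time_measurable powr_ennreal_measurable])
  have "(\<integral>\<^sup>+ z. powr_ennreal (hitting_time a (fst z) / hitting_time a (snd z)) q \<partial>(D' \<Otimes>\<^sub>M D))
    = (\<integral>\<^sup>+ y. \<integral>\<^sup>+ x. powr_ennreal (hitting_time a y / hitting_time a x) q \<partial>D \<partial>D')"
    using X.nn_integral_fst[OF meas] by simp
  also have "\<dots> = (\<integral>\<^sup>+ y. powr_ennreal (hitting_time a y) q * (\<integral>\<^sup>+ x. powr_ennreal (hitting_time a x) (- q) \<partial>D) \<partial>D')"
  proof (rule nn_integral_cong_AE)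
    show "AE y in D'. (\<integral>\<^sup>+ x. powr_ennreal (hitting_time a y / hitting_time a x) q \<partial>D)
      = powr_ennreal (hitting_time a y) q * (\<integral>\<^sup>+ x. powr_ennreal (hitting_time a x) (- q) \<partial>D)"
      using Y.hitting_time_AE[OF assms]
    proof eventually_elim
      case (elim y)
      then obtain j where j: "1 \<le> j" "hitting_time a y = of_nat j" by blast
      have "(\<integral>\<^sup>+ x. powr_ennreal (hitting_time a y / hitting_time a x) q \<partial>D)
          = (\<integral>\<^sup>+ x. powr_ennreal (hitting_time a y) q * powr_ennreal (hitting_time a x) (- q) \<partial>D)"
      proof (rule nn_integral_cong_AE)
        show "AE x in D. powr_ennreal (hitting_time a y / hitting_time a x) q
          = powr_ennreal (hitting_time a y) q * powr_ennreal (hitting_time a x) (- q)"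
          using X.hitting_time_AE[OF assms]
        proof eventually_elim
          case (elim x)
          then obtain k where "1 \<le> k" "hitting_time a x = of_nat k" by blast
          then show ?case using powr_ennreal_ratio[OF j(1)] j(2) by simp
        qed
      qed
      also have "\<dots> = powr_ennreal (hitting_time a y) q * (\<integral>\<^sup>+ x. powr_ennreal (hitting_time a x) (- q) \<partial>D)"
        by (rule nn_integral_cmult[OF mX])
      finally show ?case .
    qed
  qed
  also have "\<dots> = (\<integral>\<^sup>+ y. powr_ennreal (hitting_time a y) q \<partial>D') * (\<integral>\<^sup>+ x. powr_ennreal (hitting_time a x) (- q) \<partial>D)"
    by (rule nn_integral_multc[OF mY])
  finally show ?thesis .
qed

text \<open>Fubini with X outermost: X enters only through its word, which stationarity makes
  distributed like the first n letters.\<close>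

lemma ratio_moment:
  assumes n: "1 \<le> n"
  shows "(\<integral>\<^sup>+ \<omega>. powr_ennreal (waiting_ratio n \<omega>) q \<partial>Q) =
    (\<Sum>a | length a = n. ((\<integral>\<^sup>+ y. powr_ennreal (hitting_time a y) q \<partial>D') *
       (\<integral>\<^sup>+ x. powr_ennreal (hitting_time a x) (- q) \<partial>D)) * ennreal (word_prob m P a))"
proof -
  interpret YX: prob_space "D' \<Otimes>\<^sub>M D" by (rule prob_space_YX)
  define H where "H a = (\<integral>\<^sup>+ y. powr_ennreal (hitting_time a y) q \<partial>D') *
       (\<integral>\<^sup>+ x. powr_ennreal (hitting_time a x) (- q) \<partial>D)" for a :: "'a list"
  let ?w = "\<lambda>x. map x [Suc 0..<Suc n]"
  have meas: "(\<lambda>\<omega>. powr_ennreal (waiting_ratio n \<omega>) q) \<in> borel_measurable (D \<Otimes>\<^sub>M (D' \<Otimes>\<^sub>M D))"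
    using measurable_compose[OF waiting_ratio_measurable powr_ennreal_measurable] unfolding Q_def .
  have "(\<integral>\<^sup>+ \<omega>. powr_ennreal (waiting_ratio n \<omega>) q \<partial>Q)
      = (\<integral>\<^sup>+ x. \<integral>\<^sup>+ z. powr_ennreal (waiting_ratio n (x, z)) q \<partial>(D' \<Otimes>\<^sub>M D) \<partial>D)"
    unfolding Q_def using YX.nn_integral_fst[OF meas] by simp
  also have "\<dots> = (\<integral>\<^sup>+ x. H (?w x) \<partial>D)"
  proof (rule nn_integral_cong)
    fix x :: "nat \<Rightarrow> 'a"
    have ne: "?w x \<noteq> []" using n by auto
    show "(\<integral>\<^sup>+ z. powr_ennreal (waiting_ratio n (x, z)) q \<partial>(D' \<Otimes>\<^sub>M D)) = H (?w x)"
      unfolding H_def ratio_finite_AE[OF ne, symmetric]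
      by (simp add: waiting_ratio_def waiting_time_eq_hitting_time case_prod_beta del: upt_Suc)
  qed
  also have "\<dots> = (\<integral>\<^sup>+ x. (\<Sum>a | length a = n. H a * indicator {x\<in>space D. ?w x = a} x) \<partial>D)"
  proof (rule nn_integral_cong)
    fix x :: "nat \<Rightarrow> 'a"
    have "(\<Sum>a | length a = n. H a * indicator {x\<in>space D. ?w x = a} x) = (\<Sum>a | length a = n. if ?w x = a then H a else 0)"
      by (intro sum.cong refl) (simp add: X.space_D del: upt_Suc)
    also have "\<dots> = H (?w x)" by (subst sum.delta') (auto simp del: upt_Suc)
    finally show "H (?w x) = (\<Sum>a | length a = n. H a * indicator {x\<in>space D. ?w x = a} x)" by simp
  qed
  also have "\<dots> = (\<Sum>a | length a = n. \<integral>\<^sup>+ x. H a * indicator {x\<in>space D. ?w x = a} x \<partial>D)"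
    by (rule nn_integral_sum) measurable
  also have "\<dots> = (\<Sum>a | length a = n. H a * ennreal (word_prob m P a))"
  proof (rule sum.cong[OF refl])
    fix a :: "'a list" assume "a \<in> {a. length a = n}"
    then have a: "length a = n" "a \<noteq> []" using n by auto
    have "(\<integral>\<^sup>+ x. H a * indicator {x\<in>space D. ?w x = a} x \<partial>D) = H a * emeasure D {x\<in>space D. ?w x = a}"
      by (rule nn_integral_cmult_indicator) measurable
    also have "\<dots> = H a * ennreal (word_prob m P a)"
      using X.prob_word[OF a(2), of 1] a(1) by (simp add: X.emeasure_eq_measure X.space_D del: upt_Suc)
    finally show "(\<integral>\<^sup>+ x. H a * indicator {x\<in>space D. ?w x = a} x \<partial>D) = H a * ennreal (word_prob m P a)" .
  qed
  finally show ?thesis by (simp add: H_def)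
qed

text \<open>Two exponents rather than one tilt, because the saturation of moments at 1 affects the
  exponents of P and P' on opposite sides.\<close>

definition joint_kernel :: "real \<Rightarrow> real \<Rightarrow> 'a \<Rightarrow> 'a \<Rightarrow> real" where
  "joint_kernel \<alpha> \<beta> x y = P x y powr \<alpha> * P' x y powr \<beta>"

lemma joint_kernel_pos: "0 < joint_kernel \<alpha> \<beta> x y"
  using X.P_pos[of x y] Y.P_pos[of x y] by (simp add: joint_kernel_def)

text \<open>A word of n letters has n - 1 transitions; the missing power of the root, the initial
  weights and the number of states are all absorbed into the constant.\<close>

lemma word_sum_bounds:
  obtains C where "1 \<le> C"
    "\<And>n. 1 \<le> n \<Longrightarrow> perron_root (joint_kernel \<alpha> \<beta>) ^ n / C
      \<le> (\<Sum>a | length a = n. word_prob m P a powr \<alpha> * word_prob m' P' a powr \<beta>)"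
    "\<And>n. 1 \<le> n \<Longrightarrow> (\<Sum>a | length a = n. word_prob m P a powr \<alpha> * word_prob m' P' a powr \<beta>)
      \<le> C * perron_root (joint_kernel \<alpha> \<beta>) ^ n"
proof -
  let ?K = "joint_kernel \<alpha> \<beta>" and ?r = "perron_root (joint_kernel \<alpha> \<beta>)"
  let ?v = "\<lambda>x. m x powr \<alpha> * m' x powr \<beta>"
  let ?Z = "\<lambda>n. \<Sum>a | length a = n. word_prob m P a powr \<alpha> * word_prob m' P' a powr \<beta>"
  have r: "0 < ?r" by (rule perron_root_pos[OF joint_kernel_pos])
  have "0 < ?v x" for x using X.m_pos[of x] Y.m_pos[of x] by simp
  then obtain lo where lo: "0 < lo" "\<And>x. lo \<le> ?v x" using finite_pos_bounds[of ?v] by blast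
  obtain hi where hi: "0 < hi" "\<And>x. ?v x \<le> hi" using finite_upper_bound[of ?v] by blast
  obtain C where C: "1 \<le> C"
    "\<And>n x. ?r ^ n / C \<le> (transfer ?K ^^ n) (\<lambda>_. 1) x"
    "\<And>n x. (transfer ?K ^^ n) (\<lambda>_. 1) x \<le> C * ?r ^ n"
    using transfer_power_bounds[of ?K, OF joint_kernel_pos] by blast
  define N where "N = real CARD('a)"
  have N: "0 < N" by (simp add: N_def)
  have summand: "word_prob m P a powr \<alpha> * word_prob m' P' a powr \<beta> = ?v (hd a) * word_weight ?K a" for a
  proof -
    have "word_weight ?K a = word_weight P a powr \<alpha> * word_weight P' a powr \<beta>"
      unfolding joint_kernel_def[abs_def] by (rule word_weight_powr[OF X.P_pos Y.P_pos])
    then show ?thesis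
      using X.m_pos Y.m_pos word_weight_pos[of P a, OF X.P_pos] word_weight_pos[of P' a, OF Y.P_pos]
      by (simp add: word_prob_def powr_mult less_imp_le mult_ac)
  qed
  have ww: "0 < word_weight ?K a" for a by (rule word_weight_pos[OF joint_kernel_pos])
  have S: "(\<Sum>a | length a = n. word_weight ?K a) = (\<Sum>x\<in>UNIV. (transfer ?K ^^ (n - 1)) (\<lambda>_. 1) x)" if "1 \<le> n" for n
    using sum_word_weight[where n = "n - 1" and K = ?K] that by simp
  have r_n: "?r ^ n = ?r * ?r ^ (n - 1)" if "1 \<le> n" for n using that by (cases n) auto
  have low: "lo * N / (C * ?r) * ?r ^ n \<le> ?Z n" if n: "1 \<le> n" for n
  proof -
    have "lo * N / (C * ?r) * ?r ^ n = lo * (\<Sum>x\<in>(UNIV::'a set). ?r ^ (n - 1) / C)"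
      using r C(1) by (simp add: r_n[OF n] N_def)
    also have "\<dots> \<le> lo * (\<Sum>a | length a = n. word_weight ?K a)"
      unfolding S[OF n] using lo C(2) by (intro mult_left_mono sum_mono) auto
    also have "\<dots> \<le> ?Z n"
      unfolding summand sum_distrib_left using lo ww by (intro sum_mono mult_right_mono) (auto simp: less_imp_le)
    finally show ?thesis .
  qed
  have up: "?Z n \<le> hi * N * C / ?r * ?r ^ n" if n: "1 \<le> n" for n
  proof -
    have "?Z n \<le> hi * (\<Sum>a | length a = n. word_weight ?K a)"
      unfolding summand sum_distrib_left using hi ww by (intro sum_mono mult_right_mono) (auto simp: less_imp_le)
    also have "\<dots> \<le> hi * (\<Sum>x\<in>(UNIV::'a set). C * ?r ^ (n - 1))"
      unfolding S[OF n] using hi C(3) by (intro mult_left_mono sum_mono) auto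
    also have "\<dots> = hi * N * C / ?r * ?r ^ n" using r by (simp add: r_n[OF n] N_def)
    finally show ?thesis .
  qed
  define A where "A = max 1 (max (C * ?r / (lo * N)) (hi * N * C / ?r))"
  have "?r ^ n / A \<le> ?Z n" if n: "1 \<le> n" for n
  proof -
    have "?r ^ n / A \<le> ?r ^ n / (C * ?r / (lo * N))"
      using r C(1) lo N by (intro divide_left_mono) (auto simp: A_def)
    also have "\<dots> = lo * N / (C * ?r) * ?r ^ n" by simp
    finally show ?thesis using low[OF n] by linarith
  qed
  moreover have "?Z n \<le> A * ?r ^ n" if n: "1 \<le> n" for n
  proof -
    have "hi * N * C / ?r * ?r ^ n \<le> A * ?r ^ n" using r by (intro mult_right_mono) (auto simp: A_def)
    then show ?thesis using up[OF n] by linarith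
  qed
  ultimately show ?thesis using that[of A] by (simp add: A_def)
qed

text \<open>Up to polynomial factors the two moments contribute \<pi>' to the power - max q (-1) and
  \<pi> to the power min q 1. The probability of the word itself supplies the additional 1 in the
  exponent of \<pi>.\<close>

theorem ratio_moment_rate:
  obtains e :: "nat \<Rightarrow> real" where "\<And>n. 1 \<le> n \<Longrightarrow> 0 < e n"
    "\<And>n. 1 \<le> n \<Longrightarrow> (\<integral>\<^sup>+ \<omega>. powr_ennreal (waiting_ratio n \<omega>) q \<partial>Q) = ennreal (e n)"
    "(\<lambda>n. ln (e n) / real n) \<longlonglongrightarrow> ln (perron_root (joint_kernel (1 + min q 1) (- max q (- 1))))"
proof -
  let ?\<alpha> = "1 + min q 1" and ?\<beta> = "- max q (- 1)"
  let ?\<pi> = "word_prob m P" and ?\<pi>' = "word_prob m' P'"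
  let ?r = "perron_root (joint_kernel ?\<alpha> ?\<beta>)"
  let ?Z = "\<lambda>n. \<Sum>a | length a = n. ?\<pi> a powr ?\<alpha> * ?\<pi>' a powr ?\<beta>"
  have r: "0 < ?r" by (rule perron_root_pos[OF joint_kernel_pos])
  have \<pi>: "0 < ?\<pi> a" "0 < ?\<pi>' a" for a by (rule X.word_prob_pos, rule Y.word_prob_pos)
  obtain A1 a1 where 1: "1 \<le> A1" "0 \<le> a1" "\<And>a. a \<noteq> [] \<Longrightarrow> (\<integral>\<^sup>+ y. powr_ennreal (hitting_time a y) q \<partial>D')
    \<le> ennreal (A1 * real (length a) powr a1 * ?\<pi>' a powr ?\<beta>)"
    using Y.moment_upper[of q] by blast
  have max': "- max (- q) (- 1) = min q 1" by (simp add: min_def max_def)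
  obtain A2 a2 where 2: "1 \<le> A2" "0 \<le> a2" "\<And>a. a \<noteq> [] \<Longrightarrow> (\<integral>\<^sup>+ y. powr_ennreal (hitting_time a y) (- q) \<partial>D)
    \<le> ennreal (A2 * real (length a) powr a2 * ?\<pi> a powr (min q 1))"
    using X.moment_upper[of "- q"] unfolding max' by blast
  obtain A3 a3 where 3: "1 \<le> A3" "0 \<le> a3" "\<And>a. a \<noteq> [] \<Longrightarrow>
    ennreal (?\<pi>' a powr ?\<beta> / (A3 * real (length a) powr a3)) \<le> (\<integral>\<^sup>+ y. powr_ennreal (hitting_time a y) q \<partial>D')"
    using Y.moment_lower[of q] by blast
  obtain A4 a4 where 4: "1 \<le> A4" "0 \<le> a4" "\<And>a. a \<noteq> [] \<Longrightarrow>
    ennreal (?\<pi> a powr (min q 1) / (A4 * real (length a) powr a4)) \<le> (\<integral>\<^sup>+ y. powr_ennreal (hitting_time a y) (- q) \<partial>D)"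
    using X.moment_lower[of "- q"] unfolding max' by blast
  obtain A5 where 5: "1 \<le> A5" "\<And>n. 1 \<le> n \<Longrightarrow> ?r ^ n / A5 \<le> ?Z n" "\<And>n. 1 \<le> n \<Longrightarrow> ?Z n \<le> A5 * ?r ^ n"
    using word_sum_bounds by blast
  define U where "U n = A1 * real n powr a1 * (A2 * real n powr a2)" for n
  define V where "V n = A3 * real n powr a3 * (A4 * real n powr a4)" for n
  define B where "B = A1 * A2 * A3 * A4 * A5"
  define b where "b = a1 + a2 + a3 + a4"
  have U_le: "U n \<le> A1 * A2 * (real n + 1) powr b" if n: "1 \<le> n" for n
  proof -
    have "U n = A1 * A2 * real n powr (a1 + a2)" by (simp add: U_def powr_add)
    also have "\<dots> \<le> A1 * A2 * (real n + 1) powr b"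
      using 1 2 3 4 n by (intro mult_left_mono order_trans[OF powr_mono powr_mono2]) (auto simp: b_def)
    finally show ?thesis .
  qed
  have V_le: "V n \<le> A3 * A4 * (real n + 1) powr b" if n: "1 \<le> n" for n
  proof -
    have "V n = A3 * A4 * real n powr (a3 + a4)" by (simp add: V_def powr_add)
    also have "\<dots> \<le> A3 * A4 * (real n + 1) powr b"
      using 1 2 3 4 n by (intro mult_left_mono order_trans[OF powr_mono powr_mono2]) (auto simp: b_def)
    finally show ?thesis .
  qed
  have U_pos: "0 < U n" and V_pos: "0 < V n" if "1 \<le> n" for n
    using that 1 2 3 4 by (auto simp: U_def V_def)
  let ?E = "\<lambda>n. \<integral>\<^sup>+ \<omega>. powr_ennreal (waiting_ratio n \<omega>) q \<partial>Q"
  have upper: "?E n \<le> ennreal (U n * ?Z n)" if n: "1 \<le> n" for n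
  proof -
    have "?E n \<le> (\<Sum>a | length a = n. ennreal (U n * (?\<pi> a powr ?\<alpha> * ?\<pi>' a powr ?\<beta>)))"
      unfolding ratio_moment[OF n]
    proof (rule sum_mono)
      fix a :: "'a list" assume "a \<in> {a. length a = n}"
      then have a: "length a = n" "a \<noteq> []" using n by auto
      have "((\<integral>\<^sup>+ y. powr_ennreal (hitting_time a y) q \<partial>D') *
         (\<integral>\<^sup>+ x. powr_ennreal (hitting_time a x) (- q) \<partial>D)) * ennreal (?\<pi> a)
        \<le> (ennreal (A1 * real n powr a1 * ?\<pi>' a powr ?\<beta>) * ennreal (A2 * real n powr a2 * ?\<pi> a powr (min q 1))) * ennreal (?\<pi> a)"
        using 1(3)[OF a(2)] 2(3)[OF a(2)] a(1) by (intro mult_mono) auto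
      also have "\<dots> = ennreal (U n * (?\<pi> a powr ?\<alpha> * ?\<pi>' a powr ?\<beta>))"
        using 1 2 \<pi>[of a] by (simp add: ennreal_mult[symmetric] U_def powr_add less_imp_le mult_ac)
      finally show "((\<integral>\<^sup>+ y. powr_ennreal (hitting_time a y) q \<partial>D') *
         (\<integral>\<^sup>+ x. powr_ennreal (hitting_time a x) (- q) \<partial>D)) * ennreal (?\<pi> a)
         \<le> ennreal (U n * (?\<pi> a powr ?\<alpha> * ?\<pi>' a powr ?\<beta>))" .
    qed
    also have "\<dots> = ennreal (U n * ?Z n)"
      using U_pos[OF n] by (subst sum_ennreal) (auto simp: sum_distrib_left)
    finally show ?thesis .
  qed
  have lower: "ennreal (?Z n / V n) \<le> ?E n" if n: "1 \<le> n" for n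
  proof -
    have "ennreal (?Z n / V n) = (\<Sum>a | length a = n. ennreal (?\<pi> a powr ?\<alpha> * ?\<pi>' a powr ?\<beta> / V n))"
      using V_pos[OF n] by (subst sum_ennreal) (auto simp: sum_divide_distrib)
    also have "\<dots> \<le> ?E n"
      unfolding ratio_moment[OF n]
    proof (rule sum_mono)
      fix a :: "'a list" assume "a \<in> {a. length a = n}"
      then have a: "length a = n" "a \<noteq> []" using n by auto
      have "ennreal (?\<pi> a powr ?\<alpha> * ?\<pi>' a powr ?\<beta> / V n)
        = (ennreal (?\<pi>' a powr ?\<beta> / (A3 * real n powr a3)) * ennreal (?\<pi> a powr (min q 1) / (A4 * real n powr a4))) * ennreal (?\<pi> a)"
        using 3 4 \<pi>[of a] by (simp add: ennreal_mult[symmetric] V_def powr_add less_imp_le mult_ac)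
      also have "\<dots> \<le> ((\<integral>\<^sup>+ y. powr_ennreal (hitting_time a y) q \<partial>D') *
         (\<integral>\<^sup>+ x. powr_ennreal (hitting_time a x) (- q) \<partial>D)) * ennreal (?\<pi> a)"
        using 3(3)[OF a(2)] 4(3)[OF a(2)] a(1) by (intro mult_mono) auto
      finally show "ennreal (?\<pi> a powr ?\<alpha> * ?\<pi>' a powr ?\<beta> / V n) \<le> ((\<integral>\<^sup>+ y. powr_ennreal (hitting_time a y) q \<partial>D') *
         (\<integral>\<^sup>+ x. powr_ennreal (hitting_time a x) (- q) \<partial>D)) * ennreal (?\<pi> a)" .
    qed
    finally show ?thesis .
  qed
  define e where "e n = enn2real (?E n)" for n
  have E_eq: "?E n = ennreal (e n)" if n: "1 \<le> n" for n
  proof -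
    have "?E n < \<infinity>" using upper[OF n] by (rule order.strict_trans1) simp
    then show ?thesis by (simp add: e_def)
  qed
  \<comment> \<open>\<open>ln_power_rate\<close> asks for a positive factor at every n, including 0,
    hence the base n + 1.\<close>
  define W where "W n = B * (real n + 1) powr b" for n
  have AB: "A1 * A2 * A5 \<le> B" "A3 * A4 * A5 \<le> B" "1 \<le> B"
  proof -
    have 12: "1 \<le> A1 * A2" and 34: "1 \<le> A3 * A4"
      using 1(1) 2(1) 3(1) 4(1) mult_mono[of 1 A1 1 A2] mult_mono[of 1 A3 1 A4] by auto
    have "1 * (A1 * A2 * A5) \<le> (A3 * A4) * (A1 * A2 * A5)"
      using 12 34 5(1) by (intro mult_right_mono) auto
    then show *: "A1 * A2 * A5 \<le> B" by (simp add: B_def mult_ac)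
    have "1 * (A3 * A4 * A5) \<le> (A1 * A2) * (A3 * A4 * A5)"
      using 12 34 5(1) by (intro mult_right_mono) auto
    then show "A3 * A4 * A5 \<le> B" by (simp add: B_def mult_ac)
    have "1 * 1 \<le> (A1 * A2) * A5" using 12 5(1) by (intro mult_mono) auto
    then show "1 \<le> B" using * by simp
  qed
  have e_up: "e n \<le> W n * ?r ^ n" if n: "1 \<le> n" for n
  proof -
    have Z0: "0 \<le> ?Z n" by (intro sum_nonneg) auto
    have "e n \<le> U n * ?Z n"
      using upper[OF n] U_pos[OF n] Z0 unfolding E_eq[OF n] by (subst (asm) ennreal_le_iff) auto
    also have "\<dots> \<le> (A1 * A2 * (real n + 1) powr b) * (A5 * ?r ^ n)"
      using U_le[OF n] 5(3)[OF n] Z0 1 2 by (intro mult_mono) auto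
    also have "\<dots> = (A1 * A2 * A5) * ((real n + 1) powr b * ?r ^ n)" by simp
    also have "\<dots> \<le> B * ((real n + 1) powr b * ?r ^ n)"
      using AB r by (intro mult_right_mono) auto
    finally show ?thesis by (simp add: W_def)
  qed
  have e_low: "?r ^ n / W n \<le> e n" if n: "1 \<le> n" for n
  proof -
    have W_pos: "0 < W n" using AB(3) by (simp add: W_def)
    have "V n * A5 \<le> (A3 * A4 * (real n + 1) powr b) * A5"
      using V_le[OF n] 5(1) by (intro mult_right_mono) auto
    also have "\<dots> = (A3 * A4 * A5) * (real n + 1) powr b" by simp
    also have "\<dots> \<le> W n" unfolding W_def using AB by (intro mult_right_mono) auto
    finally have "?r ^ n / W n \<le> ?r ^ n / (V n * A5)"
      using r V_pos[OF n] 5(1) W_pos by (intro divide_left_mono) auto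
    also have "\<dots> = (?r ^ n / A5) / V n" by simp
    also have "\<dots> \<le> ?Z n / V n" using 5(2)[OF n] V_pos[OF n] by (intro divide_right_mono) auto
    also have "\<dots> \<le> e n"
      using lower[OF n] unfolding E_eq[OF n] by (subst (asm) ennreal_le_iff) (auto simp: e_def)
    finally show ?thesis .
  qed
  show ?thesis
  proof (rule that[of e])
    show "0 < e n" if n: "1 \<le> n" for n
    proof -
      have "0 < ?r ^ n / W n" using r AB(3) by (simp add: W_def)
      then show ?thesis using e_low[OF n] by linarith
    qed
    show "?E n = ennreal (e n)" if "1 \<le> n" for n by (rule E_eq[OF that])
    have B0: "0 < B" using AB(3) by simp
    show "(\<lambda>n. ln (e n) / real n) \<longlonglongrightarrow> ln ?r"
    proof (rule ln_power_rate[OF r, where D = W])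
      show "0 < W n" for n using B0 by (simp add: W_def)
      show "(\<lambda>n. ln (W n) / real n) \<longlonglongrightarrow> 0"
        unfolding W_def using B0 by real_asymp
    qed (use e_up e_low in auto)
  qed
qed

end

subsection \<open>A local large deviation principle\<close>

text \<open>Exponential moments are controlled for parameters in (-1, 1) and no steepness is assumed
  at the ends. Consequently the statements below concern only slopes g s attained in that
  interval.\<close>

locale local_ldp = prob_space Q for Q :: "'w measure" +
  fixes X :: "nat \<Rightarrow> 'w \<Rightarrow> real" and N :: "nat \<Rightarrow> real" and e :: "real \<Rightarrow> nat \<Rightarrow> real"
    and G g :: "real \<Rightarrow> real"
  assumes X_meas [measurable]: "\<And>n. X n \<in> borel_measurable Q"
    and N_pos: "\<And>n. 1 \<le> n \<Longrightarrow> 0 < N n" and N_lim: "filterlim N at_top sequentially"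
    and e_pos: "\<And>s n. s \<in> {-1<..<1} \<Longrightarrow> 1 \<le> n \<Longrightarrow> 0 < e s n"
    and mgf: "\<And>s n. s \<in> {-1<..<1} \<Longrightarrow> 1 \<le> n \<Longrightarrow>
      (\<integral>\<^sup>+ \<omega>. ennreal (exp (s * N n * X n \<omega>)) \<partial>Q) = ennreal (e s n)"
    and rate: "\<And>s. s \<in> {-1<..<1} \<Longrightarrow> (\<lambda>n. ln (e s n) / N n) \<longlonglongrightarrow> G s"
    and G_deriv: "\<And>s. s \<in> {-1<..<1} \<Longrightarrow> (G has_real_derivative g s) (at s)"
    and g_cont: "continuous_on {-1<..<1} g"
    and g_mono: "\<And>s r. s \<in> {-1<..<1} \<Longrightarrow> r \<in> {-1<..<1} \<Longrightarrow> s < r \<Longrightarrow> g s < g r"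
    and G_0: "G 0 = 0"
begin

text \<open>The Legendre transform of G at the slope g s, parametrised by s instead of by the
  slope.\<close>

definition rate_fun :: "real \<Rightarrow> real" where
  "rate_fun s = s * g s - G s"

lemma rate_fun_cont: "continuous_on {-1<..<1} rate_fun"
proof -
  have "continuous_on {-1<..<1} G"
    by (intro continuous_at_imp_continuous_on ballI DERIV_isCont[OF G_deriv])
  then show ?thesis unfolding rate_fun_def by (intro continuous_intros g_cont)
qed

text \<open>Exponential Markov inequality for the unnormalised measure tilted by s. The factor t on
  both sides of the event covers upper tails for t > 0 and lower tails for t < 0.\<close>

lemma tilted_tail:
  assumes st: "s + t \<in> {-1<..<1}" and n: "1 \<le> n"
  shows "(\<integral>\<^sup>+ \<omega>. ennreal (exp (s * N n * X n \<omega>)) * indicator {\<omega>\<in>space Q. t * b \<le> t * X n \<omega>} \<omega> \<partial>Q)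
    \<le> ennreal (exp (- t * N n * b) * e (s + t) n)"
proof -
  have "(\<integral>\<^sup>+ \<omega>. ennreal (exp (s * N n * X n \<omega>)) * indicator {\<omega>\<in>space Q. t * b \<le> t * X n \<omega>} \<omega> \<partial>Q)
      \<le> (\<integral>\<^sup>+ \<omega>. ennreal (exp (- t * N n * b)) * ennreal (exp ((s + t) * N n * X n \<omega>)) \<partial>Q)"
  proof (rule nn_integral_mono)
    fix \<omega>
    have "exp (s * N n * X n \<omega>) \<le> exp (- t * N n * b) * exp ((s + t) * N n * X n \<omega>)" if "t * b \<le> t * X n \<omega>"
    proof -
      have "N n * (t * b) \<le> N n * (t * X n \<omega>)"
        using mult_left_mono[OF that, of "N n"] N_pos[OF n] by simp
      then show ?thesis by (simp add: exp_add[symmetric] algebra_simps)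
    qed
    then show "ennreal (exp (s * N n * X n \<omega>)) * indicator {\<omega>\<in>space Q. t * b \<le> t * X n \<omega>} \<omega>
        \<le> ennreal (exp (- t * N n * b)) * ennreal (exp ((s + t) * N n * X n \<omega>))"
      by (auto simp: indicator_def ennreal_mult[symmetric] intro!: ennreal_leI)
  qed
  also have "\<dots> = ennreal (exp (- t * N n * b)) * ennreal (e (s + t) n)"
    by (subst nn_integral_cmult) (auto simp: mgf[OF st n])
  also have "\<dots> = ennreal (exp (- t * N n * b) * e (s + t) n)"
    using e_pos[OF st n] by (simp add: ennreal_mult)
  finally show ?thesis .
qed

lemma chernoff:
  assumes t: "t \<in> {-1<..<1}" and n: "1 \<le> n"
  shows "prob {\<omega>\<in>space Q. t * b \<le> t * X n \<omega>} \<le> exp (- t * N n * b) * e t n"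
proof -
  have "emeasure Q {\<omega>\<in>space Q. t * b \<le> t * X n \<omega>} \<le> ennreal (exp (- t * N n * b) * e t n)"
    using tilted_tail[of 0 t n b] t n by simp
  then show ?thesis
    using e_pos[OF t n] by (simp add: emeasure_eq_measure ennreal_le_iff)
qed

text \<open>Under the measure tilted by \<open>s\<close> the variables concentrate at the slope \<open>g s\<close>, since
  \<open>G\<close> is differentiable at \<open>s\<close>.\<close>

lemma tilted_tail_small:
  assumes s: "s \<in> {-1<..<1}" and st: "s + t \<in> {-1<..<1}" and less: "G (s + t) - G s < t * b"
  shows "\<forall>\<^sub>F n in sequentially. exp (- t * N n * b) * e (s + t) n \<le> e s n / 4"
proof -
  \<comment> \<open>Half of the gap goes into the convergence of the rates; the other half,
    multiplied by N n, eventually absorbs the factor 4. Two tails of at most a quarter each leave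
    half of the total mass.\<close>
  define \<kappa> where "\<kappa> = (t * b - (G (s + t) - G s)) / 2"
  have \<kappa>: "0 < \<kappa>" using less by (simp add: \<kappa>_def)
  have "(\<lambda>n. ln (e (s + t) n) / N n - ln (e s n) / N n) \<longlonglongrightarrow> G (s + t) - G s"
    by (intro tendsto_diff rate s st)
  moreover have "G (s + t) - G s < t * b - \<kappa>" using \<kappa> by (simp add: \<kappa>_def field_simps)
  ultimately have "\<forall>\<^sub>F n in sequentially. ln (e (s + t) n) / N n - ln (e s n) / N n < t * b - \<kappa>"
    by (rule order_tendstoD)
  moreover have "\<forall>\<^sub>F n in sequentially. ln 4 / \<kappa> \<le> N n"
    using N_lim by (simp add: filterlim_at_top)
  ultimately show ?thesis
    using eventually_ge_at_top[of 1]
  proof eventually_elim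
    case (elim n)
    have N: "0 < N n" using N_pos elim by simp
    have pos: "0 < e (s + t) n" "0 < e s n" using e_pos s st elim by auto
    have "(ln (e (s + t) n) - ln (e s n)) / N n < t * b - \<kappa>" using elim by (simp add: diff_divide_distrib)
    then have "ln (e (s + t) n) - ln (e s n) < (t * b - \<kappa>) * N n" using N by (simp add: divide_less_eq)
    moreover have "ln 4 \<le> \<kappa> * N n" using elim \<kappa> by (simp add: divide_le_eq mult.commute)
    ultimately have "- t * N n * b + ln (e (s + t) n) \<le> ln (e s n) - ln 4" by (simp add: algebra_simps)
    then have "exp (- t * N n * b + ln (e (s + t) n)) \<le> exp (ln (e s n) - ln 4)" by simp
    then show ?case using pos by (simp only: exp_add exp_diff exp_ln zero_less_numeral)
  qed
qed

text \<open>Difference quotients within \<epsilon> of the derivative supply the strict inequalities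
  that \<open>tilted_tail_small\<close> needs on either side of s.\<close>

lemma slope_step:
  assumes s: "s \<in> {-1<..<1}" and \<epsilon>: "0 < \<epsilon>"
  obtains h where "0 < h" "s + h \<in> {-1<..<1}" "s - h \<in> {-1<..<1}"
    "G (s + h) - G s < h * (g s + \<epsilon>)" "G (s - h) - G s < - h * (g s - \<epsilon>)"
proof -
  have "((\<lambda>h. (G (s + h) - G s) / h) \<longlongrightarrow> g s) (at 0)"
    using G_deriv[OF s] by (simp add: DERIV_def)
  then have "\<forall>\<^sub>F h in at 0. dist ((G (s + h) - G s) / h) (g s) < \<epsilon>"
    using \<epsilon> by (rule tendstoD)
  then obtain d where d: "0 < d" "\<And>h. h \<noteq> 0 \<Longrightarrow> \<bar>h\<bar> < d \<Longrightarrow> \<bar>(G (s + h) - G s) / h - g s\<bar> < \<epsilon>"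
    by (auto simp: eventually_at dist_real_def)
  define h where "h = min d (1 - \<bar>s\<bar>) / 2"
  have h: "0 < h" "h < d" "h < 1 - \<bar>s\<bar>" using d s by (auto simp: h_def)
  have "(G (s + h) - G s) / h < g s + \<epsilon>" using d(2)[of h] h by (simp add: abs_less_iff)
  then have 1: "G (s + h) - G s < h * (g s + \<epsilon>)" using h by (simp add: divide_less_eq mult.commute)
  have "(G (s - h) - G s) / h < - (g s - \<epsilon>)" using d(2)[of "- h"] h by (simp add: abs_less_iff)
  then have "G (s - h) - G s < - (g s - \<epsilon>) * h" using h(1) by (simp only: pos_divide_less_eq)
  then have 2: "G (s - h) - G s < - h * (g s - \<epsilon>)" by (simp add: algebra_simps)
  show ?thesis using that[OF h(1) _ _ 1 2] h s by auto
qed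

text \<open>Change of measure: the window keeps at least half of the tilted mass, and on it the
  density is at most exp (N n (s g s + \<epsilon>)), since s lies in (-1, 1). The second \<epsilon>
  comes from replacing ln (e s n) / N n by its limit.\<close>

lemma concentration:
  assumes s: "s \<in> {-1<..<1}" and \<epsilon>: "0 < \<epsilon>"
  shows "\<forall>\<^sub>F n in sequentially. exp (- (N n * (rate_fun s + 2 * \<epsilon>))) \<le> prob {\<omega>\<in>space Q. \<bar>X n \<omega> - g s\<bar> < \<epsilon>}"
proof -
  obtain h where h: "0 < h" "s + h \<in> {-1<..<1}" "s - h \<in> {-1<..<1}"
    "G (s + h) - G s < h * (g s + \<epsilon>)" "G (s - h) - G s < - h * (g s - \<epsilon>)"
    using slope_step[OF s \<epsilon>] by blast
  have h': "s + - h \<in> {-1<..<1}" "G (s + - h) - G s < - h * (g s - \<epsilon>)" using h by auto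
  have "(\<lambda>n. ln (e s n) / N n - ln 2 / N n) \<longlonglongrightarrow> G s - 0"
    by (intro tendsto_diff rate s tendsto_divide_0[OF tendsto_const] filterlim_at_top_imp_at_infinity N_lim)
  then have "\<forall>\<^sub>F n in sequentially. G s - \<epsilon> < ln (e s n) / N n - ln 2 / N n"
    using \<epsilon> by (intro order_tendstoD) auto
  then show ?thesis
    using tilted_tail_small[OF s h(2) h(4)] tilted_tail_small[OF s h'] eventually_ge_at_top[of 1]
  proof eventually_elim
    case (elim n)
    have n: "1 \<le> n" by fact
    note N = N_pos[OF n] and es = e_pos[OF s n]
    let ?f = "\<lambda>\<omega>. ennreal (exp (s * N n * X n \<omega>))"
    let ?A = "{\<omega>\<in>space Q. \<bar>X n \<omega> - g s\<bar> < \<epsilon>}"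
    let ?B = "{\<omega>\<in>space Q. h * (g s + \<epsilon>) \<le> h * X n \<omega>}"
    let ?C = "{\<omega>\<in>space Q. - h * (g s - \<epsilon>) \<le> - h * X n \<omega>}"
    have B: "(\<integral>\<^sup>+ \<omega>. ?f \<omega> * indicator ?B \<omega> \<partial>Q) \<le> ennreal (e s n / 4)"
      using tilted_tail[OF h(2) n, of "g s + \<epsilon>"] elim(2) by (meson ennreal_leI order_trans)
    have C: "(\<integral>\<^sup>+ \<omega>. ?f \<omega> * indicator ?C \<omega> \<partial>Q) \<le> ennreal (e s n / 4)"
      using tilted_tail[OF h'(1) n, of "g s - \<epsilon>"] elim(3) by (meson ennreal_leI order_trans)
    have A: "(\<integral>\<^sup>+ \<omega>. ?f \<omega> * indicator ?A \<omega> \<partial>Q) \<le> ennreal (exp (N n * (s * g s + \<epsilon>)) * prob ?A)"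
    proof -
      have "(\<integral>\<^sup>+ \<omega>. ?f \<omega> * indicator ?A \<omega> \<partial>Q)
          \<le> (\<integral>\<^sup>+ \<omega>. ennreal (exp (N n * (s * g s + \<epsilon>))) * indicator ?A \<omega> \<partial>Q)"
      proof (rule nn_integral_mono)
        fix \<omega>
        have "s * X n \<omega> \<le> s * g s + \<epsilon>" if "\<bar>X n \<omega> - g s\<bar> < \<epsilon>"
        proof -
          have "s * (X n \<omega> - g s) \<le> \<bar>s\<bar> * \<bar>X n \<omega> - g s\<bar>" by (metis abs_ge_self abs_mult)
          also have "\<dots> \<le> 1 * \<epsilon>" using s that by (intro mult_mono) auto
          finally show ?thesis by (simp add: algebra_simps)
        qed
        then have "N n * (s * X n \<omega>) \<le> N n * (s * g s + \<epsilon>)" if "\<bar>X n \<omega> - g s\<bar> < \<epsilon>"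
          using N that by (intro mult_left_mono) auto
        then show "?f \<omega> * indicator ?A \<omega> \<le> ennreal (exp (N n * (s * g s + \<epsilon>))) * indicator ?A \<omega>"
          by (auto simp: indicator_def mult_ac intro!: ennreal_leI)
      qed
      also have "\<dots> = ennreal (exp (N n * (s * g s + \<epsilon>))) * emeasure Q ?A"
        by (rule nn_integral_cmult_indicator) measurable
      finally show ?thesis by (simp add: emeasure_eq_measure ennreal_mult)
    qed
    have "ennreal (e s n) = (\<integral>\<^sup>+ \<omega>. ?f \<omega> \<partial>Q)" by (rule mgf[OF s n, symmetric])
    also have "\<dots> \<le> (\<integral>\<^sup>+ \<omega>. ?f \<omega> * indicator ?A \<omega> + (?f \<omega> * indicator ?B \<omega> + ?f \<omega> * indicator ?C \<omega>) \<partial>Q)"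
    proof (rule nn_integral_mono)
      fix \<omega> assume \<omega>: "\<omega> \<in> space Q"
      consider "\<bar>X n \<omega> - g s\<bar> < \<epsilon>" | "g s + \<epsilon> \<le> X n \<omega>" | "X n \<omega> \<le> g s - \<epsilon>" by linarith
      then show "?f \<omega> \<le> ?f \<omega> * indicator ?A \<omega> + (?f \<omega> * indicator ?B \<omega> + ?f \<omega> * indicator ?C \<omega>)"
      proof cases
        case 1
        then have "indicator ?A \<omega> = (1::ennreal)" using \<omega> by simp
        then show ?thesis by simp
      next
        case 2
        then have "indicator ?B \<omega> = (1::ennreal)" using \<omega> h(1) by simp
        then show ?thesis by (simp add: add_increasing)
      next
        case 3
        then have "indicator ?C \<omega> = (1::ennreal)" using \<omega> h(1) by simp
        then show ?thesis by (simp add: add_increasing)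
      qed
    qed
    also have "\<dots> = (\<integral>\<^sup>+ \<omega>. ?f \<omega> * indicator ?A \<omega> \<partial>Q)
        + ((\<integral>\<^sup>+ \<omega>. ?f \<omega> * indicator ?B \<omega> \<partial>Q) + (\<integral>\<^sup>+ \<omega>. ?f \<omega> * indicator ?C \<omega> \<partial>Q))"
    proof -
      have "(\<lambda>\<omega>. ?f \<omega> * indicator ?A \<omega>) \<in> borel_measurable Q"
        "(\<lambda>\<omega>. ?f \<omega> * indicator ?B \<omega>) \<in> borel_measurable Q"
        "(\<lambda>\<omega>. ?f \<omega> * indicator ?C \<omega>) \<in> borel_measurable Q" by measurable
      then show ?thesis by (simp only: nn_integral_add borel_measurable_add)
    qed
    also have "\<dots> \<le> ennreal (exp (N n * (s * g s + \<epsilon>)) * prob ?A) + (ennreal (e s n / 4) + ennreal (e s n / 4))"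
      by (intro add_mono A B C)
    also have "\<dots> = ennreal (exp (N n * (s * g s + \<epsilon>)) * prob ?A + e s n / 2)"
      using es by (simp add: ennreal_plus[symmetric] del: ennreal_plus)
    finally have "e s n / 2 \<le> exp (N n * (s * g s + \<epsilon>)) * prob ?A"
      using es by (subst (asm) ennreal_le_iff) auto
    then have "exp (- (N n * (s * g s + \<epsilon>))) * (e s n / 2)
        \<le> exp (- (N n * (s * g s + \<epsilon>))) * (exp (N n * (s * g s + \<epsilon>)) * prob ?A)"
      by (rule mult_left_mono) simp
    also have "\<dots> = prob ?A" by (simp add: mult.assoc[symmetric] exp_add[symmetric])
    finally have P: "exp (- (N n * (s * g s + \<epsilon>))) * (e s n / 2) \<le> prob ?A" .
    have "(G s - \<epsilon>) * N n < ln (e s n) - ln 2"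
      using elim(1) N by (simp add: less_divide_eq diff_divide_distrib[symmetric])
    then have "exp ((G s - \<epsilon>) * N n) \<le> exp (ln (e s n) - ln 2)" by simp
    also have "\<dots> = e s n / 2" using es by (simp add: exp_diff)
    finally have "exp (- (N n * (s * g s + \<epsilon>))) * exp ((G s - \<epsilon>) * N n) \<le> exp (- (N n * (s * g s + \<epsilon>))) * (e s n / 2)"
      by (intro mult_left_mono) auto
    moreover have "exp (- (N n * (s * g s + \<epsilon>))) * exp ((G s - \<epsilon>) * N n) = exp (- (N n * (rate_fun s + 2 * \<epsilon>)))"
      by (simp add: exp_add[symmetric] rate_fun_def algebra_simps)
    ultimately show ?case using P by linarith
  qed
qed

end

text \<open>J is enclosed in the half-line starting at its infimum, which is a slope g r by the
  intermediate value theorem. If the infimum is not in J, the slopes at parameters just above r are,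
  so the bound i passes to r by right continuity of h.\<close>

lemma interval_lower_point:
  fixes g h :: "real \<Rightarrow> real"
  assumes J: "is_interval J" "J \<subseteq> {g 0<..}"
    and g: "continuous_on {0..s} g" and h: "continuous_on {0..s} h"
    and mono: "\<And>u v. 0 \<le> u \<Longrightarrow> u < v \<Longrightarrow> v \<le> s \<Longrightarrow> g u < g v"
    and s: "0 < s" "g s \<in> J"
    and i: "\<And>u. 0 < u \<Longrightarrow> u \<le> s \<Longrightarrow> g u \<in> J \<Longrightarrow> i \<le> h u"
  obtains r where "0 \<le> r" "r \<le> s" "\<And>x. x \<in> J \<Longrightarrow> g r \<le> x" "i \<le> h r"
proof -
  define a where "a = Inf J"
  have bdd: "bdd_below J" using J(2) by (auto intro!: bdd_belowI[of _ "g 0"])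
  have a_le: "a \<le> x" if "x \<in> J" for x unfolding a_def using that bdd by (rule cInf_lower)
  have "g 0 \<le> a" unfolding a_def using J(2) s(2) by (intro cInf_greatest) auto
  then obtain r where r: "0 \<le> r" "r \<le> s" "g r = a"
    using IVT'[of g 0 a s] a_le[OF s(2)] s(1) g by auto
  have "i \<le> h r"
  proof (cases "r = s")
    case True
    then show ?thesis using i s by auto
  next
    case False
    then have rs: "r < s" using r by simp
    have "i \<le> h u" if u: "u \<in> {r<..<s}" for u
    proof -
      have "Inf J < g u" using mono[of r u] r u by (simp add: a_def)
      then obtain x where "x \<in> J" "x < g u" using s(2) bdd by (subst (asm) cInf_less_iff) auto
      moreover have "g u < g s" using mono[of u s] r u by simp
      ultimately have "g u \<in> J" using J(1) s(2) by (meson less_imp_le mem_is_interval_1_I)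
      then show ?thesis using i r u by simp
    qed
    moreover have "(h \<longlongrightarrow> h r) (at_right r)"
    proof -
      have "(h \<longlongrightarrow> h r) (at r within {0..s})" using h r by (auto simp: continuous_on_def)
      then have "(h \<longlongrightarrow> h r) (at r within {r..s})" using r by (rule_tac tendsto_within_subset) auto
      then show ?thesis using rs by (simp add: at_within_Icc_at_right)
    qed
    ultimately show ?thesis
      using rs by (intro tendsto_lowerbound[of h "h r" "at_right r" i])
        (auto simp: eventually_at_right intro!: exI[of _ s])
  qed
  then show ?thesis using that r a_le by metis
qed

context local_ldp
begin

text \<open>An interval that misses g 0 lies on one side of it, so a single t describes a half-line
  around J to which the Chernoff bound applies. The side below g 0 is reduced to the other one by
  reflection at the origin.\<close>

lemma upper_point:
  assumes J: "is_interval J" and g0: "g 0 \<notin> J" and s: "s \<in> {-1<..<1}" "g s \<in> J"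
    and i: "\<And>u. u \<in> {-1<..<1} \<Longrightarrow> g u \<in> J \<Longrightarrow> i \<le> rate_fun u"
  obtains t where "t \<in> {-1<..<1}" "\<And>x. x \<in> J \<Longrightarrow> t * g t \<le> t * x" "i \<le> rate_fun t"
proof -
  consider "0 < s" | "s < 0" using s g0 by (metis linorder_neqE_linordered_idom)
  then show ?thesis
  proof cases
    case 1
    have sub: "{0..s} \<subseteq> {-1<..<1}" using s by auto
    have "J \<subseteq> {g 0<..}"
    proof
      fix x assume x: "x \<in> J"
      have "g 0 < g s" using g_mono[of 0 s] s 1 by simp
      then show "x \<in> {g 0<..}" using J x s(2) g0 by (metis greaterThan_iff less_imp_le mem_is_interval_1_I not_le)
    qed
    moreover have "g u < g v" if "0 \<le> u" "u < v" "v \<le> s" for u v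
      using g_mono[of u v] that s by auto
    moreover have "i \<le> rate_fun u" if "0 < u" "u \<le> s" "g u \<in> J" for u
      using i[of u] that s by auto
    ultimately obtain r where r: "0 \<le> r" "r \<le> s" "\<And>x. x \<in> J \<Longrightarrow> g r \<le> x" "i \<le> rate_fun r"
      using interval_lower_point[OF J _ continuous_on_subset[OF g_cont sub]
          continuous_on_subset[OF rate_fun_cont sub] _ 1 s(2), of i] by blast
    have "r * g r \<le> r * x" if "x \<in> J" for x using r(1) r(3)[OF that] by (rule mult_left_mono[rotated])
    then show ?thesis using that[of r] r s by auto
  next
    case 2
    have sub: "uminus ` {0..- s} \<subseteq> {-1<..<1}" using s by auto
    have cont: "continuous_on {0..- s} (\<lambda>u. f (- u))" if "continuous_on {-1<..<1} f" for f :: "real \<Rightarrow> real"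
      by (rule continuous_on_compose2[OF that _ sub]) (intro continuous_intros)
    have "uminus ` J \<subseteq> {- g (- 0)<..}"
    proof
      fix x assume "x \<in> uminus ` J"
      then have x: "- x \<in> J" by auto
      have "g s < g 0" using g_mono[of s 0] s 2 by simp
      then show "x \<in> {- g (- 0)<..}" using J x s(2) g0
        by (metis greaterThan_iff less_imp_le mem_is_interval_1_I minus_less_iff neg_equal_0_iff_equal not_le)
    qed
    moreover have "is_interval (uminus ` J)" using J by (simp add: is_interval_neg_translationI)
    moreover have "- g (- u) < - g (- v)" if "0 \<le> u" "u < v" "v \<le> - s" for u v
      using g_mono[of "- v" "- u"] that s by auto
    moreover have "i \<le> rate_fun (- u)" if "0 < u" "u \<le> - s" "- g (- u) \<in> uminus ` J" for u
      using i[of "- u"] that s by auto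
    moreover have "0 < - s" "- g (- (- s)) \<in> uminus ` J" using 2 s by auto
    ultimately obtain r where r: "0 \<le> r" "r \<le> - s" "\<And>x. x \<in> uminus ` J \<Longrightarrow> - g (- r) \<le> x" "i \<le> rate_fun (- r)"
      using interval_lower_point[of "uminus ` J" "\<lambda>u. - g (- u)" "- s" "\<lambda>u. rate_fun (- u)" i,
          OF _ _ continuous_on_minus[OF cont[OF g_cont]] cont[OF rate_fun_cont]] by blast
    have "- r * g (- r) \<le> - r * x" if "x \<in> J" for x
    proof -
      have "- g (- r) \<le> - x" using r(3)[of "- x"] that by simp
      then show ?thesis using mult_left_mono[of "- g (- r)" "- x" r] r(1) by simp
    qed
    then show ?thesis using that[of "- r"] r s by auto
  qed
qed

text \<open>Concentration needs a whole window inside J. A slope at an endpoint of J is moved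
  slightly towards an interior point y; continuity of the rate function makes this cheap.\<close>

lemma interior_point:
  assumes J: "is_interval J" "interior J \<noteq> {}" and s: "s \<in> {-1<..<1}" "g s \<in> J" and \<eta>: "0 < \<eta>"
  obtains u where "u \<in> {-1<..<1}" "g u \<in> interior J" "rate_fun u < rate_fun s + \<eta>"
proof -
  obtain y where y: "y \<in> interior J" using J by blast
  then have yJ: "y \<in> J" using interior_subset by blast
  have isCont: "isCont g s" "isCont rate_fun s"
    using g_cont rate_fun_cont s by (auto simp: continuous_on_eq_continuous_at)
  have ev: "\<forall>\<^sub>F u in at s. rate_fun u < rate_fun s + \<eta>"
    using isCont(2) \<eta> by (intro order_tendstoD(2)[of _ "rate_fun s"]) (auto simp: isCont_def)
  consider "y = g s" | "g s < y" | "y < g s" by linarith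
  then show ?thesis
  proof cases
    case 1
    then show ?thesis using that[of s] s y \<eta> by simp
  next
    case 2
    have "\<forall>\<^sub>F u in at s. g u < y" using isCont(1) 2 by (intro order_tendstoD(2)[of _ "g s"]) (auto simp: isCont_def)
    with ev have "\<forall>\<^sub>F u in at_right s. rate_fun u < rate_fun s + \<eta> \<and> g u < y"
      by (auto simp: eventually_at_split eventually_conj)
    moreover have "\<forall>\<^sub>F u in at_right s. s < u \<and> u < 1"
      using s by (auto simp: eventually_at_right intro!: exI[of _ 1])
    ultimately have "\<forall>\<^sub>F u in at_right s. (rate_fun u < rate_fun s + \<eta> \<and> g u < y) \<and> (s < u \<and> u < 1)"
      by (rule eventually_conj)
    then obtain u where u: "rate_fun u < rate_fun s + \<eta>" "g u < y" "s < u" "u < 1"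
      using eventually_happens' trivial_limit_at_right_real by blast
    have "{g s<..<y} \<subseteq> J"
      using mem_is_interval_1_I[OF J(1) s(2) yJ] by auto
    then have "{g s<..<y} \<subseteq> interior J" by (intro interior_maximal) auto
    then show ?thesis using that[of u] u s g_mono[of s u] by auto
  next
    case 3
    have "\<forall>\<^sub>F u in at s. y < g u" using isCont(1) 3 by (intro order_tendstoD(1)[of _ "g s"]) (auto simp: isCont_def)
    with ev have "\<forall>\<^sub>F u in at_left s. rate_fun u < rate_fun s + \<eta> \<and> y < g u"
      by (auto simp: eventually_at_split eventually_conj)
    moreover have "\<forall>\<^sub>F u in at_left s. -1 < u \<and> u < s"
      using s by (auto simp: eventually_at_left intro!: exI[of _ "-1"])
    ultimately have "\<forall>\<^sub>F u in at_left s. (rate_fun u < rate_fun s + \<eta> \<and> y < g u) \<and> (-1 < u \<and> u < s)"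
      by (rule eventually_conj)
    then obtain u where u: "rate_fun u < rate_fun s + \<eta>" "y < g u" "-1 < u" "u < s"
      using eventually_happens' trivial_limit_at_left_real by blast
    have "{y<..<g s} \<subseteq> J"
      using mem_is_interval_1_I[OF J(1) yJ s(2)] by auto
    then have "{y<..<g s} \<subseteq> interior J" by (intro interior_maximal) auto
    then show ?thesis using that[of u] u s g_mono[of u s] by auto
  qed
qed

text \<open>The two conditions say that i is the infimum of the rates over slopes in J.
  Concentration near an almost optimal interior slope gives the lower bound, Chernoff at the
  parameter from \<open>upper_point\<close> the upper one.\<close>

theorem ldp_interval:
  assumes J: "is_interval J" "interior J \<noteq> {}"
    and i: "\<And>u. u \<in> {-1<..<1} \<Longrightarrow> g u \<in> J \<Longrightarrow> i \<le> rate_fun u"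
    and i': "\<And>\<eta>. 0 < \<eta> \<Longrightarrow> \<exists>u\<in>{-1<..<1}. g u \<in> J \<and> rate_fun u < i + \<eta>"
  shows "\<forall>\<^sub>F n in sequentially. 0 < prob {\<omega>\<in>space Q. X n \<omega> \<in> J}"
    and "(\<lambda>n. ln (prob {\<omega>\<in>space Q. X n \<omega> \<in> J}) / N n) \<longlonglongrightarrow> - i"
proof -
  have J_borel [measurable]: "J \<in> sets borel" using J(1) by (rule real_interval_borel_measurable)
  let ?P = "\<lambda>n. prob {\<omega>\<in>space Q. X n \<omega> \<in> J}"
  have lower: "\<forall>\<^sub>F n in sequentially. exp (- (N n * (i + \<eta>))) \<le> ?P n" if \<eta>: "0 < \<eta>" for \<eta>
  proof -
    obtain s where s: "s \<in> {-1<..<1}" "g s \<in> J" "rate_fun s < i + \<eta> / 4" using i'[of "\<eta> / 4"] \<eta> by auto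
    obtain u where u: "u \<in> {-1<..<1}" "g u \<in> interior J" "rate_fun u < rate_fun s + \<eta> / 4"
      using interior_point[OF J s(1,2), of "\<eta> / 4"] \<eta> by auto
    obtain \<epsilon>' where \<epsilon>': "0 < \<epsilon>'" "ball (g u) \<epsilon>' \<subseteq> J" using u(2) by (auto simp: mem_interior)
    \<comment> \<open>The budget \<eta> splits into a quarter for choosing s, a quarter for moving
      to u and a half for the loss 2 \<epsilon> in \<open>concentration\<close>.\<close>
    define \<epsilon> where "\<epsilon> = min \<epsilon>' (\<eta> / 4)"
    have \<epsilon>: "0 < \<epsilon>" "\<epsilon> \<le> \<eta> / 4" "\<epsilon> \<le> \<epsilon>'" using \<epsilon>' \<eta> by (auto simp: \<epsilon>_def)
    show ?thesis
      using concentration[OF u(1) \<epsilon>(1)] eventually_ge_at_top[of 1]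
    proof eventually_elim
      case (elim n)
      have "N n * (rate_fun u + 2 * \<epsilon>) \<le> N n * (i + \<eta>)"
        using N_pos[OF elim(2)] s(3) u(3) \<epsilon> by (intro mult_left_mono) auto
      then have "exp (- (N n * (i + \<eta>))) \<le> exp (- (N n * (rate_fun u + 2 * \<epsilon>)))" by simp
      also have "\<dots> \<le> prob {\<omega>\<in>space Q. \<bar>X n \<omega> - g u\<bar> < \<epsilon>}" by (rule elim(1))
      also have "\<dots> \<le> ?P n"
      proof (rule finite_measure_mono)
        have "x \<in> J" if "\<bar>x - g u\<bar> < \<epsilon>" for x
          using that \<epsilon>(3) \<epsilon>'(2) by (auto simp: subset_iff dist_real_def abs_minus_commute)
        then show "{\<omega>\<in>space Q. \<bar>X n \<omega> - g u\<bar> < \<epsilon>} \<subseteq> {\<omega>\<in>space Q. X n \<omega> \<in> J}" by auto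
      qed measurable
      finally show ?case .
    qed
  qed
  show pos: "\<forall>\<^sub>F n in sequentially. 0 < ?P n"
    using lower[OF zero_less_one] by eventually_elim (auto intro: less_le_trans[OF exp_gt_zero])
  have upper: "\<forall>\<^sub>F n in sequentially. ln (?P n) / N n < - i + \<eta>" if \<eta>: "0 < \<eta>" for \<eta>
  \<comment> \<open>Probabilities are at most 1, which settles this case. For i > 0 the slope g 0,
    whose rate is 0, must lie outside J.\<close>
  proof (cases "i \<le> 0")
    case True
    show ?thesis
      using pos eventually_ge_at_top[of 1]
    proof eventually_elim
      case (elim n)
      have "ln (?P n) / N n \<le> 0" using elim N_pos[OF elim(2)] by (simp add: divide_nonpos_pos)
      then show ?case using True \<eta> by linarith
    qed
  next
    case False
    have "g 0 \<notin> J" using i[of 0] False G_0 by (auto simp: rate_fun_def)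
    moreover obtain s where "s \<in> {-1<..<1}" "g s \<in> J" using i'[of 1] by auto
    ultimately obtain t where t: "t \<in> {-1<..<1}" "\<And>x. x \<in> J \<Longrightarrow> t * g t \<le> t * x" "i \<le> rate_fun t"
      using upper_point[OF J(1) _ _ _ i] by blast
    have "\<forall>\<^sub>F n in sequentially. ln (e t n) / N n < G t + \<eta>"
      using rate[OF t(1)] \<eta> by (intro order_tendstoD) auto
    then show ?thesis
      using pos eventually_ge_at_top[of 1]
    proof eventually_elim
      case (elim n)
      note N = N_pos[OF elim(3)] and et = e_pos[OF t(1) elim(3)]
      have "?P n \<le> prob {\<omega>\<in>space Q. t * g t \<le> t * X n \<omega>}"
        by (rule finite_measure_mono) (use t(2) in auto)
      also have "\<dots> \<le> exp (- t * N n * g t) * e t n" by (rule chernoff[OF t(1) elim(3)])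
      finally have "ln (?P n) \<le> ln (exp (- t * N n * g t) * e t n)"
        using elim(2) et by (subst ln_le_cancel_iff) auto
      also have "\<dots> = - (t * g t) * N n + ln (e t n)" using et by (simp add: ln_mult)
      finally have "ln (?P n) / N n \<le> (- (t * g t) * N n + ln (e t n)) / N n"
        using N by (intro divide_right_mono) auto
      also have "\<dots> = - (t * g t) + ln (e t n) / N n" using N by (simp add: add_divide_distrib diff_divide_distrib)
      also have "\<dots> < - rate_fun t + \<eta>" using elim(1) by (simp add: rate_fun_def)
      finally show ?case using t(3) by linarith
    qed
  qed
  show "(\<lambda>n. ln (?P n) / N n) \<longlonglongrightarrow> - i"
  proof (rule order_tendstoI)
    fix a assume a: "a < - i"
    define \<eta> where "\<eta> = (- i - a) / 2"
    have \<eta>: "0 < \<eta>" using a by (simp add: \<eta>_def)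
    show "\<forall>\<^sub>F n in sequentially. a < ln (?P n) / N n"
      using lower[OF \<eta>] pos eventually_ge_at_top[of 1]
    proof eventually_elim
      case (elim n)
      note N = N_pos[OF elim(3)]
      have "ln (exp (- (N n * (i + \<eta>)))) \<le> ln (?P n)" using elim by (subst ln_le_cancel_iff) auto
      then have "- (i + \<eta>) \<le> ln (?P n) / N n" using N by (simp add: le_divide_eq algebra_simps)
      moreover have "a < - (i + \<eta>)" using a by (simp add: \<eta>_def field_simps)
      ultimately show ?case by linarith
    qed
  next
    fix a assume "- i < a"
    then show "\<forall>\<^sub>F n in sequentially. ln (?P n) / N n < a" using upper[of "a + i"] by simp
  qed
qed

end

subsection \<open>The discretized chains\<close>

text \<open>Apply the finite-dimensional distributions at the times i \<delta>, whose gaps are all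
  \<delta>.\<close>

lemma discretized_stationary_chain:
  fixes p :: "'a::finite \<Rightarrow> 'a pmf"
  assumes irr: "irreducible_chain p" and c: "\<And>x. 0 < c x"
    and st: "stationary_dist (generator c p) \<mu>" and M: "markov_realization (generator c p) \<mu> M X"
    and \<delta>: "0 < \<delta>"
  shows "stationary_chain (transition_prob (generator c p) \<delta>) (pmf \<mu>) (discretized_law \<delta> M X)"
proof (rule stationary_chain.intro)
  let ?P = "transition_prob (generator c p) \<delta>" and ?D = "discretized_law \<delta> M X"
  let ?S = "\<Pi>\<^sub>M i\<in>(UNIV::nat set). count_space (UNIV::'a set)"
  interpret M: prob_space M using M by (simp add: markov_realization_def)
  have fdd: "\<forall>n (t::nat \<Rightarrow> real) x. t 0 = 0 \<longrightarrow> (\<forall>i<n. t i \<le> t (Suc i)) \<longrightarrow>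
        measure M {w \<in> space M. \<forall>i\<le>n. X (t i) w = x i} =
          pmf \<mu> (x 0) * (\<Prod>i<n. transition_prob (generator c p) (t (Suc i) - t i) (x i) (x (Suc i)))"
    using M unfolding markov_realization_def by (elim conjE)
  have X: "X t \<in> measurable M (count_space UNIV)" if "0 \<le> t" for t
    using M that by (simp add: markov_realization_def)
  have path: "(\<lambda>w i. X (real i * \<delta>) w) \<in> measurable M ?S"
    using \<delta> by (intro measurable_PiM_single' X) (auto simp: PiE_def)
  show "0 < ?P x y" for x y by (rule transition_prob_pos[OF irr c \<delta>])
  show "(\<Sum>y\<in>UNIV. ?P x y) = 1" for x by (rule transition_prob_stochastic)
  show "0 < pmf \<mu> x" for x by (rule stationary_pos[OF irr c st])
  show "(\<Sum>x\<in>UNIV. pmf \<mu> x) = 1" by (rule sum_pmf_finite)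
  show "(\<Sum>x\<in>UNIV. pmf \<mu> x * ?P x y) = pmf \<mu> y" for y by (rule stationary_invariant[OF st])
  show "prob_space ?D" unfolding discretized_law_def by (rule M.prob_space_distr[OF path])
  show "sets ?D = sets (\<Pi>\<^sub>M i\<in>UNIV. count_space UNIV)" by (simp add: discretized_law_def)
  fix n and x :: "nat \<Rightarrow> 'a"
  have "{\<omega>\<in>space ?S. \<forall>i\<le>n. \<omega> i = x i} \<in> sets ?S" by measurable
  then have "{\<omega>. \<forall>i\<le>n. \<omega> i = x i} \<in> sets ?S" by (simp add: space_PiM)
  then have "measure ?D {\<omega>. \<forall>i\<le>n. \<omega> i = x i}
      = measure M ((\<lambda>w i. X (real i * \<delta>) w) -` {\<omega>. \<forall>i\<le>n. \<omega> i = x i} \<inter> space M)"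
    unfolding discretized_law_def by (rule measure_distr[OF path])
  also have "(\<lambda>w i. X (real i * \<delta>) w) -` {\<omega>. \<forall>i\<le>n. \<omega> i = x i} \<inter> space M
      = {w\<in>space M. \<forall>i\<le>n. X ((\<lambda>i. real i * \<delta>) i) w = x i}" by auto
  also have "measure M \<dots> = pmf \<mu> (x 0) *
      (\<Prod>i<n. transition_prob (generator c p) ((\<lambda>i. real i * \<delta>) (Suc i) - (\<lambda>i. real i * \<delta>) i) (x i) (x (Suc i)))"
  proof -
    have "(\<lambda>i. real i * \<delta>) 0 = 0 \<and> (\<forall>i<n. (\<lambda>i. real i * \<delta>) i \<le> (\<lambda>i. real i * \<delta>) (Suc i))"
      using \<delta> by (auto intro: mult_right_mono)
    then show ?thesis using fdd[rule_format, of "\<lambda>i. real i * \<delta>" n x] by blast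
  qed
  also have "\<dots> = pmf \<mu> (x 0) * (\<Prod>i<n. ?P (x i) (x (Suc i)))"
    by (simp add: algebra_simps)
  finally show "measure ?D {\<omega>. \<forall>i\<le>n. \<omega> i = x i} = pmf \<mu> (x 0) * (\<Prod>i<n. ?P (x i) (x (Suc i)))" .
qed

text \<open>The eigenvector of the larger kernel is a test function for the smaller one.\<close>

lemma perron_root_mono:
  fixes K K' :: "'a::finite \<Rightarrow> 'a \<Rightarrow> real"
  assumes K: "\<And>x y. 0 < K x y" and le: "\<And>x y. K x y \<le> K' x y"
  shows "perron_root K \<le> perron_root K'"
proof -
  have K': "0 < K' x y" for x y using K le less_le_trans by blast
  obtain v where v: "\<And>x. 0 < v x" "\<And>x. transfer K' v x = perron_root K' * v x"
    using perron_vector[of K'] K' by blast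
  show ?thesis
  proof (rule perron_root_le[OF K v(1)])
    fix x
    have "transfer K v x \<le> transfer K' v x"
      unfolding transfer_def using le v(1) by (intro sum_mono mult_right_mono) (auto simp: less_imp_le)
    then show "transfer K v x \<le> perron_root K' * v x" using v(2) by simp
  qed
qed

lemma convex_on_eq_on:
  assumes f: "convex_on S f" and eq: "\<And>x. x \<in> S \<Longrightarrow> g x = f x"
  shows "convex_on S g"
  unfolding convex_on_def
proof (intro conjI ballI allI impI)
  show S: "convex S" using f by (simp add: convex_on_def)
  fix x y u v assume xy: "x \<in> S" "y \<in> S" and uv: "0 \<le> u" "0 \<le> v" "u + v = (1::real)"
  have "u *\<^sub>R x + v *\<^sub>R y \<in> S" using S xy uv by (simp add: convexD)
  moreover have "f (u *\<^sub>R x + v *\<^sub>R y) \<le> u * f x + v * f y"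
    using f xy uv by (simp add: convex_on_def)
  ultimately show "g (u *\<^sub>R x + v *\<^sub>R y) \<le> u * g x + v * g y" using eq xy by simp
qed

lemma ereal_image_borel:
  assumes "J \<in> sets borel"
  shows "ereal ` J \<in> sets borel"
proof -
  have "real_of_ereal \<in> borel_measurable (borel :: ereal measure)" by measurable
  from measurable_sets[OF this assms]
  have "{- \<infinity><..<\<infinity>} \<inter> (real_of_ereal -` J \<inter> space borel) \<in> sets (borel :: ereal measure)"
    by (rule sets.Int[OF borel_open[OF open_greaterThanLessThan]])
  also have "{- \<infinity><..<\<infinity>} \<inter> (real_of_ereal -` J \<inter> space borel) = ereal ` J"
  proof (intro set_eqI iffI)
    fix x assume "x \<in> {- \<infinity><..<\<infinity>} \<inter> (real_of_ereal -` J \<inter> space borel)"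
    then show "x \<in> ereal ` J" by (cases x) auto
  qed auto
  finally show ?thesis .
qed

lemma ln_ennreal_pos: "0 < r \<Longrightarrow> ln_ennreal (ennreal r) = ereal (ln r)"
  by (simp add: ln_ennreal_def)

lemma ln_ennreal_measurable [measurable]: "ln_ennreal \<in> borel_measurable borel"
  unfolding ln_ennreal_def[abs_def] by measurable

lemma real_analytic_on_scaled_cong:
  assumes f: "real_analytic_on f UNIV" and S: "open S" and h: "\<And>x. x \<in> S \<Longrightarrow> h x = f x / q"
  shows "real_analytic_on h S"
  unfolding real_analytic_on_def
proof
  fix x assume x: "x \<in> S"
  obtain r a where r: "0 < r" "\<And>y. \<bar>y - x\<bar> < r \<Longrightarrow> (\<lambda>n. a n * (y - x) ^ n) sums f y"
    using f unfolding real_analytic_on_def by blast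
  obtain d where d: "0 < d" "ball x d \<subseteq> S" using S x open_contains_ball by blast
  show "\<exists>r>0. \<exists>a. \<forall>y. \<bar>y - x\<bar> < r \<longrightarrow> (\<lambda>n. a n * (y - x) ^ n) sums h y"
  proof (intro exI[of _ "min r d"] conjI exI[of _ "\<lambda>n. a n / q"] allI impI)
    fix y assume y: "\<bar>y - x\<bar> < min r d"
    have "y \<in> S" using y d(2) by (auto simp: subset_iff dist_real_def abs_minus_commute)
    moreover have "(\<lambda>n. a n * (y - x) ^ n / q) sums (f y / q)" using y by (intro sums_divide r(2)) auto
    ultimately show "(\<lambda>n. a n / q * (y - x) ^ n) sums h y" by (simp add: h)
  qed (use r d in auto)
qed

section \<open>The limiting log-moment, its Legendre transform and the large deviations of the
  ratio\<close>

context two_chains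
begin

abbreviation log_ratio :: "'a \<Rightarrow> 'a \<Rightarrow> real" where
  "log_ratio \<equiv> \<lambda>x y. ln (P x y / P' x y)"

lemma tilted_eq_joint_kernel: "tilted P log_ratio s = joint_kernel (1 + s) (- s)"
proof (intro ext)
  fix x y
  have pos: "0 < P x y" "0 < P' x y" by (rule X.P_pos, rule Y.P_pos)
  have "joint_kernel (1 + s) (- s) x y = exp (ln (P x y)) * exp (s * ln (P x y)) * exp (- s * ln (P' x y))"
    using pos by (simp add: joint_kernel_def powr_def distrib_right exp_add)
  also have "\<dots> = P x y * exp (s * ln (P x y) + - s * ln (P' x y))"
    unfolding exp_add exp_ln[OF pos(1)] by (simp only: mult.assoc)
  also have "\<dots> = tilted P log_ratio s x y"
    using pos by (simp add: tilted_def ln_div algebra_simps)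
  finally show "tilted P log_ratio s x y = joint_kernel (1 + s) (- s) x y" by simp
qed

text \<open>Transition probabilities are at most 1, and truncation can only lower the exponents, so
  it can only raise the entries. Hence parameters outside [-1, 1] do not increase the Legendre
  supremum at the slopes considered.\<close>

lemma pressure_le_joint:
  "pressure P log_ratio s \<le> ln (perron_root (joint_kernel (1 + min s 1) (- max s (- 1))))"
proof -
  have P1: "P x y \<le> 1" for x y
    using member_le_sum[of y UNIV "P x"] X.P_pos X.P_sum[of x] by (auto simp: less_imp_le)
  have P'1: "P' x y \<le> 1" for x y
    using member_le_sum[of y UNIV "P' x"] Y.P_pos Y.P_sum[of x] by (auto simp: less_imp_le)
  have "perron_root (joint_kernel (1 + s) (- s)) \<le> perron_root (joint_kernel (1 + min s 1) (- max s (- 1)))"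
  proof (rule perron_root_mono[OF joint_kernel_pos])
    fix x y
    show "joint_kernel (1 + s) (- s) x y \<le> joint_kernel (1 + min s 1) (- max s (- 1)) x y"
      unfolding joint_kernel_def
      using X.P_pos[of x y] Y.P_pos[of x y] P1[of x y] P'1[of x y]
      by (intro mult_mono powr_mono') auto
  qed
  then show ?thesis
    unfolding pressure_def tilted_eq_joint_kernel
    using perron_root_pos[OF joint_kernel_pos] by (subst ln_le_cancel_iff) auto
qed

lemma pressure_eq_joint:
  assumes "s \<in> {-1..1}"
  shows "pressure P log_ratio s = ln (perron_root (joint_kernel (1 + min s 1) (- max s (- 1))))"
  using assms unfolding pressure_def tilted_eq_joint_kernel by simp

lemma scaled_log_moment_limit:
  assumes \<delta>: "0 < \<delta>"
  shows "(\<lambda>n. scaled_log_moment Q \<delta> n s) \<longlonglongrightarrow>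
    ereal (ln (perron_root (joint_kernel (1 + min s 1) (- max s (- 1)))) / \<delta>)" (is "_ \<longlonglongrightarrow> ereal (?L / \<delta>)")
proof -
  obtain e :: "nat \<Rightarrow> real" where e: "\<And>n. 1 \<le> n \<Longrightarrow> 0 < e n"
    "\<And>n. 1 \<le> n \<Longrightarrow> (\<integral>\<^sup>+ \<omega>. powr_ennreal (waiting_ratio n \<omega>) s \<partial>Q) = ennreal (e n)"
    "(\<lambda>n. ln (e n) / real n) \<longlonglongrightarrow> ?L"
    using ratio_moment_rate[of s] by blast
  have "(\<lambda>n. ereal (ln (e n) / real n / \<delta>)) \<longlonglongrightarrow> ereal (?L / \<delta>)"
    using e(3) \<delta> by (intro tendsto_intros) auto
  moreover have "\<forall>\<^sub>F n in sequentially. ereal (ln (e n) / real n / \<delta>) = scaled_log_moment Q \<delta> n s"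
    using eventually_ge_at_top[of 1]
  proof eventually_elim
    case (elim n)
    then show ?case
      using e(1)[of n] by (simp add: scaled_log_moment_def e(2) ln_ennreal_def)
  qed
  ultimately show ?thesis by (rule Lim_transform_eventually)
qed

lemma limit_log_moment_eq:
  "0 < \<delta> \<Longrightarrow> limit_log_moment Q \<delta> s = ereal (ln (perron_root (joint_kernel (1 + min s 1) (- max s (- 1)))) / \<delta>)"
  unfolding limit_log_moment_def by (intro limI scaled_log_moment_limit)

text \<open>A finite moment of order 1 excludes the value \<infinity> and one of order -1 the value
  0.\<close>

lemma waiting_ratio_pos_finite:
  assumes n: "1 \<le> n"
  shows "AE \<omega> in Q. waiting_ratio n \<omega> \<noteq> 0 \<and> waiting_ratio n \<omega> \<noteq> \<infinity>"
proof -
  have "AE \<omega> in Q. powr_ennreal (waiting_ratio n \<omega>) q \<noteq> \<infinity>" for q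
  proof (rule nn_integral_PInf_AE)
    show "(\<lambda>\<omega>. powr_ennreal (waiting_ratio n \<omega>) q) \<in> borel_measurable Q"
      by (rule measurable_compose[OF waiting_ratio_measurable powr_ennreal_measurable])
    show "(\<integral>\<^sup>+ \<omega>. powr_ennreal (waiting_ratio n \<omega>) q \<partial>Q) \<noteq> \<infinity>"
      by (rule ratio_moment_rate[of q]) (use n in simp)
  qed
  from this[of 1] this[of "- 1"] show ?thesis
    by eventually_elim (auto simp: powr_ennreal_def)
qed

lemma pressure_strict:
  assumes ne: "P \<noteq> P'" and "s < r"
  shows "deriv (pressure P log_ratio) s < deriv (pressure P log_ratio) r"
proof -
  let ?p = "pressure P log_ratio"
  have "deriv ?p s \<noteq> deriv ?p r"
  proof
    assume eq: "deriv ?p s = deriv ?p r"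
    have aff: "?p u = ?p s + deriv ?p s * (u - s)" for u
      by (rule pressure_affine[OF X.P_pos \<open>s < r\<close> eq])
    have "?p 0 = 0" by (rule pressure_at_0[OF X.P_pos X.P_sum])
    moreover have "?p (- 1) = 0" by (rule pressure_at_minus_1[OF X.P_pos Y.P_pos Y.P_sum])
    ultimately have "deriv ?p s = 0" "?p s = 0" using aff[of 0] aff[of "- 1"] by (auto simp: algebra_simps)
    then have "?p u = 0" for u using aff[of u] by simp
    then have "P = P'" by (rule pressure_zero_imp_eq[OF X.P_pos X.P_sum Y.P_pos Y.P_sum])
    then show False using ne by blast
  qed
  moreover have "deriv ?p s \<le> deriv ?p r" by (rule pressure_deriv_mono[OF X.P_pos]) (use \<open>s < r\<close> in simp)
  ultimately show ?thesis by simp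
qed

text \<open>The mean value theorem between the zeros -1 and 0 gives a zero slope in between; strict
  monotonicity does the rest.\<close>

lemma pressure_deriv_sign:
  assumes ne: "P \<noteq> P'"
  shows "deriv (pressure P log_ratio) (- 1) < 0" "0 < deriv (pressure P log_ratio) 1"
proof -
  let ?p = "pressure P log_ratio"
  have der: "(?p has_real_derivative deriv ?p s) (at s)" for s by (rule pressure_deriv(1)[OF X.P_pos])
  have "?p 0 = 0" by (rule pressure_at_0[OF X.P_pos X.P_sum])
  moreover have "?p (- 1) = 0" by (rule pressure_at_minus_1[OF X.P_pos Y.P_pos Y.P_sum])
  moreover obtain z where z: "- 1 < z" "z < 0" "?p 0 - ?p (- 1) = (0 - (- 1)) * deriv ?p z"
    using MVT2[of "- 1" 0 ?p "deriv ?p"] der by auto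
  ultimately have "deriv ?p z = 0" by simp
  then show "deriv ?p (- 1) < 0" "0 < deriv ?p 1"
    using pressure_strict[OF ne, of "- 1" z] pressure_strict[OF ne, of z 1] z by auto
qed

text \<open>The tangent to the pressure at s lies below the pressure, which lies below the moment
  limit on the whole line; all three agree at s, so the supremum is attained there.\<close>

lemma legendre_at_slope:
  assumes \<delta>: "0 < \<delta>" and s: "s \<in> {-1<..<1}"
  shows "legendre_transform (limit_log_moment Q \<delta>) (deriv (pressure P log_ratio) s / \<delta>)
    = ereal (s * (deriv (pressure P log_ratio) s / \<delta>) - pressure P log_ratio s / \<delta>)"
proof -
  let ?p = "pressure P log_ratio"
  let ?q = "deriv ?p s / \<delta>"
  show ?thesis
    unfolding legendre_transform_def
  proof (rule antisym)
    show "(SUP r. ereal (r * ?q) - limit_log_moment Q \<delta> r) \<le> ereal (s * ?q - ?p s / \<delta>)"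
    proof (rule SUP_least)
      fix r
      have "?p s + deriv ?p s * (r - s) \<le> ln (perron_root (joint_kernel (1 + min r 1) (- max r (- 1))))"
        using pressure_tangent[where A = P and b = log_ratio and s = s and r = r, OF X.P_pos] pressure_le_joint[of r] by linarith
      then have A: "(?p s + deriv ?p s * (r - s)) / \<delta> \<le> ln (perron_root (joint_kernel (1 + min r 1) (- max r (- 1)))) / \<delta>"
        using \<delta> by (intro divide_right_mono) auto
      have B: "r * ?q - (?p s + deriv ?p s * (r - s)) / \<delta> = s * ?q - ?p s / \<delta>"
        using \<delta> by (simp add: field_simps)
      have "r * ?q - ln (perron_root (joint_kernel (1 + min r 1) (- max r (- 1)))) / \<delta> \<le> s * ?q - ?p s / \<delta>"
        using diff_left_mono[OF A, of "r * ?q"] unfolding B .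
      then show "ereal (r * ?q) - limit_log_moment Q \<delta> r \<le> ereal (s * ?q - ?p s / \<delta>)"
        by (simp add: limit_log_moment_eq[OF \<delta>])
    qed
    show "ereal (s * ?q - ?p s / \<delta>) \<le> (SUP r. ereal (r * ?q) - limit_log_moment Q \<delta> r)"
      using s by (intro SUP_upper2[of s]) (auto simp: limit_log_moment_eq[OF \<delta>] pressure_eq_joint)
  qed
qed

lemma waiting_ratio_local_ldp:
  assumes \<delta>: "0 < \<delta>" and ne: "P \<noteq> P'"
  obtains e where "local_ldp Q (\<lambda>n \<omega>. ln (enn2real (waiting_ratio n \<omega>)) / (real n * \<delta>)) (\<lambda>n. real n * \<delta>) e
    (\<lambda>s. pressure P log_ratio s / \<delta>) (\<lambda>s. deriv (pressure P log_ratio) s / \<delta>)"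
proof -
  let ?p = "pressure P log_ratio"
  let ?X = "\<lambda>n \<omega>. ln (enn2real (waiting_ratio n \<omega>)) / (real n * \<delta>)"
  have "\<exists>e. (\<forall>n\<ge>1. 0 < e n \<and> (\<integral>\<^sup>+ \<omega>. powr_ennreal (waiting_ratio n \<omega>) s \<partial>Q) = ennreal (e n))
      \<and> (\<lambda>n. ln (e n) / real n) \<longlonglongrightarrow> ln (perron_root (joint_kernel (1 + min s 1) (- max s (- 1))))" for s
    by (rule ratio_moment_rate[of s]) blast
  then have "\<forall>s. \<exists>e. (\<forall>n\<ge>1. 0 < e n \<and> (\<integral>\<^sup>+ \<omega>. powr_ennreal (waiting_ratio n \<omega>) s \<partial>Q) = ennreal (e n))
      \<and> (\<lambda>n. ln (e n) / real n) \<longlonglongrightarrow> ln (perron_root (joint_kernel (1 + min s 1) (- max s (- 1))))" by blast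
  from choice[OF this] obtain e where e: "\<And>s n. 1 \<le> n \<Longrightarrow> 0 < e s n"
    "\<And>s n. 1 \<le> n \<Longrightarrow> (\<integral>\<^sup>+ \<omega>. powr_ennreal (waiting_ratio n \<omega>) s \<partial>Q) = ennreal (e s n)"
    "\<And>s. (\<lambda>n. ln (e s n) / real n) \<longlonglongrightarrow> ln (perron_root (joint_kernel (1 + min s 1) (- max s (- 1))))"
    by blast
  have "local_ldp Q ?X (\<lambda>n. real n * \<delta>) e (\<lambda>s. ?p s / \<delta>) (\<lambda>s. deriv ?p s / \<delta>)"
    unfolding local_ldp_def local_ldp_axioms_def
  proof (intro conjI allI impI prob_space_Q)
    show "?X n \<in> borel_measurable Q" for n by measurable
    show "0 < real n * \<delta>" if "1 \<le> n" for n using that \<delta> by simp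
    show "filterlim (\<lambda>n. real n * \<delta>) at_top sequentially"
      using filterlim_tendsto_pos_mult_at_top[OF tendsto_const \<delta> filterlim_real_sequentially]
      by (simp add: mult.commute)
    show "0 < e s n" if "1 \<le> n" for s n by (rule e(1)[OF that])
    show "(\<integral>\<^sup>+ \<omega>. ennreal (exp (s * (real n * \<delta>) * ?X n \<omega>)) \<partial>Q) = ennreal (e s n)" if n: "1 \<le> n" for s n
    proof -
      have "(\<integral>\<^sup>+ \<omega>. ennreal (exp (s * (real n * \<delta>) * ?X n \<omega>)) \<partial>Q) = (\<integral>\<^sup>+ \<omega>. powr_ennreal (waiting_ratio n \<omega>) s \<partial>Q)"
      proof (rule nn_integral_cong_AE)
        \<comment> \<open>The real-valued logarithm gives wrong values where the ratio is 0 or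
          \<infinity>; these form a null set.\<close>
        show "AE \<omega> in Q. ennreal (exp (s * (real n * \<delta>) * ?X n \<omega>)) = powr_ennreal (waiting_ratio n \<omega>) s"
          using waiting_ratio_pos_finite[OF n]
        proof eventually_elim
          case (elim \<omega>)
          then have "0 < enn2real (waiting_ratio n \<omega>)"
            by (simp add: enn2real_positive_iff less_top[symmetric] zero_less_iff_neq_zero)
          then show ?case using elim n \<delta> by (auto simp: powr_ennreal_def powr_def)
        qed
      qed
      then show ?thesis using e(2)[OF n] by simp
    qed
    show "(\<lambda>n. ln (e s n) / (real n * \<delta>)) \<longlonglongrightarrow> ?p s / \<delta>" if "s \<in> {-1<..<1}" for s
    proof -
      have "(\<lambda>n. ln (e s n) / real n / \<delta>) \<longlonglongrightarrow> ?p s / \<delta>"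
      proof -
        have "?p s = ln (perron_root (joint_kernel (1 + min s 1) (- max s (- 1))))"
          using that by (intro pressure_eq_joint) auto
        then show ?thesis using \<delta> tendsto_divide[OF e(3)[of s] tendsto_const[of \<delta>]] by simp
      qed
      then show ?thesis by simp
    qed
    show "((\<lambda>s. ?p s / \<delta>) has_real_derivative deriv ?p s / \<delta>) (at s)" for s
      by (intro DERIV_cdivide pressure_deriv(1) X.P_pos)
    show "continuous_on {-1<..<1} (\<lambda>s. deriv ?p s / \<delta>)"
      using \<delta> pressure_deriv(2)[OF X.P_pos]
      by (intro continuous_intros continuous_at_imp_continuous_on) auto
    show "deriv ?p s / \<delta> < deriv ?p r / \<delta>" if "s < r" for s r
      using pressure_strict[OF ne that] \<delta> by (rule divide_strict_right_mono)
    show "?p 0 / \<delta> = 0" using pressure_at_0[OF X.P_pos X.P_sum] by simp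
  qed
  then show ?thesis by (rule that)
qed

lemma ldp_waiting_ratio:
  assumes \<delta>: "0 < \<delta>" and ne: "P \<noteq> P'"
    and J: "is_interval J" "interior J \<noteq> {}"
    and meets: "J \<inter> {deriv (pressure P log_ratio) (- 1) / \<delta><..<deriv (pressure P log_ratio) 1 / \<delta>} \<noteq> {}"
  shows "(\<lambda>n. ereal (1 / (real n * \<delta>)) * ln_ennreal (emeasure Q {\<omega> \<in> space Q.
      ereal (1 / (real n * \<delta>)) * ln_ennreal (waiting_ratio n \<omega>) \<in> ereal ` J}))
    \<longlonglongrightarrow> - (INF q \<in> J \<inter> {deriv (pressure P log_ratio) (- 1) / \<delta><..<deriv (pressure P log_ratio) 1 / \<delta>}.
      legendre_transform (limit_log_moment Q \<delta>) q)"
proof -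
  let ?p = "pressure P log_ratio"
  let ?X = "\<lambda>n \<omega>. ln (enn2real (waiting_ratio n \<omega>)) / (real n * \<delta>)"
  let ?N = "\<lambda>n. real n * \<delta>" and ?g = "\<lambda>s. deriv ?p s / \<delta>"
  obtain e where "local_ldp Q ?X ?N e (\<lambda>s. ?p s / \<delta>) ?g"
    using waiting_ratio_local_ldp[OF \<delta> ne] by blast
  then interpret L: local_ldp Q ?X ?N e "\<lambda>s. ?p s / \<delta>" ?g .
  define A where "A = {u \<in> {-1<..<1}. ?g u \<in> J}"
  have g_cont: "isCont ?g s" for s
    using \<delta> pressure_deriv(2)[OF X.P_pos] by (intro continuous_intros) auto
  have g_strict: "?g s < ?g r" if "s < r" for s r
    using pressure_strict[OF ne that] \<delta> by (rule divide_strict_right_mono)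
  \<comment> \<open>The intermediate value theorem finds a parameter in [-1, 1], and a slope
    strictly between the extreme ones excludes the ends. The converse inclusion is strict
    monotonicity.\<close>
  have slopes: "J \<inter> {?g (- 1)<..<?g 1} = ?g ` A"
  proof (intro set_eqI iffI)
    fix q assume q: "q \<in> J \<inter> {?g (- 1)<..<?g 1}"
    have "\<exists>u\<ge>-1. u \<le> 1 \<and> ?g u = q"
      using q g_cont by (intro IVT) auto
    then obtain u where u: "- 1 \<le> u" "u \<le> 1" "?g u = q" by blast
    then have "u \<in> {-1<..<1}" using q by (auto simp: order_less_le)
    then show "q \<in> ?g ` A" using u q by (auto simp: A_def)
  next
    fix q assume "q \<in> ?g ` A"
    then obtain u where u: "u \<in> {-1<..<1}" "?g u \<in> J" "q = ?g u" by (auto simp: A_def)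
    then show "q \<in> J \<inter> {?g (- 1)<..<?g 1}" using g_strict[of "- 1" u] g_strict[of u 1] by auto
  qed
  have A_ne: "A \<noteq> {}" using meets unfolding slopes by blast
  \<comment> \<open>The tangent at u, evaluated at 0 where the pressure vanishes, is at most 0. The
    rates are thus bounded below and their infimum is a real number.\<close>
  have rate_nonneg: "0 \<le> L.rate_fun u" for u
  proof -
    have "?p u + deriv ?p u * (0 - u) \<le> 0"
      using pressure_tangent[where A = P and b = log_ratio and s = u and r = 0, OF X.P_pos] pressure_at_0[OF X.P_pos X.P_sum] by simp
    then have "(?p u + deriv ?p u * (0 - u)) / \<delta> \<le> 0" using \<delta> by (intro divide_nonpos_pos) auto
    then show ?thesis by (simp add: L.rate_fun_def add_divide_distrib diff_divide_distrib mult.commute)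
  qed
  define i where "i = Inf (L.rate_fun ` A)"
  have bdd: "bdd_below (L.rate_fun ` A)" using rate_nonneg by (auto intro!: bdd_belowI[of _ 0])
  have i_le: "i \<le> L.rate_fun u" if "u \<in> {-1<..<1}" "?g u \<in> J" for u
    unfolding i_def using that by (intro cInf_lower bdd imageI) (auto simp: A_def)
  have i_approx: "\<exists>u\<in>{-1<..<1}. ?g u \<in> J \<and> L.rate_fun u < i + \<eta>" if "0 < \<eta>" for \<eta>
  proof -
    have "Inf (L.rate_fun ` A) < i + \<eta>" using that by (simp add: i_def)
    then obtain u where "u \<in> A" "L.rate_fun u < i + \<eta>"
      using A_ne bdd by (subst (asm) cInf_less_iff) auto
    then show ?thesis by (auto simp: A_def)
  qed
  have "(INF q \<in> J \<inter> {?g (- 1)<..<?g 1}. legendre_transform (limit_log_moment Q \<delta>) q) = (INF u\<in>A. ereal (L.rate_fun u))"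
    unfolding slopes image_image
    by (intro INF_cong refl) (auto simp: A_def legendre_at_slope[OF \<delta>] L.rate_fun_def)
  also have "\<dots> = ereal i"
  proof (rule antisym)
    show "ereal i \<le> (INF u\<in>A. ereal (L.rate_fun u))"
      using i_le by (intro INF_greatest) (auto simp: A_def)
    show "(INF u\<in>A. ereal (L.rate_fun u)) \<le> ereal i"
    proof (rule ereal_le_epsilon2)
      fix \<eta> :: real assume "0 < \<eta>"
      then obtain u where "u \<in> {-1<..<1}" "?g u \<in> J" and u: "L.rate_fun u < i + \<eta>"
        using i_approx by blast
      then have "u \<in> A" by (simp add: A_def)
      with u show "(INF u\<in>A. ereal (L.rate_fun u)) \<le> ereal i + ereal \<eta>"
        by (intro INF_lower2[of u]) auto
    qed
  qed
  finally have inf: "(INF q \<in> J \<inter> {?g (- 1)<..<?g 1}. legendre_transform (limit_log_moment Q \<delta>) q) = ereal i" .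
  have J_borel [measurable]: "J \<in> sets borel" using J(1) by (rule real_interval_borel_measurable)
  let ?E = "\<lambda>n. {\<omega> \<in> space Q. ereal (1 / ?N n) * ln_ennreal (waiting_ratio n \<omega>) \<in> ereal ` J}"
  let ?B = "\<lambda>n. {\<omega> \<in> space Q. ?X n \<omega> \<in> J}"
  \<comment> \<open>The extended-valued event and its real-valued counterpart differ by a null set,
    so \<open>ldp_interval\<close> for the latter decides the former.\<close>
  have event: "emeasure Q (?E n) = emeasure Q (?B n)" if n: "1 \<le> n" for n
  proof (rule emeasure_eq_AE)
    show "AE \<omega> in Q. \<omega> \<in> ?E n \<longleftrightarrow> \<omega> \<in> ?B n"
      using waiting_ratio_pos_finite[OF n]
    proof eventually_elim
      case (elim \<omega>)
      then have "ereal (1 / ?N n) * ln_ennreal (waiting_ratio n \<omega>) = ereal (?X n \<omega>)"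
        by (simp add: ln_ennreal_def)
      then show ?case by auto
    qed
    have "(\<lambda>\<omega>. ereal (1 / ?N n) * ln_ennreal (waiting_ratio n \<omega>)) \<in> borel_measurable Q"
      by measurable
    from measurable_sets[OF this ereal_image_borel[OF J_borel]]
    show "?E n \<in> sets Q" by (simp add: vimage_def Int_def conj_commute)
    show "?B n \<in> sets Q"
      using measurable_sets[OF L.X_meas J_borel, of n] by (simp add: vimage_def Int_def conj_commute)
  qed
  have positive: "\<forall>\<^sub>F n in sequentially. 0 < L.prob (?B n)"
    by (rule L.ldp_interval(1)[OF J i_le i_approx])
  have "(\<lambda>n. ereal (ln (L.prob (?B n)) / ?N n)) \<longlonglongrightarrow> ereal (- i)"
    by (intro tendsto_ereal) (rule L.ldp_interval(2)[OF J i_le i_approx])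
  moreover have "\<forall>\<^sub>F n in sequentially. ereal (ln (L.prob (?B n)) / ?N n) = ereal (1 / ?N n) * ln_ennreal (emeasure Q (?E n))"
    using positive eventually_ge_at_top[of 1]
  proof eventually_elim
    case (elim n)
    have ln_eq: "ln_ennreal (emeasure Q (?E n)) = ereal (ln (L.prob (?B n)))"
    proof -
      have "emeasure Q (?E n) = ennreal (L.prob (?B n))"
        by (rule trans[OF event[OF elim(2)] L.emeasure_eq_measure])
      then have "ln_ennreal (emeasure Q (?E n)) = ln_ennreal (ennreal (L.prob (?B n)))" by (rule arg_cong)
      also have "\<dots> = ereal (ln (L.prob (?B n)))" by (rule ln_ennreal_pos[OF elim(1)])
      finally show ?thesis .
    qed
    show ?case unfolding ln_eq by simp
  qed
  ultimately have "(\<lambda>n. ereal (1 / ?N n) * ln_ennreal (emeasure Q (?E n))) \<longlonglongrightarrow> ereal (- i)"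
    by (rule Lim_transform_eventually)
  then show ?thesis unfolding inf by simp
qed

end

theorem proposition3:
  fixes p :: "'a::finite \<Rightarrow> 'a pmf"
    and c c' :: "'a \<Rightarrow> real"
    and \<mu> \<mu>' :: "'a pmf"
    and M :: "'v measure" and X :: "real \<Rightarrow> 'v \<Rightarrow> 'a"
    and M' :: "'w measure" and Y :: "real \<Rightarrow> 'w \<Rightarrow> 'a"
    and \<delta> :: real
    and Q :: "((nat \<Rightarrow> 'a) \<times> (nat \<Rightarrow> 'a) \<times> (nat \<Rightarrow> 'a)) measure"
    and F :: "real \<Rightarrow> ereal"
  assumes "irreducible_chain p"
    and "\<And>x. pmf (p x) x = 0"
    and "\<And>x. 0 < c x"
    and "\<And>x. 0 < c' x"
    and "stationary_dist (generator c p) \<mu>"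
    and "stationary_dist (generator c' p) \<mu>'"
    and "markov_realization (generator c p) \<mu> M X"
    and "markov_realization (generator c' p) \<mu>' M' Y"
    and "0 < \<delta>"
  defines "Q \<equiv> discretized_law \<delta> M X \<Otimes>\<^sub>M (discretized_law \<delta> M' Y \<Otimes>\<^sub>M discretized_law \<delta> M X)"
    and "F \<equiv> limit_log_moment Q \<delta>"
  shows "(\<forall>s\<in>{-1<..<1}. ((\<lambda>n. scaled_log_moment Q \<delta> n s) \<longlonglongrightarrow> F s) \<and> \<bar>F s\<bar> \<noteq> \<infinity>) \<and>
    real_analytic_on (\<lambda>s. real_of_ereal (F s)) {-1<..<1} \<and>
    convex_on {-1<..<1} (\<lambda>s. real_of_ereal (F s)) \<and>
    (\<exists>c_minus c_plus.
       (deriv (\<lambda>s. real_of_ereal (F s)) \<longlongrightarrow> c_minus) (at_right (-1)) \<and>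
       (deriv (\<lambda>s. real_of_ereal (F s)) \<longlongrightarrow> c_plus) (at_left 1) \<and>
       (c \<noteq> c' \<longrightarrow> c_minus < 0 \<and> 0 < c_plus) \<and>
       (\<forall>J. is_interval J \<longrightarrow> interior J \<noteq> {} \<longrightarrow> J \<inter> {c_minus<..<c_plus} \<noteq> {} \<longrightarrow>
          (\<lambda>n. ereal (1 / (real n * \<delta>)) *
                 ln_ennreal (emeasure Q {\<omega> \<in> space Q.
                   ereal (1 / (real n * \<delta>)) * ln_ennreal (waiting_ratio n \<omega>) \<in> ereal ` J}))
          \<longlonglongrightarrow> - (INF q \<in> J \<inter> {c_minus<..<c_plus}. legendre_transform F q)))"
proof -
  let ?P = "transition_prob (generator c p) \<delta>" and ?P' = "transition_prob (generator c' p) \<delta>"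
  interpret T: two_chains ?P ?P' "pmf \<mu>" "pmf \<mu>'" "discretized_law \<delta> M X" "discretized_law \<delta> M' Y"
    unfolding two_chains_def
    by (intro conjI discretized_stationary_chain[OF assms(1,3,5,7,9)] discretized_stationary_chain[OF assms(1,4,6,8,9)])
  let ?p = "pressure ?P (\<lambda>x y. ln (?P x y / ?P' x y))"
  note \<delta> = \<open>0 < \<delta>\<close>
  have Q: "Q = T.Q" by (simp add: Q_def T.Q_def)
  have F_real: "real_of_ereal (F s) = ?p s / \<delta>" if "s \<in> {-1<..<1}" for s
    using that by (simp add: F_def Q T.limit_log_moment_eq[OF \<delta>] T.pressure_eq_joint)
  have ne: "?P \<noteq> ?P'" if "c \<noteq> c'"
    using transition_prob_inject[OF assms(1-6) \<delta>] that by blast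
  have limit: "\<forall>s\<in>{-1<..<1}. ((\<lambda>n. scaled_log_moment Q \<delta> n s) \<longlonglongrightarrow> F s) \<and> \<bar>F s\<bar> \<noteq> \<infinity>"
  proof (intro ballI conjI)
    fix s
    have F_eq: "F s = ereal (ln (perron_root (T.joint_kernel (1 + min s 1) (- max s (- 1)))) / \<delta>)"
      unfolding F_def Q by (rule T.limit_log_moment_eq[OF \<delta>])
    show "(\<lambda>n. scaled_log_moment Q \<delta> n s) \<longlonglongrightarrow> F s"
      unfolding F_eq unfolding Q by (rule T.scaled_log_moment_limit[OF \<delta>])
    show "\<bar>F s\<bar> \<noteq> \<infinity>" unfolding F_eq by simp
  qed
  have analytic: "real_analytic_on (\<lambda>s. real_of_ereal (F s)) {-1<..<1}"
    by (rule real_analytic_on_scaled_cong[OF pressure_analytic[OF T.X.P_pos] _ F_real]) auto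
  have convex: "convex_on {-1<..<1} (\<lambda>s. real_of_ereal (F s))"
  proof -
    have "convex_on {-1<..<1} (\<lambda>s. (1 / \<delta>) * ?p s)"
      using \<delta> by (intro convex_on_cmul convex_on_subset[OF pressure_convex[OF T.X.P_pos]]) auto
    then have "convex_on {-1<..<1} (\<lambda>s. ?p s / \<delta>)" by simp
    then show ?thesis
      by (rule convex_on_eq_on) (rule F_real, assumption)
  qed
  have deriv_F: "deriv (\<lambda>s. real_of_ereal (F s)) s = deriv ?p s / \<delta>" if s: "s \<in> {-1<..<1}" for s
  proof (rule DERIV_imp_deriv, rule has_field_derivative_transform_within_open)
    show "((\<lambda>s. ?p s / \<delta>) has_real_derivative deriv ?p s / \<delta>) (at s)"
      by (intro DERIV_cdivide pressure_deriv(1) T.X.P_pos)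
    show "?p r / \<delta> = real_of_ereal (F r)" if "r \<in> {-1<..<1}" for r by (rule F_real[OF that, symmetric])
  qed (use s in auto)
  have cont: "isCont (\<lambda>s. deriv ?p s / \<delta>) s" for s
    using \<delta> pressure_deriv(2)[OF T.X.P_pos] by (intro continuous_intros) auto
  have left: "(deriv (\<lambda>s. real_of_ereal (F s)) \<longlongrightarrow> deriv ?p (- 1) / \<delta>) (at_right (- 1))"
  proof (rule Lim_transform_eventually)
    show "((\<lambda>s. deriv ?p s / \<delta>) \<longlongrightarrow> deriv ?p (- 1) / \<delta>) (at_right (- 1))"
      using cont[of "- 1"] unfolding isCont_def by (rule tendsto_within_subset) simp
    show "\<forall>\<^sub>F s in at_right (- 1). deriv ?p s / \<delta> = deriv (\<lambda>s. real_of_ereal (F s)) s"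
      unfolding eventually_at_right_field by (rule exI[of _ 1]) (auto simp: deriv_F)
  qed
  have right: "(deriv (\<lambda>s. real_of_ereal (F s)) \<longlongrightarrow> deriv ?p 1 / \<delta>) (at_left 1)"
  proof (rule Lim_transform_eventually)
    show "((\<lambda>s. deriv ?p s / \<delta>) \<longlongrightarrow> deriv ?p 1 / \<delta>) (at_left 1)"
      using cont[of 1] unfolding isCont_def by (rule tendsto_within_subset) simp
    show "\<forall>\<^sub>F s in at_left 1. deriv ?p s / \<delta> = deriv (\<lambda>s. real_of_ereal (F s)) s"
      unfolding eventually_at_left_field by (rule exI[of _ "- 1"]) (auto simp: deriv_F)
  qed
  have sign: "deriv ?p (- 1) / \<delta> < 0 \<and> 0 < deriv ?p 1 / \<delta>" if "c \<noteq> c'"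
    using T.pressure_deriv_sign[OF ne[OF that]] \<delta> by (simp add: divide_neg_pos)
  \<comment> \<open>For equal rates the tilt is trivial and both extreme slopes are 0, so no
    interval J meets the empty interval between them.\<close>
  have degenerate: "deriv ?p s = 0" if "c = c'" for s
  proof -
    have "?p s = 0" for s
    proof -
      have "tilted ?P (\<lambda>x y. ln (?P x y / ?P' x y)) s = ?P"
        using T.X.P_pos that by (intro ext) (simp add: tilted_def less_imp_neq[symmetric])
      then show ?thesis
        using perron_root_stochastic[OF T.X.P_pos T.X.P_sum] by (simp add: pressure_def)
    qed
    then have "?p = (\<lambda>_. 0)" by blast
    then show ?thesis by simp
  qed
  have ldp: "(\<lambda>n. ereal (1 / (real n * \<delta>)) *
                 ln_ennreal (emeasure Q {\<omega> \<in> space Q.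
                   ereal (1 / (real n * \<delta>)) * ln_ennreal (waiting_ratio n \<omega>) \<in> ereal ` J}))
          \<longlonglongrightarrow> - (INF q \<in> J \<inter> {deriv ?p (- 1) / \<delta><..<deriv ?p 1 / \<delta>}. legendre_transform F q)"
    if J: "is_interval J" "interior J \<noteq> {}" "J \<inter> {deriv ?p (- 1) / \<delta><..<deriv ?p 1 / \<delta>} \<noteq> {}" for J
  proof -
    have "c \<noteq> c'" using J(3) degenerate by auto
    then show ?thesis
      unfolding F_def Q using T.ldp_waiting_ratio[OF \<delta> ne J] by blast
  qed
  show ?thesis
    using limit analytic convex left right sign ldp by blast
qed

end
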